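(* Assume that $\alpha\in(1,2)$ and let $\mathbb x=\mathbb x^{(\alpha)}$. Almost surely: (i) $\mathscr T_{\mathbb x}$ is binary, i.e. $\deg(v)\in\{1,2,3\}$ for all $v\in\mathscr T_{\mathbb x}$; (ii) if $\mathcal L(\mathscr T_{\mathbb x})=\{v\in\mathscr T_{\mathbb x}:\deg(v)=1\}$ denotes the set of leaves, then $\overline{\mathcal L(\mathscr T_{\mathbb x})}=\mathscr T_{\mathbb x}$; (iii) $\mu_{\mathbb x}$ is non-atomic and charges the leaves of $\mathscr T_{\mathbb x}$, i.e. $\mu_{\mathbb x}(\mathcal L(\mathscr T_{\mathbb x}))=1$.
   Context: $\mathbb x^{(\alpha)}$ is the normalized excursion of the spectrally positive $\alpha$-stable Lévy process $X$ with $\mathbb E[e^{-\lambda X_t}]=e^{t\lambda^\alpha}$ ($t,\lambda>0$), i.e. an excursion of $X$ above its past infimum conditioned to have unit length; concretely, with $I_t=\inf_{[0,t]}X$, $(g,d)$ the excursion interval of $X-I$ straddling time $1$ and $\zeta=d-g$, $\mathbb x(t)=\zeta^{-1/\alpha}(X-I)_{g+\zeta t}$ for $t\in[0,1]$. It is a random càdlàg function $[0,1]\to[0,\infty)$ vanishing at $0$ and $1$. For continuous $f:[0,1]\to[0,\infty)$ with $f(0)=f(1)=0$, let $d_f(s,t)=f(s)+f(t)-2\inf_{[s\wedge t,s\vee t]}f$; $\mathscr T_f$ is the quotient of $[0,1]$ by $\{d_f=0\}$ with the metric $d_f$, rooted at the class of $0$, and $\pi_f:[0,1]\to\mathscr T_f$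 is the canonical projection. For càdlàg $x:[0,1]\to[0,\infty)$ with $x(0)=x(1)=0$ (convention $x(0-)=x(0)$), the completed graph $\Gamma_x=\{(\lambda x(t-)+(1-\lambda)x(t),t):(t,\lambda)\in[0,1]^2\}$ is ordered by $(z_1,t_1)\le(z_2,t_2)$ iff $t_1<t_2$, or $t_1=t_2$ and $|z_1-x(t_1-)|\le|z_2-x(t_2-)|$; a parametric representation of $x$ is a non-decreasing continuous onto map $(\chi,\tau):[0,1]\to\Gamma_x$. The measured $\mathbb R$-tree $(\mathscr T_x,\mu_x)$ is the isometry class of $(\mathscr T_\chi,\mu_{(\chi,\tau)})$ for any parametric representation $(\chi,\tau)$, where $\mu_{(\chi,\tau)}$ is the law of $\pi_\chi(\tau^{-1}(U))$ with $U$ uniform on $[0,1]$ and $\tau^{-1}$ the right-continuous inverse of $\tau$ (independent of the choice of $(\chi,\tau)$). The degree $\deg(v)$ of a point $v\in\mathscr T$ of an $\mathbb R$-tree is the number of connected components of $\mathscr T\setminus\{v\}$. *)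

theory Defs
  imports "HOL-Probability.Probability"
begin

section \<open>Spectrally positive stable Levy processes\<close>

definition cadlag_on_halfline :: "(real \<Rightarrow> real) \<Rightarrow> bool" where
  "cadlag_on_halfline p \<longleftrightarrow>
     (\<forall>t\<ge>0. (p \<longlongrightarrow> p t) (at_right t)) \<and>
     (\<forall>t>0. \<exists>l. (p \<longlongrightarrow> l) (at_left t))"

text \<open>The value of a process at times \<open>t < 0\<close> is irrelevant throughout.\<close>

definition levy_process :: "'a measure \<Rightarrow> (real \<Rightarrow> 'a \<Rightarrow> real) \<Rightarrow> bool" where
  "levy_process M X \<longleftrightarrow>
     prob_space M \<and>
     (\<forall>t\<ge>0. X t \<in> borel_measurable M) \<and>
     (AE \<omega> in M. X 0 \<omega> = 0) \<and>
     (AE \<omega> in M. cadlag_on_halfline (\<lambda>t. X t \<omega>)) \<and>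
     (\<forall>(n::nat) (t::nat \<Rightarrow> real). 0 \<le> t 0 \<longrightarrow> (\<forall>i<n. t i \<le> t (Suc i)) \<longrightarrow>
        prob_space.indep_vars M (\<lambda>_. borel) (\<lambda>i \<omega>. X (t (Suc i)) \<omega> - X (t i) \<omega>) {..<n}) \<and>
     (\<forall>s\<ge>0. \<forall>h\<ge>0. distr M borel (\<lambda>\<omega>. X (s + h) \<omega> - X s \<omega>) = distr M borel (X h))"

definition left_lim :: "(real \<Rightarrow> real) \<Rightarrow> real \<Rightarrow> real" where
  "left_lim x t = (if t = 0 then x 0 else Lim (at_left t) x)"

definition spectrally_positive :: "'a measure \<Rightarrow> (real \<Rightarrow> 'a \<Rightarrow> real) \<Rightarrow> bool" where
  "spectrally_positive M X \<longleftrightarrow> (AE \<omega> in M. \<forall>t>0. left_lim (\<lambda>s. X s \<omega>) t \<le> X t \<omega>)"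

text \<open>Equality in law of the whole processes, on the product \<open>\<sigma>\<close>-algebra over \<open>[0,\<infinity>)\<close>.\<close>

definition stable_scaling :: "'a measure \<Rightarrow> real \<Rightarrow> (real \<Rightarrow> 'a \<Rightarrow> real) \<Rightarrow> bool" where
  "stable_scaling M \<alpha> X \<longleftrightarrow>
     (\<forall>c>0. distr M (\<Pi>\<^sub>M t\<in>{0..}. borel) (\<lambda>\<omega>. \<lambda>t\<in>{0..}. X (c * t) \<omega>) =
            distr M (\<Pi>\<^sub>M t\<in>{0..}. borel) (\<lambda>\<omega>. \<lambda>t\<in>{0..}. c powr (1 / \<alpha>) * X t \<omega>))"

definition spectrally_positive_stable_levy ::
    "'a measure \<Rightarrow> real \<Rightarrow> (real \<Rightarrow> 'a \<Rightarrow> real) \<Rightarrow> bool" where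
  "spectrally_positive_stable_levy M \<alpha> X \<longleftrightarrow>
     levy_process M X \<and> spectrally_positive M X \<and> stable_scaling M \<alpha> X \<and>
     (\<forall>t>0. \<forall>q>0. integrable M (\<lambda>\<omega>. exp (- q * X t \<omega>)) \<and>
        (\<integral>\<omega>. exp (- q * X t \<omega>) \<partial>M) = exp (t * q powr \<alpha>))"


section \<open>The normalized excursion\<close>

definition above_past_inf :: "(real \<Rightarrow> real) \<Rightarrow> real \<Rightarrow> real" where
  "above_past_inf p t = p t - (INF s\<in>{0..t}. p s)"

definition exc_left :: "(real \<Rightarrow> real) \<Rightarrow> real" where
  "exc_left p = Sup {t \<in> {0..1}. above_past_inf p t = 0}"

definition exc_right :: "(real \<Rightarrow> real) \<Rightarrow> real" where
  "exc_right p = Inf {t \<in> {1..}. above_past_inf p t = 0}"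

definition normalized_excursion :: "real \<Rightarrow> (real \<Rightarrow> real) \<Rightarrow> real \<Rightarrow> real" where
  "normalized_excursion \<alpha> p t =
     (let g = exc_left p; \<zeta> = exc_right p - g
      in \<zeta> powr (- 1 / \<alpha>) * above_past_inf p (g + \<zeta> * t))"


section \<open>Trees coded by continuous functions\<close>

definition code_dist :: "(real \<Rightarrow> real) \<Rightarrow> real \<Rightarrow> real \<Rightarrow> real" where
  "code_dist f s t = f s + f t - 2 * (INF u\<in>{min s t..max s t}. f u)"

definition tree_proj :: "(real \<Rightarrow> real) \<Rightarrow> real \<Rightarrow> real set" where
  "tree_proj f s = {t \<in> {0..1}. code_dist f s t = 0}"

definition tree_points :: "(real \<Rightarrow> real) \<Rightarrow> real set set" where
  "tree_points f = {0..1} // {(s, t). s \<in> {0..1} \<and> t \<in> {0..1} \<and> code_dist f s t = 0}"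

text \<open>The value \<open>0\<close> off \<open>tree_points f\<close> is there because the locale \<open>Metric_space\<close> demands
  symmetry and non-negativity for all arguments, not only for points of the carrier.\<close>

definition tree_dist :: "(real \<Rightarrow> real) \<Rightarrow> real set \<Rightarrow> real set \<Rightarrow> real" where
  "tree_dist f A B =
     (if A \<in> tree_points f \<and> B \<in> tree_points f
      then code_dist f (SOME s. s \<in> A) (SOME t. t \<in> B) else 0)"

definition tree_top :: "(real \<Rightarrow> real) \<Rightarrow> real set topology" where
  "tree_top f = Metric_space.mtopology (tree_points f) (tree_dist f)"

definition tree_borel :: "(real \<Rightarrow> real) \<Rightarrow> real set measure" where
  "tree_borel f = sigma (tree_points f) {U. openin (tree_top f) U}"

lemma tree_points_eq: "tree_points f = tree_proj f ` {0..1}"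
  by (auto simp: tree_points_def tree_proj_def quotient_def)

lemma code_dist_triangle:
  assumes "continuous_on {0..1} f" and "r \<in> {0..1}" "s \<in> {0..1}" "t \<in> {0..1}"
  shows "code_dist f s t \<le> code_dist f s r + code_dist f r t"
proof -
  define m where "m a b = (INF u\<in>{min a b..max a b}. f u)" for a b
  have att: "\<exists>u\<in>{min a b..max a b}. f u = m a b \<and> (\<forall>v\<in>{min a b..max a b}. m a b \<le> f v)"
    if "a \<in> {0..1}" "b \<in> {0..1}" for a b
  proof -
    have "continuous_on {min a b..max a b} f"
      by (rule continuous_on_subset[OF assms(1)]) (use that in auto)
    moreover have "{min a b..max a b} \<noteq> {}" by auto
    ultimately obtain u where u: "u \<in> {min a b..max a b}" "\<forall>v\<in>{min a b..max a b}. f u \<le> f v"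
      using continuous_attains_inf[of "{min a b..max a b}" f] by auto
    have "m a b = f u"
      unfolding m_def by (rule cInf_eq_minimum) (use u in auto)
    with u show ?thesis by auto
  qed
  obtain u where u: "u \<in> {min s t..max s t}" "f u = m s t"
    using att[OF assms(3,4)] by auto
  have "u \<in> {min s r..max s r} \<or> u \<in> {min r t..max r t}"
    using u(1) by (auto simp: min_def max_def split: if_splits)
  then have "m s r \<le> m s t \<or> m r t \<le> m s t"
    using att[OF assms(3,2)] att[OF assms(2,4)] u(2) by metis
  moreover have "m s r \<le> f r" "m r t \<le> f r"
    using att[OF assms(3,2)] att[OF assms(2,4)] by auto
  ultimately show ?thesis unfolding code_dist_def m_def[symmetric] by linarith
qed

lemma code_dist_nonneg:
  assumes "continuous_on {0..1} f" and "s \<in> {0..1}" "t \<in> {0..1}"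
  shows "0 \<le> code_dist f s t"
proof -
  have sym: "code_dist f t s = code_dist f s t"
    by (simp add: code_dist_def min.commute max.commute)
  have "code_dist f s s = 0" by (simp add: code_dist_def)
  with code_dist_triangle[OF assms(1) assms(3) assms(2) assms(2)] sym show ?thesis by linarith
qed

lemma tree_dist_proj:
  assumes "continuous_on {0..1} f" and "s \<in> {0..1}" "t \<in> {0..1}"
  shows "tree_dist f (tree_proj f s) (tree_proj f t) = code_dist f s t"
proof -
  have sym: "code_dist f a b = code_dist f b a" for a b
    by (simp add: code_dist_def min.commute max.commute)
  have r: "(SOME v. v \<in> tree_proj f u) \<in> tree_proj f u" if "u \<in> {0..1}" for u
    by (rule someI[of _ u]) (use that in \<open>auto simp: tree_proj_def code_dist_def\<close>)
  define a where "a = (SOME v. v \<in> tree_proj f s)"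
  define b where "b = (SOME v. v \<in> tree_proj f t)"
  have a: "a \<in> {0..1}" "code_dist f s a = 0" using r[OF assms(2)] by (auto simp: a_def tree_proj_def)
  have b: "b \<in> {0..1}" "code_dist f t b = 0" using r[OF assms(3)] by (auto simp: b_def tree_proj_def)
  note tri = code_dist_triangle[OF assms(1)]
  have "code_dist f a b = code_dist f s t"
    using tri[OF assms(2) a(1) b(1)] tri[OF assms(3) assms(2) b(1)]
      tri[OF a(1) assms(2,3)] tri[OF b(1) a(1) assms(3)] a b sym[of s a] sym[of t b]
    by linarith
  then show ?thesis
    using assms(2,3) by (simp add: tree_dist_def tree_points_eq a_def b_def)
qed

lemma Metric_space_tree:
  assumes f: "continuous_on {0..1} f"
  shows "Metric_space (tree_points f) (tree_dist f)"
proof -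
  have sym: "code_dist f a b = code_dist f b a" for a b
    by (simp add: code_dist_def min.commute max.commute)
  show ?thesis
  proof
    show "0 \<le> tree_dist f A B" for A B
    proof (cases "A \<in> tree_points f \<and> B \<in> tree_points f")
      case True
      then show ?thesis
        using code_dist_nonneg[OF f] by (auto simp: tree_points_eq tree_dist_proj[OF f])
    qed (auto simp: tree_dist_def)
    show "tree_dist f A B = tree_dist f B A" for A B
      by (simp add: tree_dist_def sym)
    show "tree_dist f A B = 0 \<longleftrightarrow> A = B" if AB: "A \<in> tree_points f" "B \<in> tree_points f" for A B
    proof -
      obtain s t where st: "s \<in> {0..1}" "t \<in> {0..1}" "A = tree_proj f s" "B = tree_proj f t"
        using AB by (auto simp: tree_points_eq)
      have "tree_proj f s = tree_proj f t" if z: "code_dist f s t = 0"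
      proof -
        have "code_dist f s u = 0 \<longleftrightarrow> code_dist f t u = 0" if u: "u \<in> {0..1}" for u
          using code_dist_triangle[OF f st(2) st(1) u] code_dist_triangle[OF f st(1) st(2) u]
            code_dist_nonneg[OF f st(1) u] code_dist_nonneg[OF f st(2) u] z sym[of s t]
          by linarith
        then show ?thesis by (auto simp: tree_proj_def)
      qed
      moreover have "code_dist f s t = 0" if e: "tree_proj f s = tree_proj f t"
      proof -
        have "t \<in> tree_proj f t" using st(2) by (simp add: tree_proj_def code_dist_def)
        with e show ?thesis by (auto simp: tree_proj_def)
      qed
      ultimately show ?thesis using st tree_dist_proj[OF f st(1,2)] by auto
    qed
    show "tree_dist f A C \<le> tree_dist f A B + tree_dist f B C"
      if "A \<in> tree_points f" "B \<in> tree_points f" "C \<in> tree_points f" for A B C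
      using that code_dist_triangle[OF f] by (auto simp: tree_points_eq tree_dist_proj[OF f])
  qed
qed

definition tree_degree :: "(real \<Rightarrow> real) \<Rightarrow> real set \<Rightarrow> enat" where
  "tree_degree f v =
     (let C = connected_components_of (subtopology (tree_top f) (tree_points f - {v}))
      in if finite C then enat (card C) else \<infinity>)"

definition tree_leaves :: "(real \<Rightarrow> real) \<Rightarrow> real set set" where
  "tree_leaves f = {v \<in> tree_points f. tree_degree f v = 1}"


section \<open>Measured trees coded by cadlag functions\<close>

definition completed_graph :: "(real \<Rightarrow> real) \<Rightarrow> (real \<times> real) set" where
  "completed_graph x =
     {(l * left_lim x t + (1 - l) * x t, t) | t l. t \<in> {0..1} \<and> l \<in> {0..1}}"

definition graph_le :: "(real \<Rightarrow> real) \<Rightarrow> real \<times> real \<Rightarrow> real \<times> real \<Rightarrow> bool" where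
  "graph_le x p q \<longleftrightarrow>
     snd p < snd q \<or>
     snd p = snd q \<and> \<bar>fst p - left_lim x (snd p)\<bar> \<le> \<bar>fst q - left_lim x (snd q)\<bar>"

definition parametric_representation ::
    "(real \<Rightarrow> real) \<Rightarrow> (real \<Rightarrow> real) \<Rightarrow> (real \<Rightarrow> real) \<Rightarrow> bool" where
  "parametric_representation x \<xi> \<tau> \<longleftrightarrow>
     continuous_on {0..1} (\<lambda>s. (\<xi> s, \<tau> s)) \<and>
     monotone_on {0..1} (\<le>) (graph_le x) (\<lambda>s. (\<xi> s, \<tau> s)) \<and>
     (\<lambda>s. (\<xi> s, \<tau> s)) ` {0..1} = completed_graph x"

text \<open>Inserting \<open>1\<close> only fixes the value at the right end point, \<open>right_inverse \<tau> 1 = 1\<close>.\<close>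

definition right_inverse :: "(real \<Rightarrow> real) \<Rightarrow> real \<Rightarrow> real" where
  "right_inverse \<tau> u = Inf (insert 1 {s \<in> {0..1}. u < \<tau> s})"

definition tree_measure :: "(real \<Rightarrow> real) \<Rightarrow> (real \<Rightarrow> real) \<Rightarrow> real set measure" where
  "tree_measure \<xi> \<tau> =
     distr (uniform_measure lborel {0..1}) (tree_borel \<xi>)
       (\<lambda>u. tree_proj \<xi> (right_inverse \<tau> u))"

end

theory Submission
  imports Defs
begin

text \<open>
  The theorem splits into a deterministic part, which lists the properties that the path of the
  process must have, and a probabilistic part, which shows that almost every path has them.

  For a continuous \<open>f\<close> a point \<open>v\<close> of the coded tree is a set of times at one level \<open>h\<close>, between
  any two of which \<open>f\<close> stays above \<open>h\<close>.  Two points of the tree are in one component of the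
  complement of \<open>v\<close> as soon as a time interval joins them without meeting this set, or as soon as
  both can descend below \<open>h\<close> on the outer sides of the set, since then they reach a common ancestor
  (\<open>disconnected_imp_above\<close>).  Consequently four components force two local minima of \<open>f\<close> at the
  same level, separated by a strict excursion above that level and with no lower value in between.
  By the same principle, \<open>v\<close> is a leaf when \<open>f\<close> drops below \<open>h\<close> at once on both sides of the set.

  A parametric representation \<open>(\<xi>, \<tau>)\<close> of a cadlag path \<open>x\<close> with upward jumps replaces each jump by
  an increasing piece, so that no local minimum lies inside a jump.  Equal minima of \<open>\<xi>\<close> are
  therefore equal minima of \<open>x\<close>, and a time \<open>u\<close> at which \<open>x\<close> dips below \<open>x u\<close> immediately before
  and after \<open>u\<close> is mapped to a leaf that no other time is mapped to.  If almost all times are of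
  this kind, the image of Lebesgue measure charges the leaves and has no atoms.  The leaves are then
  also dense: a value in the middle of a jump is met again later on the way down to \<open>x 1 = 0\<close>, and
  there, outside the jumps, times of this kind accumulate.

  Three facts about a stable process remain.  First, infima over two disjoint intervals with rational
  end points differ: the difference of the infima is the increment over the gap plus an
  independent variable, and increments have no atoms.  The latter holds because, by scaling, the
  law of an increment and its convolution square have atoms of the same sizes, so that an atom would
  make the increment bounded, against the growth of the Laplace transform.  Secondly, each fixed time is almost surely a dip, and the path is unbounded
  below: along times \<open>T \<rho>\<^sup>k\<close> with small \<open>\<rho>\<close> the process is governed by
  independent increments, each of which has the wanted sign with a probability bounded below
  (\<open>geometric_times\<close>).  Fubini's theorem turns fixed times into almost all times.  Thirdly, the process
  does not jump at the fixed time \<open>1\<close>, so that this time is interior to an excursion.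
\<close>

section \<open>The projection onto the tree of a continuous function\<close>

locale coding_function =
  fixes f :: "real \<Rightarrow> real"
  assumes cont: "continuous_on {0..1} f"
begin

sublocale tree: Metric_space "tree_points f" "tree_dist f"
  by (rule Metric_space_tree[OF cont])

text \<open>The infimum in \<open>code_dist\<close> is a minimum, hence a value of \<open>f\<close> to which the intermediate value
  theorem can be applied.\<close>
lemma inf_attained:
  assumes "0 \<le> a" "a \<le> b" "b \<le> 1"
  obtains u where "u \<in> {a..b}" "f u = (INF u\<in>{a..b}. f u)" "\<And>v. v \<in> {a..b} \<Longrightarrow> f u \<le> f v"
proof -
  have "continuous_on {a..b} f"
    by (rule continuous_on_subset[OF cont]) (use assms in auto)
  moreover have "{a..b} \<noteq> {}" using assms by auto
  ultimately obtain u where u: "u \<in> {a..b}" "\<forall>v\<in>{a..b}. f u \<le> f v"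
    using continuous_attains_inf[of "{a..b}" f] by auto
  have "f u = (INF u\<in>{a..b}. f u)"
    by (rule cInf_eq_minimum[symmetric]) (use u in auto)
  with u that show ?thesis by blast
qed

lemma code_dist_commute: "code_dist f a b = code_dist f b a"
  by (simp add: code_dist_def min.commute max.commute)

lemma code_dist_self [simp]: "code_dist f a a = 0"
  by (simp add: code_dist_def)

text \<open>Both summands of \<open>(f s - m) + (f t - m)\<close>, with \<open>m\<close> the minimum between \<open>s\<close> and \<open>t\<close>, are
  nonnegative.\<close>
lemma code_dist_eq_0_iff:
  assumes "0 \<le> s" "s \<le> t" "t \<le> 1"
  shows "code_dist f s t = 0 \<longleftrightarrow> f s = f t \<and> (\<forall>u\<in>{s..t}. f s \<le> f u)"
proof -
  obtain w where w: "w \<in> {s..t}" "f w = (INF u\<in>{s..t}. f u)" "\<And>v. v \<in> {s..t} \<Longrightarrow> f w \<le> f v"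
    using inf_attained[OF assms] by metis
  have eq: "code_dist f s t = (f s - f w) + (f t - f w)"
    using assms w(2) by (simp add: code_dist_def)
  have "f w \<le> f s" "f w \<le> f t" using w(3) assms by auto
  then have "code_dist f s t = 0 \<longleftrightarrow> f s = f w \<and> f t = f w" using eq by linarith
  moreover have "f s = f w \<and> f t = f w \<longleftrightarrow> f s = f t \<and> (\<forall>u\<in>{s..t}. f s \<le> f u)"
  proof
    assume "f s = f w \<and> f t = f w" then show "f s = f t \<and> (\<forall>u\<in>{s..t}. f s \<le> f u)" using w(3) by simp
  next
    assume a: "f s = f t \<and> (\<forall>u\<in>{s..t}. f s \<le> f u)"
    then have "f s \<le> f w" using w(1) by blast
    with a \<open>f w \<le> f s\<close> show "f s = f w \<and> f t = f w" by linarith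
  qed
  ultimately show ?thesis by blast
qed

lemma tree_proj_eq_iff:
  assumes "s \<in> {0..1}" "t \<in> {0..1}"
  shows "tree_proj f s = tree_proj f t \<longleftrightarrow> code_dist f s t = 0"
proof -
  have "tree_proj f s \<in> tree_points f" "tree_proj f t \<in> tree_points f"
    using assms by (auto simp: tree_points_eq)
  then show ?thesis using tree.zero tree_dist_proj[OF cont assms] by metis
qed

lemma tree_proj_in [simp, intro]: "s \<in> {0..1} \<Longrightarrow> tree_proj f s \<in> tree_points f"
  by (auto simp: tree_points_eq)

lemma tree_proj_eqI:
  assumes "0 \<le> s" "s \<le> t" "t \<le> 1" "f s = h" "f t = h" "\<And>u. s \<le> u \<Longrightarrow> u \<le> t \<Longrightarrow> h \<le> f u"
  shows "tree_proj f s = tree_proj f t"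
  using assms code_dist_eq_0_iff[of s t] by (subst tree_proj_eq_iff) auto

lemma tree_proj_eqD:
  assumes "s \<in> {0..1}" "t \<in> {0..1}" "tree_proj f s = tree_proj f t"
  shows "f s = f t" and "\<And>u. min s t \<le> u \<Longrightarrow> u \<le> max s t \<Longrightarrow> f s \<le> f u"
proof -
  have 0: "code_dist f s t = 0" "code_dist f t s = 0"
    using assms tree_proj_eq_iff by (auto simp: code_dist_commute)
  have *: "f a = f b \<and> (\<forall>u\<in>{a..b}. f a \<le> f u)" if "0 \<le> a" "a \<le> b" "b \<le> 1" "code_dist f a b = 0" for a b
    using code_dist_eq_0_iff[of a b] that by blast
  have **: "f s = f t \<and> (\<forall>u\<in>{min s t..max s t}. f s \<le> f u)"
  proof (cases "s \<le> t")
    case True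
    then have mm: "min s t = s" "max s t = t" by simp_all
    show ?thesis unfolding mm by (rule *) (use 0 True assms in simp_all)
  next
    case False
    then have mm: "min s t = t" "max s t = s" by simp_all
    have "f t = f s \<and> (\<forall>u\<in>{t..s}. f t \<le> f u)" by (rule *) (use 0 False assms in simp_all)
    then show ?thesis unfolding mm by metis
  qed
  then show "f s = f t" by blast
  show "f s \<le> f u" if "min s t \<le> u" "u \<le> max s t" for u
    using **[THEN conjunct2, rule_format, OF atLeastAtMost_iff[THEN iffD2, OF conjI, OF that]] .
qed

text \<open>Near \<open>s\<close> the values of \<open>f\<close>, and hence their infima, are close to \<open>f s\<close>.\<close>
lemma code_dist_small:
  assumes s: "s \<in> {0..1}" and e: "e > 0"
  obtains \<delta> where "\<delta> > 0" "\<And>t. t \<in> {0..1} \<Longrightarrow> \<bar>t - s\<bar> < \<delta> \<Longrightarrow> code_dist f s t < e"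
proof -
  obtain \<delta> where \<delta>: "\<delta> > 0" "\<And>t. t \<in> {0..1} \<Longrightarrow> dist t s < \<delta> \<Longrightarrow> dist (f t) (f s) < e / 4"
    using cont[unfolded continuous_on_iff, rule_format, OF s, of "e/4"] e by auto
  have "code_dist f s t < e" if t: "t \<in> {0..1}" "\<bar>t - s\<bar> < \<delta>" for t
  proof -
    obtain w where w: "w \<in> {min s t..max s t}" "f w = (INF u\<in>{min s t..max s t}. f u)"
      using inf_attained[of "min s t" "max s t"] s t by force
    have "0 \<le> w" "w \<le> 1" "\<bar>w - s\<bar> < \<delta>" using w(1) s t by (cases "s \<le> t"; simp)+
    then have "w \<in> {0..1}" by simp
    with \<open>\<bar>w - s\<bar> < \<delta>\<close> have "\<bar>f w - f s\<bar> < e/4" "\<bar>f t - f s\<bar> < e/4" using \<delta>(2) t by (auto simp: dist_real_def)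
    then show ?thesis unfolding code_dist_def w(2)[symmetric] using e by linarith
  qed
  with \<delta>(1) that show ?thesis by blast
qed

lemma tree_topspace [simp]: "topspace (tree_top f) = tree_points f"
  by (simp add: tree_top_def)

lemma openin_tree_top:
  "openin (tree_top f) U \<longleftrightarrow>
     U \<subseteq> tree_points f \<and> (\<forall>x\<in>U. \<exists>r>0. \<forall>y\<in>tree_points f. tree_dist f x y < r \<longrightarrow> y \<in> U)"
  unfolding tree_top_def tree.openin_mtopology tree.mball_def by blast

lemma continuous_map_tree_proj:
  "continuous_map (top_of_set {0..1}) (tree_top f) (tree_proj f)"
  unfolding continuous_map_def
proof (intro conjI allI impI)
  show "tree_proj f \<in> topspace (top_of_set {0..1}) \<rightarrow> topspace (tree_top f)" by auto
  fix U assume U: "openin (tree_top f) U"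
  show "openin (top_of_set {0..1}) {x \<in> topspace (top_of_set {0..1}). tree_proj f x \<in> U}"
    unfolding openin_euclidean_subtopology_iff
  proof (intro conjI ballI)
    fix s assume "s \<in> {x \<in> topspace (top_of_set {0..1}). tree_proj f x \<in> U}"
    then have s: "s \<in> {0..1}" "tree_proj f s \<in> U" by auto
    then obtain r where r: "r > 0" "\<And>y. y \<in> tree_points f \<Longrightarrow> tree_dist f (tree_proj f s) y < r \<Longrightarrow> y \<in> U"
      using U unfolding openin_tree_top by blast
    obtain \<delta> where \<delta>: "\<delta> > 0" "\<And>t. t \<in> {0..1} \<Longrightarrow> \<bar>t - s\<bar> < \<delta> \<Longrightarrow> code_dist f s t < r"
      using code_dist_small[OF s(1) r(1)] by blast
    have "tree_proj f t \<in> U" if "t \<in> {0..1}" "dist t s < \<delta>" for t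
      using r(2)[of "tree_proj f t"] \<delta>(2)[of t] tree_dist_proj[OF cont s(1) that(1)] that by (simp add: dist_real_def)
    with \<delta>(1) show "\<exists>e>0. \<forall>x'\<in>{0..1}. dist x' s < e \<longrightarrow> x' \<in> {x \<in> topspace (top_of_set {0..1}). tree_proj f x \<in> U}"
      by auto
  qed auto
qed

abbreviation punctured :: "real set \<Rightarrow> real set topology" where
  "punctured v \<equiv> subtopology (tree_top f) (tree_points f - {v})"

lemma topspace_punctured [simp]: "topspace (punctured v) = tree_points f - {v}"
  by auto

text \<open>The image of a time interval is connected.  All connectedness in the tree is derived from this.\<close>
lemma connected_avoiding:
  assumes "0 \<le> a" "b \<le> 1" "s \<in> {a..b}" "t \<in> {a..b}" and avoid: "\<And>u. u \<in> {a..b} \<Longrightarrow> tree_proj f u \<noteq> v"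
  shows "connected_component_of (punctured v) (tree_proj f s) (tree_proj f t)"
proof -
  have "connectedin (top_of_set {0..1}) {a..b}"
    using assms by (auto simp: connectedin_subtopology)
  then have "connectedin (tree_top f) (tree_proj f ` {a..b})"
    by (rule connectedin_continuous_map_image[OF continuous_map_tree_proj])
  then have "connectedin (punctured v) (tree_proj f ` {a..b})"
    using assms(1,2) avoid[symmetric] by (simp add: connectedin_subtopology) force
  then show ?thesis using assms unfolding connected_component_of_def by blast
qed

section \<open>Branch points of high degree need equal local minima\<close>

lemma last_visit:
  assumes "0 \<le> u" "u \<le> a" "a \<le> 1" "f u \<le> c" "c \<le> f a"
  obtains s where "u \<le> s" "s \<le> a" "f s = c" "\<And>x. s \<le> x \<Longrightarrow> x \<le> a \<Longrightarrow> c \<le> f x"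
proof -
  have cu: "continuous_on {u'..a'} f" if "0 \<le> u'" "a' \<le> 1" for u' a'
    by (rule continuous_on_subset[OF cont]) (use that in auto)
  define S where "S = {x\<in>{u..a}. f x = c}"
  have "closed S" unfolding S_def
    by (rule continuous_closed_preimage_constant[OF cu]) (use assms in auto)
  moreover have "bounded S" by (rule bounded_subset[of "{u..a}"]) (auto simp: S_def)
  ultimately have "compact S" by (simp add: compact_eq_bounded_closed)
  moreover have "S \<noteq> {}"
    using IVT'[of f u c a] cu[of u a] assms by (auto simp: S_def)
  ultimately obtain s where s: "s \<in> S" "\<forall>x\<in>S. x \<le> s" using compact_attains_sup[of S] by blast
  have "c \<le> f x" if x: "s \<le> x" "x \<le> a" for x
  proof (rule ccontr)
    assume n: "\<not> c \<le> f x"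
    obtain y where "x \<le> y" "y \<le> a" "f y = c"
      using IVT'[of f x c a] cu[of x a] n x s assms by (auto simp: S_def)
    moreover have "y \<noteq> x" using n \<open>f y = c\<close> by auto
    ultimately have "y \<in> S" "s < y" using s x by (auto simp: S_def)
    then show False using s by force
  qed
  with s that show ?thesis by (auto simp: S_def)
qed

lemma first_visit:
  assumes "0 \<le> a" "a \<le> u" "u \<le> 1" "f u \<le> c" "c \<le> f a"
  obtains s where "a \<le> s" "s \<le> u" "f s = c" "\<And>x. a \<le> x \<Longrightarrow> x \<le> s \<Longrightarrow> c \<le> f x"
proof -
  interpret r: coding_function "\<lambda>x. f (1 - x)"
    by unfold_locales (auto intro!: continuous_on_compose2[OF cont] continuous_intros)
  obtain s where s: "1 - u \<le> s" "s \<le> 1 - a" "f (1 - s) = c"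
    "\<And>x. s \<le> x \<Longrightarrow> x \<le> 1 - a \<Longrightarrow> c \<le> f (1 - x)"
    using r.last_visit[of "1-u" "1-a" c] assms by auto
  have "c \<le> f x" if "a \<le> x" "x \<le> 1 - s" for x
    using s(4)[of "1 - x"] that by simp
  then show ?thesis using that[of "1 - s"] s by simp
qed

text \<open>Suppose that \<open>f\<close> goes below the level of \<open>v\<close> both between \<open>s\<close> and a time \<open>a\<close> of \<open>v\<close>, and between
  \<open>a\<close> and \<open>t\<close>.  Then a level slightly lower than that of \<open>v\<close> is attained last before \<open>a\<close> and
  first after \<open>a\<close>, and these two times code one point of the tree.  The part from \<open>s\<close> to the former and
  the part from the latter to \<open>t\<close> both avoid \<open>v\<close>, which connects the two given points.\<close>
lemma disconnected_imp_above:
  assumes r: "r \<in> {0..1}" and st: "0 \<le> s" "s < t" "t \<le> 1"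
    and ns: "tree_proj f s \<noteq> tree_proj f r" "tree_proj f t \<noteq> tree_proj f r"
    and nc: "\<not> connected_component_of (punctured (tree_proj f r)) (tree_proj f s) (tree_proj f t)"
  obtains a where "s < a" "a < t" "tree_proj f a = tree_proj f r"
    "(\<forall>u\<in>{s..a}. f a \<le> f u) \<or> (\<forall>u\<in>{a..t}. f a \<le> f u)"
proof -
  obtain a where a: "s \<le> a" "a \<le> t" "tree_proj f a = tree_proj f r"
    using connected_avoiding[of s t s t "tree_proj f r"] nc st by auto
  have a': "s < a" "a < t" using a ns by (metis order_le_less)+
  have "(\<forall>u\<in>{s..a}. f a \<le> f u) \<or> (\<forall>u\<in>{a..t}. f a \<le> f u)"
  proof (rule ccontr)
    assume "\<not> ?thesis"
    then obtain u1 u2 where u: "u1 \<in> {s..a}" "u2 \<in> {a..t}" "f u1 < f a" "f u2 < f a" by (auto simp: not_le)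
    \<comment> \<open>A level below that of \<open>v\<close> that \<open>f\<close> reaches on both sides of \<open>a\<close>.\<close>
    define c where "c = max (f u1) (f u2)"
    have c: "f u1 \<le> c" "f u2 \<le> c" "c < f a" using u by (auto simp: c_def)
    obtain s1 where s1: "u1 \<le> s1" "s1 \<le> a" "f s1 = c" "\<And>x. s1 \<le> x \<Longrightarrow> x \<le> a \<Longrightarrow> c \<le> f x"
      using last_visit[of u1 a c] c u st a by auto
    obtain s2 where s2: "a \<le> s2" "s2 \<le> u2" "f s2 = c" "\<And>x. a \<le> x \<Longrightarrow> x \<le> s2 \<Longrightarrow> c \<le> f x"
      using first_visit[of a u2 c] c u st a by auto
    have "c \<le> f x" if "s1 \<le> x" "x \<le> s2" for x
      using s1(4)[of x] s2(4)[of x] that by linarith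
    then have eq: "tree_proj f s1 = tree_proj f s2"
      using s1(1-3) s2(1-3) u(1,2) st by (intro tree_proj_eqI[of _ _ c]) auto
    have av: "tree_proj f w \<noteq> tree_proj f r" if w: "w \<in> {0..1}" "w \<le> s1 \<or> s2 \<le> w" for w
    proof
      assume "tree_proj f w = tree_proj f r"
      then have e: "tree_proj f w = tree_proj f a" using a by simp
      have a01: "a \<in> {0..1}" using st a by auto
      from w(2) show False
      proof
        assume "w \<le> s1"
        then have "f w \<le> f s1" using s1 by (intro tree_proj_eqD(2)[OF w(1) a01 e]) auto
        then show False using tree_proj_eqD(1)[OF w(1) a01 e] s1 c by simp
      next
        assume "s2 \<le> w"
        then have "f w \<le> f s2" using s2 by (intro tree_proj_eqD(2)[OF w(1) a01 e]) auto
        then show False using tree_proj_eqD(1)[OF w(1) a01 e] s2 c by simp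
      qed
    qed
    have "connected_component_of (punctured (tree_proj f r)) (tree_proj f s) (tree_proj f s1)"
      using av u s1 s2 st by (intro connected_avoiding[of s s1]) auto
    moreover have "connected_component_of (punctured (tree_proj f r)) (tree_proj f s2) (tree_proj f t)"
      using av u s1 s2 st by (intro connected_avoiding[of s2 t]) auto
    ultimately show False using nc eq connected_component_of_trans by metis
  qed
  with a a' that show ?thesis by blast
qed

lemma four_element_set_sorted:
  assumes "card (S::real set) = 4"
  obtains a b c d where "a < b" "b < c" "c < d" "S = {a,b,c,d}"
proof -
  have fin: "finite S" by (rule card_ge_0_finite) (simp add: assms)
  define l where "l = sorted_list_of_set S"
  have l: "length l = Suc (Suc (Suc (Suc 0)))" "sorted_wrt (<) l" "set l = S"
    unfolding l_def using assms fin by simp_all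
  obtain a l1 where l1: "l = a # l1" "length l1 = Suc (Suc (Suc 0))" using l(1) by (cases l) auto
  obtain b l2 where l2: "l1 = b # l2" "length l2 = Suc (Suc 0)" using l1(2) by (cases l1) auto
  obtain c l3 where l3: "l2 = c # l3" "length l3 = Suc 0" using l2(2) by (cases l2) auto
  obtain d where l4: "l3 = [d]" using l3(2) by (cases l3) auto
  note abcd = l1(1)[unfolded l2(1) l3(1) l4]
  show ?thesis
  proof (rule that[of a b c d])
    show "a < b" "b < c" "c < d" using l(2) unfolding abcd by simp_all
    show "S = {a,b,c,d}" using l(3) unfolding abcd by (simp only: list.set)
  qed
qed

text \<open>Representatives \<open>t1 < t2 < t3 < t4\<close> of four components are separated by times \<open>a1, a2, a3\<close> of
  \<open>v\<close>.  Comparing \<open>t1\<close> with \<open>t4\<close> shows that \<open>f\<close> also stays above the level of \<open>v\<close> on one of the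
  outer pieces.  So three of the four representatives lie in excursions above that level with two
  local minima of equal height between them.\<close>
lemma card_components_le_3:
  assumes v: "v \<in> tree_points f"
    and no_pattern: "\<And>t1 a1 t2 a2 t3. \<lbrakk>0 \<le> t1; t1 < a1; a1 < t2; t2 < a2; a2 < t3; t3 \<le> 1; f a1 = f a2;
       \<And>u. t1 \<le> u \<Longrightarrow> u \<le> t3 \<Longrightarrow> f a1 \<le> f u; f a1 < f t1; f a1 < f t2; f a1 < f t3\<rbrakk> \<Longrightarrow> False"
  shows "finite (connected_components_of (punctured v)) \<and> card (connected_components_of (punctured v)) \<le> 3"
proof (rule ccontr)
  let ?C = "connected_components_of (punctured v)"
  assume n: "\<not> ?thesis"
  obtain C where C: "C \<subseteq> ?C" "card C = 4"
  proof (cases "finite ?C")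
    case True
    then have "\<not> card ?C \<le> 3" using n by blast
    then have "4 \<le> card ?C" by linarith
    from obtain_subset_with_card_n[OF this] show ?thesis using that by metis
  next
    case False
    from infinite_arbitrarily_large[OF this, of 4] show ?thesis using that by metis
  qed
  obtain r where r: "r \<in> {0..1}" "v = tree_proj f r" using v unfolding tree_points_eq by blast
  define K where "K t = connected_component_of_set (punctured v) (tree_proj f t)" for t
  have "\<exists>s. s \<in> {0..1} \<and> tree_proj f s \<noteq> v \<and> K s = c" if "c \<in> C" for c
  proof -
    have "c \<in> ?C" using that C(1) by blast
    then obtain x where x: "x \<in> tree_points f - {v}" "c = connected_component_of_set (punctured v) x"
      unfolding connected_components_of_def topspace_punctured by blast
    then obtain s where "s \<in> {0..1}" "x = tree_proj f s" unfolding tree_points_eq by blast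
    then show ?thesis using x unfolding K_def by blast
  qed
  then have "\<forall>c\<in>C. \<exists>s. s \<in> {0..1} \<and> tree_proj f s \<noteq> v \<and> K s = c" by blast
  from bchoice[OF this] obtain p where p: "\<forall>c\<in>C. p c \<in> {0..1} \<and> tree_proj f (p c) \<noteq> v \<and> K (p c) = c"
    by blast
  then have pK: "K (p c) = c" if "c \<in> C" for c using that by blast
  have "inj_on p C" by (rule inj_on_inverseI[of C K]) (rule pK)
  then have "card (p ` C) = 4" using C(2) card_image[of p C] by simp
  then obtain t1 t2 t3 t4 where t: "t1 < t2" "t2 < t3" "t3 < t4" "p ` C = {t1,t2,t3,t4}"
    by (rule four_element_set_sorted)
  have pP: "t \<in> {0..1} \<and> tree_proj f t \<noteq> v" if "t \<in> {t1,t2,t3,t4}" for t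
    using that p unfolding t(4)[symmetric] by blast
  have in01: "t1 \<in> {0..1}" "t2 \<in> {0..1}" "t3 \<in> {0..1}" "t4 \<in> {0..1}" 
    and nv: "tree_proj f t1 \<noteq> v" "tree_proj f t2 \<noteq> v" "tree_proj f t3 \<noteq> v" "tree_proj f t4 \<noteq> v" 
    using pP by blast+
  have nc: "\<not> connected_component_of (punctured v) (tree_proj f x) (tree_proj f y)"
    if xy: "x \<in> {t1,t2,t3,t4}" "y \<in> {t1,t2,t3,t4}" "x < y" for x y
  proof
    assume c: "connected_component_of (punctured v) (tree_proj f x) (tree_proj f y)"
    obtain c1 c2 where cc: "c1 \<in> C" "x = p c1" "c2 \<in> C" "y = p c2"
      using xy(1,2) unfolding t(4)[symmetric] by blast
    have "K x = K y"
      using c[unfolded connected_component_of_equiv[of "punctured v" "tree_proj f x" "tree_proj f y"]] by (simp add: K_def)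
    then have "c1 = c2" using pK[OF cc(1)] pK[OF cc(3)] cc(2,4) by simp
    then show False using cc xy(3) by simp
  qed
  have ex: "\<exists>a. x < a \<and> a < y \<and> tree_proj f a = v \<and>
    ((\<forall>u\<in>{x..a}. f a \<le> f u) \<or> (\<forall>u\<in>{a..y}. f a \<le> f u))"
    if xy: "x \<in> {t1,t2,t3,t4}" "y \<in> {t1,t2,t3,t4}" "x < y" for x y
  proof -
    have "0 \<le> x" "y \<le> 1" and nvxy: "tree_proj f x \<noteq> v" "tree_proj f y \<noteq> v"
      using pP[OF xy(1)] pP[OF xy(2)] by simp_all
    from disconnected_imp_above[OF r(1) this(1) xy(3) this(2), folded r(2), OF nvxy nc[OF xy]]
    show ?thesis by blast
  qed
  obtain a1 where a1: "t1 < a1" "a1 < t2" "tree_proj f a1 = v" using ex[of t1 t2] t(1) by blast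
  obtain a2 where a2: "t2 < a2" "a2 < t3" "tree_proj f a2 = v" using ex[of t2 t3] t(2) by blast
  obtain a3 where a3: "t3 < a3" "a3 < t4" "tree_proj f a3 = v" using ex[of t3 t4] t(3) by blast
  have "t1 < t4" using t by linarith
  then obtain a where a: "t1 < a" "a < t4" "tree_proj f a = v"
    "(\<forall>u\<in>{t1..a}. f a \<le> f u) \<or> (\<forall>u\<in>{a..t4}. f a \<le> f u)" using ex[of t1 t4] by blast
  have lim: "0 \<le> t1" "t4 \<le> 1" using in01 by simp_all
  have b01: "a1 \<in> {0..1}" "a2 \<in> {0..1}" "a3 \<in> {0..1}" "a \<in> {0..1}"
    using a1(1,2) a2(1,2) a3(1,2) a(1,2) t(1-3) lim by simp_all
  have h: "f a1 = f a" "f a2 = f a" "f a3 = f a"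
    using tree_proj_eqD(1)[OF b01(1,4)] tree_proj_eqD(1)[OF b01(2,4)] tree_proj_eqD(1)[OF b01(3,4)]
      a1(3) a2(3) a3(3) a(3) by simp_all
  have strict: "f a < f t" if t: "tree_proj f t \<noteq> v" "lo \<le> t" "t \<le> hi" "lo \<le> b" "b \<le> hi" "0 \<le> lo" "hi \<le> 1"
      "\<forall>u\<in>{lo..hi}. f a \<le> f u" "tree_proj f b = v" "f b = f a" for t lo hi b
  proof (rule ccontr)
    assume "\<not> f a < f t"
    moreover have "f a \<le> f t" using that by simp
    ultimately have e: "f t = f a" by simp
    have "tree_proj f t = tree_proj f b"
    proof (cases "t \<le> b")
      case True
      then show ?thesis by (intro tree_proj_eqI[of _ _ "f a"]) (use that e in simp_all)
    next
      case False
      then show ?thesis by (intro tree_proj_eqI[of _ _ "f a", symmetric]) (use that e in simp_all)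
    qed
    then show False using t by simp
  qed
  from a(4) show False
  proof
    assume up: "\<forall>u\<in>{t1..a}. f a \<le> f u"
    have up': "\<forall>u\<in>{t1..a3}. f a \<le> f u"
    proof
      fix u assume u: "u \<in> {t1..a3}"
      show "f a \<le> f u"
      proof (cases "u \<le> a")
        case True then show ?thesis using up u by simp
      next
        case False
        then show ?thesis using tree_proj_eqD(2)[OF b01(4,3), of u] a(3) a3(3) u by simp
      qed
    qed
    have st: "f a < f t1" "f a < f t2" "f a < f t3"
      using a1 a2 a3 t(1-3) lim h by (intro strict[OF _ _ _ _ _ _ _ up', of _ a1] nv; simp)+
    show False
      by (rule no_pattern[of t1 a1 t2 a2 t3]) (use up' st h a1 a2 a3 t(1-3) lim in simp_all)
  next
    assume up: "\<forall>u\<in>{a..t4}. f a \<le> f u"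
    have up': "\<forall>u\<in>{a1..t4}. f a \<le> f u"
    proof
      fix u assume u: "u \<in> {a1..t4}"
      show "f a \<le> f u"
      proof (cases "a \<le> u")
        case True then show ?thesis using up u by simp
      next
        case False
        then show ?thesis using tree_proj_eqD(2)[OF b01(4,1), of u] a(3) a1(3) u by simp
      qed
    qed
    have st: "f a < f t2" "f a < f t3" "f a < f t4"
      using a1 a2 a3 t(1-3) lim h by (intro strict[OF _ _ _ _ _ _ _ up', of _ a1] nv; simp)+
    show False
      by (rule no_pattern[of t2 a2 t3 a3 t4]) (use up' st h a1 a2 a3 t(1-3) lim in simp_all)
  qed
qed

lemma components_nonempty:
  assumes "w \<in> tree_points f" "w \<noteq> v"
  shows "connected_components_of (punctured v) \<noteq> {}"
proof -
  have "w \<in> topspace (punctured v)" using assms by simp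
  then show ?thesis unfolding connected_components_of_def by blast
qed

text \<open>The degree is at least one because the tree has a second point.\<close>
lemma tree_degree_in_123:
  assumes "v \<in> tree_points f" "w \<in> tree_points f" "w \<noteq> v"
    and "\<And>t1 a1 t2 a2 t3. \<lbrakk>0 \<le> t1; t1 < a1; a1 < t2; t2 < a2; a2 < t3; t3 \<le> 1; f a1 = f a2;
       \<And>u. t1 \<le> u \<Longrightarrow> u \<le> t3 \<Longrightarrow> f a1 \<le> f u; f a1 < f t1; f a1 < f t2; f a1 < f t3\<rbrakk> \<Longrightarrow> False"
  shows "tree_degree f v \<in> {1, 2, 3}"
proof -
  let ?C = "connected_components_of (punctured v)"
  have *: "finite ?C \<and> card ?C \<le> 3" by (rule card_components_le_3[OF assms(1)]) (rule assms(4))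
  moreover have "card ?C \<noteq> 0" using card_0_eq[OF conjunct1[OF *]] components_nonempty[OF assms(2,3)] by simp
  ultimately have "card ?C = 1 \<or> card ?C = 2 \<or> card ?C = 3" by linarith
  moreover have "tree_degree f v = enat (card ?C)" using * by (simp add: tree_degree_def)
  moreover have "enat 1 = 1" "enat 2 = 2" "enat 3 = 3" unfolding one_enat_def numeral_eq_enat by (rule refl)+
  ultimately show ?thesis by force
qed

section \<open>Leaves, and their Borel measurability\<close>

lemma leafI:
  assumes "v \<in> tree_points f" "w \<in> tree_points f" "w \<noteq> v"
    and conn: "\<And>x. \<lbrakk>x \<in> tree_points f; x \<noteq> v\<rbrakk> \<Longrightarrow> connected_component_of (punctured v) x w"
  shows "v \<in> tree_leaves f"
proof -
  let ?C = "connected_components_of (punctured v)"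
  let ?W = "connected_component_of_set (punctured v) w"
  have *: "connected_component_of_set (punctured v) x = ?W" if "x \<in> tree_points f - {v}" for x
  proof -
    have "x \<in> tree_points f" "x \<noteq> v" using that by blast+
    note conn[OF this, unfolded connected_component_of_equiv[of "punctured v" x w]]
    then show ?thesis by (simp only:)
  qed
  have "w \<in> tree_points f - {v}" using assms by simp
  then have "?C = {?W}"
    unfolding connected_components_of_def topspace_punctured using * by blast
  then have "finite ?C" "card ?C = 1" by simp_all
  then show ?thesis using assms(1) by (simp add: tree_leaves_def tree_degree_def one_enat_def)
qed

lemma leafD:
  assumes "v \<in> tree_leaves f" "x \<in> tree_points f" "y \<in> tree_points f" "x \<noteq> v" "y \<noteq> v"
  shows "connected_component_of (punctured v) x y"
proof -
  let ?C = "connected_components_of (punctured v)"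
  have "card ?C = 1"
    using assms(1) by (auto simp: tree_leaves_def tree_degree_def Let_def one_enat_def split: if_splits)
  then obtain c where c: "?C = {c}" by (auto simp: card_1_singleton_iff)
  have xy: "x \<in> topspace (punctured v)" "y \<in> topspace (punctured v)" using assms by simp_all
  have "connected_component_of_set (punctured v) x \<in> ?C" "connected_component_of_set (punctured v) y \<in> ?C"
    unfolding connected_components_of_def using xy by blast+
  then have "connected_component_of_set (punctured v) x = connected_component_of_set (punctured v) y" using c by simp
  then have e: "connected_component_of (punctured v) x = connected_component_of (punctured v) y" by (rule Collect_inj)
  show ?thesis unfolding connected_component_of_equiv[of "punctured v" x y] using xy e by blast
qed

lemma avoiding_nbhd:
  assumes "s \<in> {0..1}" "tree_proj f s \<noteq> v" "v \<in> tree_points f"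
  obtains \<delta> where "\<delta> > 0" "\<And>u. u \<in> {0..1} \<Longrightarrow> \<bar>u - s\<bar> < \<delta> \<Longrightarrow> tree_proj f u \<noteq> v"
proof -
  have "tree_dist f (tree_proj f s) v > 0" using assms by (simp add: tree.mdist_pos_less)
  then obtain \<delta> where d: "\<delta> > 0" "\<And>u. u \<in> {0..1} \<Longrightarrow> \<bar>u - s\<bar> < \<delta> \<Longrightarrow> code_dist f s u < tree_dist f (tree_proj f s) v"
    using code_dist_small[OF assms(1)] by blast
  have "tree_proj f u \<noteq> v" if u: "u \<in> {0..1}" "\<bar>u - s\<bar> < \<delta>" for u
    using d(2)[OF u] tree_dist_proj[OF cont assms(1) u(1)] by auto
  with d(1) that show ?thesis by blast
qed

text \<open>Points coded by nearby times lie in one component of the complement of \<open>v\<close>.  Hence components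
  can be told apart by rational times, which makes the set of leaves a countable combination of
  closed sets.\<close>
lemma rational_representative:
  assumes s: "s \<in> {0..1}" "tree_proj f s \<noteq> v" and v: "v \<in> tree_points f"
  obtains q where "q \<in> \<rat>" "q \<in> {0..1}" "tree_proj f q \<noteq> v"
    "connected_component_of (punctured v) (tree_proj f s) (tree_proj f q)"
proof -
  obtain \<delta> where d: "\<delta> > 0" "\<And>u. u \<in> {0..1} \<Longrightarrow> \<bar>u - s\<bar> < \<delta> \<Longrightarrow> tree_proj f u \<noteq> v"
    using avoiding_nbhd[OF s v] by blast
  define lo where "lo = max 0 (s - \<delta>)"
  define hi where "hi = min 1 (s + \<delta>)"
  have lh: "lo < hi" using s d(1) by (auto simp: lo_def hi_def)
  then obtain q where q: "q \<in> \<rat>" "lo < q" "q < hi" using Rats_dense_in_real by blast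
  have q01: "q \<in> {0..1}" "\<bar>q - s\<bar> < \<delta>" using q by (auto simp: lo_def hi_def)
  have av: "tree_proj f u \<noteq> v" if "u \<in> {min s q..max s q}" for u
  proof (rule d(2))
    show "u \<in> {0..1}" using that s q01 by (cases "s \<le> q") auto
    show "\<bar>u - s\<bar> < \<delta>" using that q01 by (cases "s \<le> q") auto
  qed
  have "0 \<le> min s q" "max s q \<le> 1" using s q01 by simp_all
  then have "connected_component_of (punctured v) (tree_proj f s) (tree_proj f q)"
    by (rule connected_avoiding) (simp_all add: av)
  then show ?thesis using that[OF q(1) q01(1) d(2)[OF q01]] by blast
qed

text \<open>The minimum over the interval between two times satisfies the ultrametric inequality
  \<open>min (m x y) (m y z) \<le> m x z\<close>, and the four-point condition of a real tree is an arithmetical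
  consequence of it.\<close>
lemma code_dist_four_point:
  assumes "a \<in> {0..1}" "b \<in> {0..1}" "c \<in> {0..1}" "e \<in> {0..1}"
  shows "code_dist f a c + code_dist f b e
    \<le> max (code_dist f a b + code_dist f c e) (code_dist f b c + code_dist f a e)"
proof -
  define m where "m x y = (INF u\<in>{min x y..max x y}. f u)" for x y
  have att: "\<exists>w\<in>{min x y..max x y}. f w = m x y \<and> (\<forall>v\<in>{min x y..max x y}. m x y \<le> f v)"
    if "x \<in> {0..1}" "y \<in> {0..1}" for x y
  proof -
    have "0 \<le> min x y" "min x y \<le> max x y" "max x y \<le> 1" using that by simp_all
    then show ?thesis using inf_attained[of "min x y" "max x y"] unfolding m_def by metis
  qed
  have ultra: "min (m x y) (m y z) \<le> m x z"
    if xyz: "x \<in> {0..1}" "y \<in> {0..1}" "z \<in> {0..1}" for x y z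
  proof -
    obtain w where w: "w \<in> {min x z..max x z}" "f w = m x z" using att[OF xyz(1,3)] by blast
    have "w \<in> {min x y..max x y} \<or> w \<in> {min y z..max y z}"
      using w(1) by (auto simp: min_def max_def split: if_splits)
    then have "m x y \<le> f w \<or> m y z \<le> f w" using att[OF xyz(1,2)] att[OF xyz(2,3)] by blast
    then show ?thesis using w(2) by linarith
  qed
  have sym: "m x y = m y x" for x y by (simp add: m_def min.commute max.commute)
  have "min (m a b + m c e) (m b c + m a e) \<le> m a c + m b e"
    using ultra[OF assms(1,2,3)] ultra[OF assms(2,1,4)] ultra[OF assms(2,3,4)] ultra[OF assms(1,4,3)]
    unfolding sym[of b a] sym[of e c] by linarith
  then show ?thesis unfolding code_dist_def m_def[symmetric] by linarith
qed

lemma tree_four_point: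
  assumes "x \<in> tree_points f" "y \<in> tree_points f" "z \<in> tree_points f" "v \<in> tree_points f"
  shows "tree_dist f x z + tree_dist f y v
    \<le> max (tree_dist f x y + tree_dist f z v) (tree_dist f y z + tree_dist f x v)"
proof -
  obtain a b c e where "a \<in> {0..1}" "b \<in> {0..1}" "c \<in> {0..1}" "e \<in> {0..1}"
    "x = tree_proj f a" "y = tree_proj f b" "z = tree_proj f c" "v = tree_proj f e"
    using assms unfolding tree_points_eq by blast
  then show ?thesis using code_dist_four_point[of a b c e] by (simp only: tree_dist_proj[OF cont])
qed

text \<open>Declare \<open>w\<close> equivalent to \<open>x\<close> when \<open>d x w < d x v + d w v\<close>, that is, when the Gromov product
  of \<open>x\<close> and \<open>w\<close> at \<open>v\<close> is positive.  By the four-point condition this does not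
  change when \<open>w\<close> moves by less than \<open>d w v\<close>.  So the class of \<open>x\<close> is open and closed in the
  complement of \<open>v\<close>, and it does not contain \<open>y\<close>.\<close>
lemma between_imp_disconnected:
  assumes T: "x \<in> tree_points f" "y \<in> tree_points f" "v \<in> tree_points f" and "x \<noteq> v" "y \<noteq> v"
    and between: "tree_dist f x v + tree_dist f v y = tree_dist f x y"
  shows "\<not> connected_component_of (punctured v) x y"
proof
  let ?d = "tree_dist f"
  assume "connected_component_of (punctured v) x y"
  then obtain S where S: "connectedin (tree_top f) S" "S \<subseteq> tree_points f - {v}" "x \<in> S" "y \<in> S"
    unfolding connected_component_of_def connectedin_subtopology by blast
  define E1 where "E1 = {w \<in> tree_points f - {v}. ?d x w < ?d x v + ?d w v}"
  define E2 where "E2 = {w \<in> tree_points f - {v}. \<not> ?d x w < ?d x v + ?d w v}"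
  have pos: "0 < ?d w v" if "w \<in> tree_points f - {v}" for w
    using that T(3) by (simp add: tree.mdist_pos_less)
  have near: "(?d x w' < ?d x v + ?d w' v) = (?d x w < ?d x v + ?d w v) \<and> w' \<in> tree_points f - {v}"
    if w: "w \<in> tree_points f - {v}" "w' \<in> tree_points f" "?d w w' < ?d w v" for w w'
  proof -
    have w': "w' \<in> tree_points f - {v}" using w by auto
    have p: "0 < ?d w v" "0 < ?d w' v" "0 \<le> ?d x v" using pos w(1) w' by simp_all
    have c: "?d w' w = ?d w w'" by (simp add: tree.commute)
    have "?d x w' + ?d w v \<le> max (?d x w + ?d w' v) (?d w w' + ?d x v)"
      by (rule tree_four_point) (use w T in auto)
    moreover have "?d x w + ?d w' v \<le> max (?d x w' + ?d w v) (?d w' w + ?d x v)"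
      by (rule tree_four_point) (use w T in auto)
    ultimately show ?thesis using w(3) w' p c by linarith
  qed
  have "openin (tree_top f) E1" unfolding openin_tree_top
  proof (intro conjI ballI)
    fix w assume w: "w \<in> E1"
    then have "0 < ?d w v" using pos by (simp add: E1_def)
    moreover have "y \<in> E1" if "y \<in> tree_points f" "?d w y < ?d w v" for y
      using near[of w y] that w unfolding E1_def by blast
    ultimately show "\<exists>r>0. \<forall>y\<in>tree_points f. ?d w y < r \<longrightarrow> y \<in> E1" by blast
  qed (auto simp: E1_def)
  moreover have "openin (tree_top f) E2" unfolding openin_tree_top
  proof (intro conjI ballI)
    fix w assume w: "w \<in> E2"
    then have "0 < ?d w v" using pos by (simp add: E2_def)
    moreover have "y \<in> E2" if "y \<in> tree_points f" "?d w y < ?d w v" for y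
      using near[of w y] that w unfolding E2_def by blast
    ultimately show "\<exists>r>0. \<forall>y\<in>tree_points f. ?d w y < r \<longrightarrow> y \<in> E2" by blast
  qed (auto simp: E2_def)
  moreover have "x \<in> E1" using T assms(4) pos[of x] by (simp add: E1_def)
  moreover have "y \<in> E2" using T assms(5) between by (simp add: E2_def tree.commute[of y v])
  moreover have "S \<subseteq> E1 \<union> E2" "E1 \<inter> E2 = {}" using S(2) unfolding E1_def E2_def by blast+
  ultimately show False using S(1,3,4) unfolding connectedin by blast
qed

lemma not_leaf_imp:
  assumes v: "v \<in> tree_points f" and w: "w \<in> tree_points f" "w \<noteq> v" and nl: "v \<notin> tree_leaves f"
  obtains s t where "s \<in> \<rat>" "t \<in> \<rat>" "0 \<le> s" "s < t" "t \<le> 1" "tree_proj f s \<noteq> v" "tree_proj f t \<noteq> v"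
    "\<not> connected_component_of (punctured v) (tree_proj f s) (tree_proj f t)"
proof -
  note sym = connected_component_of_sym[of "punctured v", THEN iffD1] and trans = connected_component_of_trans[of "punctured v"]
  obtain x where x: "x \<in> tree_points f" "x \<noteq> v" "\<not> connected_component_of (punctured v) x w"
    using leafI[OF v w] nl by blast
  obtain s0 t0 where st0: "s0 \<in> {0..1}" "t0 \<in> {0..1}" "x = tree_proj f s0" "w = tree_proj f t0"
    using x w unfolding tree_points_eq by blast
  obtain s where s: "s \<in> \<rat>" "s \<in> {0..1}" "tree_proj f s \<noteq> v"
    "connected_component_of (punctured v) x (tree_proj f s)"
    by (rule rational_representative[OF st0(1) _ v]) (use st0(3) x(2) in simp_all)
  obtain t where t: "t \<in> \<rat>" "t \<in> {0..1}" "tree_proj f t \<noteq> v"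
    "connected_component_of (punctured v) w (tree_proj f t)"
    by (rule rational_representative[OF st0(2) _ v]) (use st0(4) w(2) in simp_all)
  have n1: "\<not> connected_component_of (punctured v) (tree_proj f s) (tree_proj f t)"
    using trans[OF trans[OF s(4)]] sym[OF t(4)] x(3) by blast
  then have n2: "\<not> connected_component_of (punctured v) (tree_proj f t) (tree_proj f s)"
    using sym by blast
  have "connected_component_of (punctured v) (tree_proj f s) (tree_proj f s)"
    unfolding connected_component_of_refl topspace_punctured using s by simp
  then have "s \<noteq> t" using n1 by auto
  then consider "s < t" | "t < s" by linarith
  then show ?thesis
  proof cases
    case 1
    then show ?thesis using that[OF s(1) t(1) _ 1 _ s(3) t(3) n1] s(2) t(2) by simp
  next
    case 2
    then show ?thesis using that[OF t(1) s(1) _ 2 _ t(3) s(3) n2] s(2) t(2) by simp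
  qed
qed

text \<open>One direction is \<open>between_imp_disconnected\<close>.  For the other one, \<open>disconnected_imp_above\<close> applied
  to two components shows that \<open>f\<close> has the same minimum from \<open>a\<close> to \<open>t\<close> as from \<open>s\<close> to \<open>t\<close>, or the
  mirror image of this, and then the distances add up.\<close>
lemma leaf_iff:
  assumes v: "v \<in> tree_points f" and w: "w \<in> tree_points f" "w \<noteq> v"
  shows "v \<in> tree_leaves f \<longleftrightarrow> \<not> (\<exists>s\<in>\<rat> \<inter> {0..1}. \<exists>t\<in>\<rat> \<inter> {0..1}. tree_proj f s \<noteq> v \<and> tree_proj f t \<noteq> v \<and>
    tree_dist f (tree_proj f s) v + tree_dist f v (tree_proj f t) = tree_dist f (tree_proj f s) (tree_proj f t))"
    (is "?L \<longleftrightarrow> \<not> ?R")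
proof -
  have "\<not> ?R" if L: ?L
  proof
    assume ?R
    then obtain s t where st: "s \<in> {0..1}" "t \<in> {0..1}" "tree_proj f s \<noteq> v" "tree_proj f t \<noteq> v"
      "tree_dist f (tree_proj f s) v + tree_dist f v (tree_proj f t) = tree_dist f (tree_proj f s) (tree_proj f t)"
      by blast
    have T: "tree_proj f s \<in> tree_points f" "tree_proj f t \<in> tree_points f" using st by simp_all
    show False
      using leafD[OF L T st(3,4)] between_imp_disconnected[OF T v st(3,4,5)] by blast
  qed
  moreover have ?R if nL: "\<not> ?L"
  proof -
    obtain s t where st: "s \<in> \<rat>" "t \<in> \<rat>" "0 \<le> s" "s < t" "t \<le> 1" "tree_proj f s \<noteq> v" "tree_proj f t \<noteq> v"
      "\<not> connected_component_of (punctured v) (tree_proj f s) (tree_proj f t)"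
      by (rule not_leaf_imp[OF v w nL])
    obtain r where r: "r \<in> {0..1}" "v = tree_proj f r" using v unfolding tree_points_eq by blast
    obtain a where a: "s < a" "a < t" "tree_proj f a = v"
      "(\<forall>u\<in>{s..a}. f a \<le> f u) \<or> (\<forall>u\<in>{a..t}. f a \<le> f u)"
      by (rule disconnected_imp_above[OF r(1) st(3,4,5), folded r(2), OF st(6,7,8)])
    have b: "0 \<le> a" "a \<le> 1" "s \<le> a" "a \<le> t" "s \<le> t" using a st by linarith+
    obtain w1 where w1: "w1 \<in> {s..a}" "f w1 = (INF u\<in>{s..a}. f u)" "\<And>x. x \<in> {s..a} \<Longrightarrow> f w1 \<le> f x"
      using inf_attained[OF st(3) b(3,2)] by metis
    obtain w2 where w2: "w2 \<in> {a..t}" "f w2 = (INF u\<in>{a..t}. f u)" "\<And>x. x \<in> {a..t} \<Longrightarrow> f w2 \<le> f x"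
      using inf_attained[OF b(1,4) st(5)] by metis
    obtain w3 where w3: "w3 \<in> {s..t}" "f w3 = (INF u\<in>{s..t}. f u)" "\<And>x. x \<in> {s..t} \<Longrightarrow> f w3 \<le> f x"
      using inf_attained[OF st(3) b(5) st(5)] by metis
    have d: "code_dist f s a = f s + f a - 2 * f w1" "code_dist f a t = f a + f t - 2 * f w2"
        "code_dist f s t = f s + f t - 2 * f w3"
      unfolding code_dist_def w1(2) w2(2) w3(2) using b by (simp_all add: min_absorb1 max_absorb2)
    have "w3 \<in> {s..a} \<or> w3 \<in> {a..t}" using w3(1) by auto
    then have m: "f w1 \<le> f w3 \<or> f w2 \<le> f w3" using w1(3) w2(3) by blast
    have m': "f w3 \<le> f w1" "f w3 \<le> f w2" "f w1 \<le> f a" "f w2 \<le> f a"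
      using w3(3)[of w1] w3(3)[of w2] w1(1) w2(1) w1(3)[of a] w2(3)[of a] b by simp_all
    have "f a \<le> f w1 \<or> f a \<le> f w2" using a(4) w1(1) w2(1) by blast
    then have "code_dist f s a + code_dist f a t = code_dist f s t" using d m m' by linarith
    moreover have "a \<in> {0..1}" "s \<in> {0..1}" "t \<in> {0..1}" using a st by simp_all
    ultimately have "tree_dist f (tree_proj f s) v + tree_dist f v (tree_proj f t) = tree_dist f (tree_proj f s) (tree_proj f t)"
      unfolding a(3)[symmetric] by (simp add: tree_dist_proj[OF cont])
    moreover have "s \<in> \<rat> \<inter> {0..1}" "t \<in> \<rat> \<inter> {0..1}" using st by simp_all
    ultimately show ?R using st(6,7) by blast
  qed
  ultimately show ?thesis by blast
qed

text \<open>If \<open>v\<close> were not a leaf, \<open>f\<close> would stay above the level of \<open>v\<close> all the way from a time of \<open>v\<close> to a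
  time of another point, by \<open>disconnected_imp_above\<close>.\<close>
lemma leaf_criterion:
  assumes r: "r \<in> {0..1}" and w: "w \<in> tree_points f" "w \<noteq> tree_proj f r"
    and left: "\<And>a s. \<lbrakk>tree_proj f a = tree_proj f r; 0 \<le> s; s < a; a \<le> 1; tree_proj f s \<noteq> tree_proj f r\<rbrakk>
       \<Longrightarrow> \<exists>u\<in>{s..a}. f u < f a"
    and right: "\<And>a s. \<lbrakk>tree_proj f a = tree_proj f r; 0 \<le> a; a < s; s \<le> 1; tree_proj f s \<noteq> tree_proj f r\<rbrakk>
       \<Longrightarrow> \<exists>u\<in>{a..s}. f u < f a"
  shows "tree_proj f r \<in> tree_leaves f"
proof (rule ccontr)
  assume n: "tree_proj f r \<notin> tree_leaves f"
  obtain s t where st: "0 \<le> s" "s < t" "t \<le> 1" "tree_proj f s \<noteq> tree_proj f r" "tree_proj f t \<noteq> tree_proj f r"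
    "\<not> connected_component_of (punctured (tree_proj f r)) (tree_proj f s) (tree_proj f t)"
    by (rule not_leaf_imp[OF tree_proj_in[OF r] w n])
  obtain a where a: "s < a" "a < t" "tree_proj f a = tree_proj f r"
      "(\<forall>u\<in>{s..a}. f a \<le> f u) \<or> (\<forall>u\<in>{a..t}. f a \<le> f u)"
    by (rule disconnected_imp_above[OF r st(1-3) st(4-6)])
  have "\<exists>u\<in>{s..a}. f u < f a" using left[OF a(3) st(1) a(1) _ st(4)] a st by linarith
  moreover have "\<exists>u\<in>{a..t}. f u < f a" using right[OF a(3) _ a(2) st(3) st(5)] a st by linarith
  ultimately show False using a(4) by force
qed

lemma space_tree_borel [simp]: "space (tree_borel f) = tree_points f"
  by (simp add: tree_borel_def space_measure_of_conv)

lemma sets_tree_borel: "sets (tree_borel f) = sigma_sets (tree_points f) {U. openin (tree_top f) U}"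
  unfolding tree_borel_def
  by (rule sets_measure_of) (auto simp: openin_tree_top)

lemma open_in_tree_borel: "openin (tree_top f) U \<Longrightarrow> U \<in> sets (tree_borel f)"
  by (simp add: sets_tree_borel sigma_sets.Basic)

lemma closed_in_tree_borel:
  assumes "closedin (tree_top f) C" shows "C \<in> sets (tree_borel f)"
proof -
  have "tree_points f - C \<in> sets (tree_borel f)"
    using assms by (intro open_in_tree_borel) (simp add: closedin_def)
  then have "space (tree_borel f) - (tree_points f - C) \<in> sets (tree_borel f)" by (rule sets.compl_sets)
  moreover have "C \<subseteq> tree_points f" using closedin_subset[OF assms] by simp
  ultimately show ?thesis by (simp add: double_diff)
qed

lemma singleton_in_tree_borel: "v \<in> tree_points f \<Longrightarrow> {v} \<in> sets (tree_borel f)"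
  by (rule closed_in_tree_borel)
    (use closedin_Hausdorff_sing_eq[OF tree.Hausdorff_space_mtopology] in \<open>simp add: tree_top_def\<close>)

lemma segment_in_tree_borel:
  assumes "x \<in> tree_points f" "y \<in> tree_points f"
  shows "{v \<in> tree_points f. tree_dist f x v + tree_dist f v y = tree_dist f x y} \<in> sets (tree_borel f)" (is "?S \<in> _")
proof (rule closed_in_tree_borel)
  let ?d = "tree_dist f"
  have "openin (tree_top f) (tree_points f - ?S)"
    unfolding openin_tree_top
  proof (intro conjI ballI)
    fix v assume v: "v \<in> tree_points f - ?S"
    then have vT: "v \<in> tree_points f" by simp
    define \<eta> where "\<eta> = ?d x v + ?d v y - ?d x y"
    have \<eta>: "\<eta> > 0" using v tree.triangle[OF assms(1) vT assms(2)] unfolding \<eta>_def by simp argo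
    have "w \<in> tree_points f - ?S" if w: "w \<in> tree_points f" "?d v w < \<eta> / 2" for w
    proof -
      have "?d x v \<le> ?d x w + ?d w v" "?d v y \<le> ?d v w + ?d w y" "?d w v = ?d v w"
        using tree.triangle[OF assms(1) w(1) vT] tree.triangle[OF vT w(1) assms(2)] by (simp_all add: tree.commute)
      then have "?d x y < ?d x w + ?d w y" using w(2) unfolding \<eta>_def by argo
      then show ?thesis using w(1) by simp
    qed
    then show "\<exists>r>0. \<forall>w\<in>tree_points f. ?d v w < r \<longrightarrow> w \<in> tree_points f - ?S"
      using \<eta> by (intro exI[of _ "\<eta>/2"]) simp
  qed auto
  then show "closedin (tree_top f) ?S" by (simp add: closedin_def)
qed

text \<open>By \<open>leaf_iff\<close> the complement of the leaves is a countable union of closed segments without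
  their end points.\<close>
lemma leaves_in_tree_borel:
  assumes two: "x \<in> tree_points f" "y \<in> tree_points f" "x \<noteq> y"
  shows "tree_leaves f \<in> sets (tree_borel f)"
proof -
  let ?Q = "\<rat> \<inter> {0..1::real}"
  let ?N = "\<lambda>s t. {v \<in> tree_points f. tree_dist f (tree_proj f s) v + tree_dist f v (tree_proj f t)
      = tree_dist f (tree_proj f s) (tree_proj f t)} - {tree_proj f s} - {tree_proj f t}"
  have "v \<in> tree_leaves f \<longleftrightarrow> v \<in> space (tree_borel f) - (\<Union>s\<in>?Q. \<Union>t\<in>?Q. ?N s t)" for v
  proof (cases "v \<in> tree_points f")
    case True
    obtain w where w: "w \<in> tree_points f" "w \<noteq> v" using two by metis
    show ?thesis unfolding leaf_iff[OF True w] using True by auto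
  qed (simp add: tree_leaves_def)
  then have eq: "tree_leaves f = space (tree_borel f) - (\<Union>s\<in>?Q. \<Union>t\<in>?Q. ?N s t)" by blast
  have N: "?N s t \<in> sets (tree_borel f)" if "s \<in> ?Q" "t \<in> ?Q" for s t
    using that by (intro sets.Diff segment_in_tree_borel singleton_in_tree_borel) auto
  have Q: "countable ?Q" by (intro countable_Int1 countable_rat)
  have "(\<Union>s\<in>?Q. \<Union>t\<in>?Q. ?N s t) \<in> sets (tree_borel f)"
    by (rule sets.countable_UN''[OF Q], rule sets.countable_UN''[OF Q], rule N)
  then show ?thesis unfolding eq by (rule sets.compl_sets)
qed

end

section \<open>Parametric representations of excursions with upward jumps\<close>

text \<open>The properties of the normalized excursion on which the tree depends.\<close>
locale excursion_path =
  fixes x :: "real \<Rightarrow> real"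
  assumes right_cont: "\<And>t. 0 \<le> t \<Longrightarrow> t < 1 \<Longrightarrow> (x \<longlongrightarrow> x t) (at_right t)"
    and left_limit: "\<And>t. 0 < t \<Longrightarrow> t \<le> 1 \<Longrightarrow> (x \<longlongrightarrow> left_lim x t) (at_left t)"
    and jump_nonneg: "\<And>t. 0 < t \<Longrightarrow> t \<le> 1 \<Longrightarrow> left_lim x t \<le> x t"
    and nonneg: "\<And>t. 0 \<le> t \<Longrightarrow> t \<le> 1 \<Longrightarrow> 0 \<le> x t"
    and pos: "\<And>t. 0 < t \<Longrightarrow> t < 1 \<Longrightarrow> 0 < x t"
    and at_1: "x 1 = 0"
begin

lemma left_lim_le: "0 \<le> t \<Longrightarrow> t \<le> 1 \<Longrightarrow> left_lim x t \<le> x t"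
  using jump_nonneg[of t] by (cases "t = 0") (simp_all add: left_lim_def)

lemma left_lim_nonneg:
  assumes "0 \<le> t" "t \<le> 1" shows "0 \<le> left_lim x t"
proof (cases "t = 0")
  case True
  then show ?thesis using nonneg[of 0] by (simp add: left_lim_def)
next
  case False
  then have t: "0 < t" using assms by simp
  have "\<forall>\<^sub>F s in at_left t. 0 \<le> x s"
    unfolding eventually_at_left[OF t] using nonneg assms t by (intro exI[of _ 0]) simp
  moreover have "at_left t \<noteq> bot" by simp
  ultimately show ?thesis using tendsto_lowerbound[OF left_limit[OF t assms(2)]] by blast
qed

lemma mem_completed_graph_iff:
  "(z, t) \<in> completed_graph x \<longleftrightarrow> 0 \<le> t \<and> t \<le> 1 \<and> left_lim x t \<le> z \<and> z \<le> x t"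
proof
  assume "(z, t) \<in> completed_graph x"
  then obtain l where tl: "z = l * left_lim x t + (1 - l) * x t" "t \<in> {0..1}" "l \<in> {0..1}"
    unfolding completed_graph_def by blast
  have le: "0 \<le> x t - left_lim x t" using left_lim_le tl by simp
  have "0 \<le> l * (x t - left_lim x t)" "0 \<le> (1 - l) * (x t - left_lim x t)"
    using le tl(3) by (simp_all add: mult_nonneg_nonneg)
  then show "0 \<le> t \<and> t \<le> 1 \<and> left_lim x t \<le> z \<and> z \<le> x t"
    using tl(2) unfolding tl(1) by (simp add: algebra_simps)
next
  assume a: "0 \<le> t \<and> t \<le> 1 \<and> left_lim x t \<le> z \<and> z \<le> x t"
  show "(z, t) \<in> completed_graph x"
  proof (cases "left_lim x t = x t")
    case True
    then have "z = 0 * left_lim x t + (1 - 0) * x t" using a by simp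
    then show ?thesis unfolding completed_graph_def using a
      by (intro CollectI exI[of _ t] exI[of _ "0::real"]) simp
  next
    case False
    define l where "l = (x t - z) / (x t - left_lim x t)"
    have p: "0 < x t - left_lim x t" using False a by simp
    have "0 \<le> l" "l \<le> 1" unfolding l_def using p a by (simp_all add: divide_simps)
    moreover have "l * (x t - left_lim x t) = x t - z" unfolding l_def using p by simp
    then have "z = l * left_lim x t + (1 - l) * x t" by (simp add: algebra_simps)
    ultimately show ?thesis unfolding completed_graph_def using a
      by (intro CollectI exI[of _ t] exI[of _ l]) simp
  qed
qed

end

text \<open>In terms of the coded tree: neither side of \<open>u\<close> carries, close to \<open>u\<close>, a subtree attached to the
  point coded by \<open>u\<close>.\<close>
definition dips_at :: "(real \<Rightarrow> real) \<Rightarrow> real \<Rightarrow> bool" where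
  "dips_at x u \<longleftrightarrow> (\<forall>a<u. \<exists>w\<in>{a<..<u}. x w < x u) \<and> (\<forall>b>u. \<exists>w\<in>{u<..<b}. x w < x u)"

locale parametrized_excursion = excursion_path +
  fixes \<xi> \<tau> :: "real \<Rightarrow> real"
  assumes rep: "parametric_representation x \<xi> \<tau>"
begin

lemma in_graph:
  assumes "0 \<le> s" "s \<le> 1"
  shows "0 \<le> \<tau> s" "\<tau> s \<le> 1" "left_lim x (\<tau> s) \<le> \<xi> s" "\<xi> s \<le> x (\<tau> s)"
proof -
  have "(\<xi> s, \<tau> s) \<in> completed_graph x"
    using rep assms unfolding parametric_representation_def by auto
  then show "0 \<le> \<tau> s" "\<tau> s \<le> 1" "left_lim x (\<tau> s) \<le> \<xi> s" "\<xi> s \<le> x (\<tau> s)"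
    unfolding mem_completed_graph_iff by blast+
qed

lemma graph_point:
  assumes "0 \<le> t" "t \<le> 1" "left_lim x t \<le> z" "z \<le> x t"
  shows "\<exists>s. 0 \<le> s \<and> s \<le> 1 \<and> \<tau> s = t \<and> \<xi> s = z"
proof -
  have "(z, t) \<in> completed_graph x" unfolding mem_completed_graph_iff using assms by blast
  then have "(z, t) \<in> (\<lambda>s. (\<xi> s, \<tau> s)) ` {0..1}"
    using rep unfolding parametric_representation_def by simp
  then show ?thesis by auto
qed

lemma graph_point_value:
  "\<lbrakk>0 \<le> t; t \<le> 1\<rbrakk> \<Longrightarrow> \<exists>s. 0 \<le> s \<and> s \<le> 1 \<and> \<tau> s = t \<and> \<xi> s = x t"
  by (rule graph_point[OF _ _ left_lim_le]) simp_all

lemma param_mono: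
  assumes "0 \<le> s" "s \<le> s'" "s' \<le> 1"
  shows "\<tau> s \<le> \<tau> s'" "\<tau> s = \<tau> s' \<Longrightarrow> \<xi> s \<le> \<xi> s'"
proof -
  have g: "graph_le x (\<xi> s, \<tau> s) (\<xi> s', \<tau> s')"
    using rep assms unfolding parametric_representation_def by (auto elim: monotone_onD)
  then show "\<tau> s \<le> \<tau> s'" unfolding graph_le_def by auto
  show "\<xi> s \<le> \<xi> s'" if e: "\<tau> s = \<tau> s'"
    using g e in_graph(3)[of s] in_graph(3)[of s'] assms unfolding graph_le_def by simp
qed

lemma param_less: "\<lbrakk>0 \<le> s'; s \<le> 1; \<tau> s < \<tau> s'\<rbrakk> \<Longrightarrow> s < s'"
  using param_mono(1)[of s' s] by fastforce

lemma cont_\<xi>: "continuous_on {0..1} \<xi>" and cont_\<tau>: "continuous_on {0..1} \<tau>"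
proof -
  have c: "continuous_on {0..1} (\<lambda>s. (\<xi> s, \<tau> s))"
    using rep unfolding parametric_representation_def by simp
  show "continuous_on {0..1} \<xi>" using continuous_on_fst[OF c] by simp
  show "continuous_on {0..1} \<tau>" using continuous_on_snd[OF c] by simp
qed

sublocale coding_function \<xi>
  by unfold_locales (rule cont_\<xi>)

lemma \<tau>_0: "\<tau> 0 = 0"
proof -
  obtain s where "0 \<le> s" "s \<le> 1" "\<tau> s = 0" using graph_point_value[of 0] by force
  then show ?thesis using param_mono(1)[of 0 s] in_graph(1)[of 0] by simp
qed

lemma at_end: "\<tau> 1 = 1" "\<xi> 1 = 0"
proof -
  obtain s where s: "0 \<le> s" "s \<le> 1" "\<tau> s = 1" "\<xi> s = x 1" using graph_point_value[of 1] by force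
  then show e: "\<tau> 1 = 1" using param_mono(1)[of s 1] in_graph(2)[of 1] by simp
  then show "\<xi> 1 = 0" using param_mono(2)[of s 1] s in_graph(4)[of 1] at_1 by simp
qed

lemma \<xi>_nonneg:
  assumes "0 \<le> s" "s \<le> 1" shows "0 \<le> \<xi> s"
  using in_graph(3)[OF assms] left_lim_nonneg[OF in_graph(1,2)[OF assms]] by linarith

text \<open>Inside a jump \<open>\<xi>\<close> increases.  A time from which \<open>\<xi>\<close> was higher shortly before, and which is a
  minimum since, must therefore sit at the bottom of the jump: its level is a left limit of \<open>x\<close>.\<close>
lemma descent_to_minimum:
  assumes "0 \<le> t" "t < a" "a \<le> 1" "\<xi> a < \<xi> t" "\<And>u. t \<le> u \<Longrightarrow> u \<le> a \<Longrightarrow> \<xi> a \<le> \<xi> u"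
  shows "\<tau> t < \<tau> a" "left_lim x (\<tau> a) = \<xi> a"
proof -
  have a: "0 \<le> a" using assms by simp
  have le: "\<tau> t \<le> \<tau> a" using param_mono(1)[of t a] assms by simp
  have "\<tau> t \<noteq> \<tau> a" using param_mono(2)[OF assms(1) less_imp_le[OF assms(2)] assms(3)] assms(4) by linarith
  then show lt: "\<tau> t < \<tau> a" using le by simp
  obtain u where u: "0 \<le> u" "u \<le> 1" "\<tau> u = \<tau> a" "\<xi> u = left_lim x (\<tau> a)"
    using graph_point[OF in_graph(1,2)[OF a assms(3)] order_refl left_lim_le[OF in_graph(1,2)[OF a assms(3)]]] by blast
  have "t < u" by (rule param_less) (use u lt assms(2,3) in simp_all)
  have "\<xi> a \<le> \<xi> u"
  proof (cases "u \<le> a")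
    case True
    show ?thesis by (rule assms(5)) (use True \<open>t < u\<close> in simp_all)
  next
    case False
    show ?thesis by (rule param_mono(2)) (use False a u in simp_all)
  qed
  then show "left_lim x (\<tau> a) = \<xi> a" using in_graph(3)[OF a assms(3)] u(4) by simp
qed

text \<open>This carries the pattern of \<open>tree_degree_in_123\<close> over from \<open>\<xi>\<close> to \<open>x\<close>.  The third high point \<open>t3\<close>
  may belong to the jump that starts at the second minimum; then right continuity of \<open>x\<close> provides
  the time \<open>B\<close> up to which \<open>x\<close> stays above the level.\<close>
lemma twin_minima:
  assumes ord: "0 \<le> t1" "t1 < a1" "a1 < t2" "t2 < a2" "a2 < t3" "t3 \<le> 1"
    and lev: "\<xi> a1 = \<xi> a2" "\<And>u. t1 \<le> u \<Longrightarrow> u \<le> t3 \<Longrightarrow> \<xi> a1 \<le> \<xi> u" "\<xi> a1 < \<xi> t1" "\<xi> a1 < \<xi> t2" "\<xi> a1 < \<xi> t3"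
  obtains T A1 A2 B h where "0 \<le> T" "T < A1" "A1 < A2" "A2 < B" "B \<le> 1"
    "\<And>w. T < w \<Longrightarrow> w < B \<Longrightarrow> h \<le> x w" "left_lim x A1 = h" "left_lim x A2 = h"
proof -
  have d1: "\<tau> t1 < \<tau> a1" "left_lim x (\<tau> a1) = \<xi> a1"
    using descent_to_minimum[of t1 a1] ord lev by simp_all
  have d2: "\<tau> t2 < \<tau> a2" "left_lim x (\<tau> a2) = \<xi> a1"
    using descent_to_minimum[of t2 a2] ord lev by simp_all
  have le: "\<tau> a1 \<le> \<tau> t2" "\<tau> a2 \<le> \<tau> t3" using param_mono(1)[of a1 t2] param_mono(1)[of a2 t3] ord by simp_all
  have r: "0 \<le> \<tau> t1" "0 \<le> \<tau> a2" "\<tau> a2 \<le> 1" "\<tau> t3 \<le> 1" "\<xi> t3 \<le> x (\<tau> t3)"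
    using in_graph[of t1] in_graph[of a2] in_graph[of t3] ord by simp_all
  have below: "\<xi> a1 \<le> x w" if w: "\<tau> t1 < w" "w < \<tau> t3" for w
  proof -
    have w01: "0 \<le> w" "w \<le> 1" using w r by linarith+
    obtain u where u: "0 \<le> u" "u \<le> 1" "\<tau> u = w" "\<xi> u = x w"
      using graph_point_value[OF w01] by blast
    have "t1 < u" "u < t3" by (rule param_less; use u w ord in simp)+
    then show ?thesis using lev(2)[of u] u by simp
  qed
  show ?thesis
  proof (cases "\<tau> a2 < \<tau> t3")
    case True
    show ?thesis
      by (rule that[of "\<tau> t1" "\<tau> a1" "\<tau> a2" "\<tau> t3" "\<xi> a1"]) (use True d1 d2 le r below in simp_all)
  next
    case False
    then have e: "\<tau> t3 = \<tau> a2" using le by simp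
    have gt: "\<xi> a1 < x (\<tau> a2)" using e r lev by simp
    \<comment> \<open>The path cannot jump upwards at time 1, because it ends at 0.\<close>
    have "\<tau> a2 \<noteq> 1"
    proof
      assume "\<tau> a2 = 1"
      then have "\<xi> a1 < 0" using gt at_1 by simp
      then show False using \<xi>_nonneg[of a1] ord by simp
    qed
    then have lt1: "\<tau> a2 < 1" using r by simp
    have "\<forall>\<^sub>F w in at_right (\<tau> a2). \<xi> a1 < x w"
      using order_tendstoD(1)[OF right_cont[OF r(2) lt1] gt] .
    then obtain b where b: "\<tau> a2 < b" "\<And>w. \<tau> a2 < w \<Longrightarrow> w < b \<Longrightarrow> \<xi> a1 < x w"
      unfolding eventually_at_right_field by blast
    define B where "B = min 1 b"
    have B: "\<tau> a2 < B" "B \<le> 1" using b lt1 by (simp_all add: B_def)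
    have "\<xi> a1 \<le> x w" if w: "\<tau> t1 < w" "w < B" for w
    proof -
      consider "w < \<tau> a2" | "w = \<tau> a2" | "\<tau> a2 < w" by linarith
      then show ?thesis
      proof cases
        case 1 then show ?thesis using below w e by simp
      next
        case 2 then show ?thesis using gt by simp
      next
        case 3 then show ?thesis using b(2)[of w] w by (simp add: B_def)
      qed
    qed
    then show ?thesis using that[of "\<tau> t1" "\<tau> a1" "\<tau> a2" B "\<xi> a1"] d1 d2 le r B by simp
  qed
qed

text \<open>The right-continuous inverse picks the last parameter at which \<open>\<tau>\<close> equals \<open>u\<close>, that is, the top
  \<open>x u\<close> of the jump at \<open>u\<close>.\<close>
lemma right_inverse_props:
  assumes u: "0 \<le> u" "u < 1"
  defines "\<sigma> \<equiv> right_inverse \<tau> u"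
  shows "0 \<le> \<sigma>" "\<sigma> \<le> 1" "\<tau> \<sigma> = u" "\<xi> \<sigma> = x u"
proof -
  define S where "S = {s \<in> {0..1}. u < \<tau> s}"
  have 1: "1 \<in> S" using u at_end by (simp add: S_def)
  have \<sigma>: "\<sigma> = Inf S" using 1 by (simp add: \<sigma>_def right_inverse_def S_def insert_absorb)
  have bdd: "bdd_below S" by (rule bdd_belowI[of _ 0]) (simp add: S_def)
  have ge: "c \<le> \<sigma>" if "\<And>s. s \<in> S \<Longrightarrow> c \<le> s" for c unfolding \<sigma> using 1 that by (intro cInf_greatest) auto
  have lower: "\<sigma> \<le> s" if "s \<in> S" for s unfolding \<sigma> using that bdd by (rule cInf_lower)
  show s0: "0 \<le> \<sigma>" by (rule ge) (simp add: S_def)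
  show s1: "\<sigma> \<le> 1" by (rule lower[OF 1])
  have c: "continuous_on {a..b} \<tau>" if "0 \<le> a" "b \<le> 1" for a b
    by (rule continuous_on_subset[OF cont_\<tau>]) (use that in auto)
  have "\<not> u < \<tau> \<sigma>"
  proof
    assume a: "u < \<tau> \<sigma>"
    obtain s where s: "0 \<le> s" "s \<le> \<sigma>" "\<tau> s = (u + \<tau> \<sigma>) / 2"
      using IVT'[of \<tau> 0 "(u + \<tau> \<sigma>) / 2" \<sigma>, OF _ _ s0 c[OF order_refl s1]] a u \<tau>_0 by auto
    then have "s \<in> S" using a s1 by (simp add: S_def)
    from lower[OF this] have "s = \<sigma>" using s by simp
    then show False using s a by simp
  qed
  moreover have "\<not> \<tau> \<sigma> < u"
  proof
    assume a: "\<tau> \<sigma> < u"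
    obtain s where s: "\<sigma> \<le> s" "s \<le> 1" "\<tau> s = u"
      using IVT'[of \<tau> \<sigma> u 1, OF _ _ s1 c[OF s0 order_refl]] a u at_end by auto
    have "s \<le> \<sigma>"
    proof (rule ge)
      fix r assume "r \<in> S"
      then have r: "0 \<le> r" "u < \<tau> r" by (simp_all add: S_def)
      have "s < r" by (rule param_less) (use r s in simp_all)
      then show "s \<le> r" by simp
    qed
    then show False using s a by simp
  qed
  ultimately show \<tau>: "\<tau> \<sigma> = u" by simp
  obtain s where s: "0 \<le> s" "s \<le> 1" "\<tau> s = u" "\<xi> s = x u"
    using graph_point_value[of u] u by force
  have "s \<le> \<sigma>"
  proof (rule ge)
    fix r assume "r \<in> S"
    then have r: "0 \<le> r" "u < \<tau> r" by (simp_all add: S_def)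
    have "s < r" by (rule param_less) (use r s in simp_all)
    then show "s \<le> r" by simp
  qed
  then show "\<xi> \<sigma> = x u" using param_mono(2)[of s \<sigma>] s \<tau> s1 in_graph(4)[OF s0 s1] by simp
qed

lemma right_inverse_range: "0 \<le> right_inverse \<tau> u" "right_inverse \<tau> u \<le> 1"
  unfolding right_inverse_def
  by (auto intro!: cInf_greatest cInf_lower bdd_belowI[of _ 0])

lemma right_inverse_mono: "mono (right_inverse \<tau>)"
  unfolding right_inverse_def
  by (rule monoI, rule cInf_superset_mono) (auto intro!: bdd_belowI[of _ 0])

lemma two_points:
  obtains s where "s \<in> {0..1}" "tree_proj \<xi> s \<noteq> tree_proj \<xi> 1"
proof -
  obtain s where s: "0 \<le> s" "s \<le> 1" "\<xi> s = x (1/2)"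
    using graph_point_value[of "1/2"] by force
  have "0 < x (1/2)" by (rule pos) simp_all
  then have "\<xi> s \<noteq> \<xi> 1" using s at_end by simp
  then show ?thesis using that[of s] tree_proj_eqD(1)[of s 1] s by auto
qed

lemma other_point: obtains w where "w \<in> tree_points \<xi>" "w \<noteq> v"
  using two_points tree_proj_in by (metis atLeastAtMost_iff order_refl zero_le_one)

text \<open>A parameter with the same projection but another time would have a dip below the common level
  between them.\<close>
lemma dip_class:
  assumes u: "0 < u" "u < 1" "dips_at x u" and a: "0 \<le> a" "a \<le> 1" "tree_proj \<xi> a = tree_proj \<xi> (right_inverse \<tau> u)"
  shows "\<tau> a = u" "\<xi> a = x u"
proof -
  define \<sigma> where "\<sigma> = right_inverse \<tau> u"
  have \<sigma>: "0 \<le> \<sigma>" "\<sigma> \<le> 1" "\<tau> \<sigma> = u" "\<xi> \<sigma> = x u" using right_inverse_props[of u] u by (simp_all add: \<sigma>_def)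
  have in01: "a \<in> {0..1}" "\<sigma> \<in> {0..1}" using a \<sigma> by simp_all
  note eq = tree_proj_eqD[OF in01 a(3)[folded \<sigma>_def]]
  show \<xi>: "\<xi> a = x u" using eq(1) \<sigma> by simp
  have no: False if w: "w \<in> {min (\<tau> a) u<..<max (\<tau> a) u}" "x w < x u" for w
  proof -
    have w01: "0 \<le> w" "w \<le> 1" using w(1) u in_graph[OF a(1,2)] by auto
    obtain r where r: "0 \<le> r" "r \<le> 1" "\<tau> r = w" "\<xi> r = x w"
      using graph_point_value[OF w01] by blast
    have "min a \<sigma> \<le> r \<and> r \<le> max a \<sigma>"
    proof (cases "\<tau> a \<le> u")
      case True
      have "a < r" by (rule param_less) (use True w(1) r a \<sigma> in simp_all)
      moreover have "r < \<sigma>" by (rule param_less) (use True w(1) r a \<sigma> in simp_all)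
      ultimately show ?thesis by simp
    next
      case False
      have "\<sigma> < r" by (rule param_less) (use False w(1) r a \<sigma> in simp_all)
      moreover have "r < a" by (rule param_less) (use False w(1) r a \<sigma> in simp_all)
      ultimately show ?thesis by simp
    qed
    then have "min a \<sigma> \<le> r" "r \<le> max a \<sigma>" by simp_all
    then have "\<xi> a \<le> \<xi> r" by (rule eq(2))
    then show False using \<xi> r w by simp
  qed
  show "\<tau> a = u"
  proof (rule ccontr)
    assume "\<tau> a \<noteq> u"
    then consider "\<tau> a < u" | "u < \<tau> a" by linarith
    then show False
    proof cases
      case 1
      then obtain w where "w \<in> {\<tau> a<..<u}" "x w < x u" using u(3) unfolding dips_at_def by blast
      then show False using no[of w] 1 by simp
    next
      case 2
      then obtain w where "w \<in> {u<..<\<tau> a}" "x w < x u" using u(3) unfolding dips_at_def by blast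
      then show False using no[of w] 2 by simp
    qed
  qed
qed

text \<open>On either side of the class of \<open>u\<close> one leaves it either by changing the time, and then meets a dip
  of \<open>x\<close>, or, to the left, by going down into the jump at \<open>u\<close>.  So \<open>leaf_criterion\<close> applies.\<close>
lemma dip_is_leaf:
  assumes u: "0 < u" "u < 1" "dips_at x u"
  shows "tree_proj \<xi> (right_inverse \<tau> u) \<in> tree_leaves \<xi>"
proof -
  define \<sigma> where "\<sigma> = right_inverse \<tau> u"
  have \<sigma>: "0 \<le> \<sigma>" "\<sigma> \<le> 1" "\<tau> \<sigma> = u" "\<xi> \<sigma> = x u" using right_inverse_props[of u] u by (simp_all add: \<sigma>_def)
  note cl = dip_class[OF u, folded \<sigma>_def]
  obtain w where w: "w \<in> tree_points \<xi>" "w \<noteq> tree_proj \<xi> \<sigma>" by (rule other_point)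
  have on_level: "tree_proj \<xi> s = tree_proj \<xi> a" 
    if "0 \<le> s" "s \<le> 1" "\<tau> s = u" "\<xi> s = x u" "0 \<le> a" "a \<le> 1" "\<tau> a = u" "\<xi> a = x u" for s a
  proof -
    have *: "tree_proj \<xi> s = tree_proj \<xi> a"
      if h: "0 \<le> s" "\<tau> s = u" "\<xi> s = x u" "a \<le> 1" "\<tau> a = u" "\<xi> a = x u" "s \<le> a" for s a
    proof (rule tree_proj_eqI[OF h(1,7,4,3,6)])
      fix r assume r: "s \<le> r" "r \<le> a"
      have "\<tau> r = u" using param_mono(1)[of s r] param_mono(1)[of r a] h r by simp
      have "\<xi> s \<le> \<xi> r" by (rule param_mono(2)) (use \<open>\<tau> r = u\<close> h r in simp_all)
      then show "x u \<le> \<xi> r" using h by simp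
    qed
    show ?thesis
    proof (cases "s \<le> a")
      case True
      show ?thesis by (rule *) (use True that in simp_all)
    next
      case False
      have "tree_proj \<xi> a = tree_proj \<xi> s" by (rule *) (use False that in simp_all)
      then show ?thesis by simp
    qed
  qed
  show ?thesis unfolding \<sigma>_def[symmetric]
  proof (rule leaf_criterion[OF _ w])
    show "\<sigma> \<in> {0..1}" using \<sigma> by simp
  next
    fix a s assume as: "tree_proj \<xi> a = tree_proj \<xi> \<sigma>" "0 \<le> s" "s < a" "a \<le> 1" "tree_proj \<xi> s \<noteq> tree_proj \<xi> \<sigma>"
    have a0: "0 \<le> a" using as by simp
    note ca = cl[OF a0 as(4,1)]
    have le: "\<tau> s \<le> u" using param_mono(1)[of s a] as ca by simp
    show "\<exists>r\<in>{s..a}. \<xi> r < \<xi> a"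
    proof (cases "\<tau> s = u")
      case True
      have "\<xi> s \<le> \<xi> a" by (rule param_mono(2)) (use as True ca in simp_all)
      moreover have "\<xi> s \<noteq> \<xi> a"
      proof
        assume "\<xi> s = \<xi> a"
        then have "tree_proj \<xi> s = tree_proj \<xi> a" by (intro on_level) (use True as ca a0 in simp_all)
        then show False using as by simp
      qed
      ultimately show ?thesis using as by (intro bexI[of _ s]) simp_all
    next
      case False
      then have "\<tau> s < u" using le by simp
      then obtain v where v: "v \<in> {\<tau> s<..<u}" "x v < x u" using u(3) unfolding dips_at_def by blast
      have v01: "0 \<le> v" "v \<le> 1" using v u in_graph(1)[of s] as by auto
      obtain r where r: "0 \<le> r" "r \<le> 1" "\<tau> r = v" "\<xi> r = x v"
        using graph_point_value[OF v01] by blast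
      have "s < r" "r < a" by (rule param_less; use r v as ca in simp)+
      then show ?thesis using v r ca by (intro bexI[of _ r]) simp_all
    qed
  next
    fix a s assume as: "tree_proj \<xi> a = tree_proj \<xi> \<sigma>" "0 \<le> a" "a < s" "s \<le> 1" "tree_proj \<xi> s \<noteq> tree_proj \<xi> \<sigma>"
    have a1: "a \<le> 1" using as by simp
    note ca = cl[OF as(2) a1 as(1)]
    have le: "u \<le> \<tau> s" using param_mono(1)[of a s] as ca by simp
    show "\<exists>r\<in>{a..s}. \<xi> r < \<xi> a"
    proof (cases "\<tau> s = u")
      case True
      have "\<xi> a \<le> \<xi> s" by (rule param_mono(2)) (use as True ca in simp_all)
      moreover have "\<xi> s \<le> x u" using in_graph(4)[of s] as True by simp
      ultimately have "\<xi> s = x u" using ca by simp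
      then have "tree_proj \<xi> s = tree_proj \<xi> a" by (intro on_level) (use True as ca a1 in simp_all)
      then show ?thesis using as by simp
    next
      case False
      then have "u < \<tau> s" using le by simp
      then obtain v where v: "v \<in> {u<..<\<tau> s}" "x v < x u" using u(3) unfolding dips_at_def by blast
      have v01: "0 \<le> v" "v \<le> 1" using v u in_graph(2)[of s] as by auto
      obtain r where r: "0 \<le> r" "r \<le> 1" "\<tau> r = v" "\<xi> r = x v"
        using graph_point_value[OF v01] by blast
      have "a < r" "r < s" by (rule param_less; use r v as ca a1 in simp)+
      then show ?thesis using v r ca by (intro bexI[of _ r]) simp_all
    qed
  qed
qed

section \<open>The measure on the tree, and density of the leaves\<close>

lemma measurable_tree_param:
  "(\<lambda>u. tree_proj \<xi> (right_inverse \<tau> u)) \<in> measurable (uniform_measure lborel {0..1}) (tree_borel \<xi>)"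
  unfolding tree_borel_def
proof (rule measurable_measure_of)
  show "{U. openin (tree_top \<xi>) U} \<subseteq> Pow (tree_points \<xi>)" by (auto simp: openin_tree_top)
  show "(\<lambda>u. tree_proj \<xi> (right_inverse \<tau> u)) \<in> space (uniform_measure lborel {0..1}) \<rightarrow> tree_points \<xi>"
    using right_inverse_range by auto
  fix U assume "U \<in> {U. openin (tree_top \<xi>) U}"
  then have "openin (top_of_set {0..1}) {s \<in> {0..1}. tree_proj \<xi> s \<in> U}"
    using continuous_map_tree_proj unfolding continuous_map_def by simp
  then obtain T where T: "open T" "{s \<in> {0..1}. tree_proj \<xi> s \<in> U} = {0..1} \<inter> T"
    unfolding openin_open by blast
  have "right_inverse \<tau> \<in> borel_measurable borel" by (rule borel_measurable_mono[OF right_inverse_mono])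
  then have "right_inverse \<tau> -` ({0..1} \<inter> T) \<inter> space borel \<in> sets borel"
    by (rule measurable_sets) (use T in simp)
  moreover have "(\<lambda>u. tree_proj \<xi> (right_inverse \<tau> u)) -` U \<inter> space (uniform_measure lborel {0..1})
     = right_inverse \<tau> -` ({0..1} \<inter> T) \<inter> space borel"
    unfolding T(2)[symmetric] using right_inverse_range by auto
  ultimately show "(\<lambda>u. tree_proj \<xi> (right_inverse \<tau> u)) -` U \<inter> space (uniform_measure lborel {0..1})
     \<in> sets (uniform_measure lborel {0..1})" by simp
qed

lemma emeasure_tree_measure:
  assumes "E \<in> sets (tree_borel \<xi>)"
  shows "{u \<in> {0..1}. tree_proj \<xi> (right_inverse \<tau> u) \<in> E} \<in> sets lborel"
    and "emeasure (tree_measure \<xi> \<tau>) E = emeasure lborel {u \<in> {0..1}. tree_proj \<xi> (right_inverse \<tau> u) \<in> E}"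
proof -
  let ?f = "\<lambda>u. tree_proj \<xi> (right_inverse \<tau> u)"
  have s: "?f -` E \<in> sets lborel" using measurable_sets[OF measurable_tree_param assms] by simp
  have e: "{u \<in> {0..1}. ?f u \<in> E} = {0..1} \<inter> ?f -` E" by auto
  show "{u \<in> {0..1}. ?f u \<in> E} \<in> sets lborel" unfolding e using s by simp
  have "emeasure (tree_measure \<xi> \<tau>) E = emeasure (uniform_measure lborel {0..1}) (?f -` E)"
    unfolding tree_measure_def using emeasure_distr[OF measurable_tree_param assms] by simp
  also have "\<dots> = emeasure lborel ({0..1} \<inter> ?f -` E) / emeasure lborel {0..1::real}"
    by (rule emeasure_uniform_measure) (use s in simp_all)
  finally show "emeasure (tree_measure \<xi> \<tau>) E = emeasure lborel {u \<in> {0..1}. ?f u \<in> E}"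
    unfolding e by (simp add: divide_ennreal_def)
qed

context
  assumes ae: "AE u in lborel. 0 < u \<longrightarrow> u < 1 \<longrightarrow> dips_at x u"
begin

lemma tree_measure_leaves: "emeasure (tree_measure \<xi> \<tau>) (tree_leaves \<xi>) = 1"
proof -
  obtain s where "s \<in> {0..1}" "tree_proj \<xi> s \<noteq> tree_proj \<xi> 1" by (rule two_points)
  then have L: "tree_leaves \<xi> \<in> sets (tree_borel \<xi>)"
    by (intro leaves_in_tree_borel[of "tree_proj \<xi> s" "tree_proj \<xi> 1"]) simp_all
  have "AE u in lborel. u \<noteq> (0::real)" "AE u in lborel. u \<noteq> (1::real)" by (rule AE_lborel_singleton)+
  with ae have "AE u in lborel. u \<in> {u \<in> {0..1}. tree_proj \<xi> (right_inverse \<tau> u) \<in> tree_leaves \<xi>} \<longleftrightarrow> u \<in> {0..1::real}"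
  proof eventually_elim
    case (elim u)
    have "tree_proj \<xi> (right_inverse \<tau> u) \<in> tree_leaves \<xi>" if "u \<in> {0..1}"
      by (rule dip_is_leaf) (use that elim in simp_all)
    then show ?case by blast
  qed
  then have "emeasure lborel {u \<in> {0..1}. tree_proj \<xi> (right_inverse \<tau> u) \<in> tree_leaves \<xi>} = emeasure lborel {0..1::real}"
    by (rule emeasure_eq_AE) (simp_all only: emeasure_tree_measure(1)[OF L], simp)
  then show ?thesis using emeasure_tree_measure(2)[OF L] by simp
qed

text \<open>A point coded by a dip receives no other time.  Any other point only receives times from the
  exceptional null set.\<close>
lemma tree_measure_no_atom:
  assumes v: "v \<in> tree_points \<xi>"
  shows "emeasure (tree_measure \<xi> \<tau>) {v} = 0"
proof -
  note V = singleton_in_tree_borel[OF v]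
  let ?A = "{u \<in> {0..1}. tree_proj \<xi> (right_inverse \<tau> u) \<in> {v}}"
  have N: "AE u in lborel. u \<noteq> (0::real)" "AE u in lborel. u \<noteq> (1::real)" by (rule AE_lborel_singleton)+
  have "AE u in lborel. u \<notin> ?A"
  proof (cases "\<exists>u0. 0 < u0 \<and> u0 < 1 \<and> dips_at x u0 \<and> tree_proj \<xi> (right_inverse \<tau> u0) = v")
    case True
    then obtain u0 where u0: "0 < u0" "u0 < 1" "dips_at x u0" "tree_proj \<xi> (right_inverse \<tau> u0) = v" by blast
    have "AE u in lborel. u \<noteq> u0" by (rule AE_lborel_singleton)
    with N show ?thesis
    proof eventually_elim
      case (elim u)
      show ?case
      proof
        assume A: "u \<in> ?A"
        have "\<tau> (right_inverse \<tau> u) = u0"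
          by (rule dip_class(1)[OF u0(1-3) right_inverse_range]) (use A u0(4) in simp)
        moreover have "\<tau> (right_inverse \<tau> u) = u" by (rule right_inverse_props(3)) (use A elim in simp_all)
        ultimately show False using elim by simp
      qed
    qed
  next
    case False
    from ae N show ?thesis
    proof eventually_elim
      case (elim u)
      show ?case
      proof
        assume A: "u \<in> ?A"
        then have "0 < u" "u < 1" using elim by simp_all
        then show False using elim(1) A False by blast
      qed
    qed
  qed
  then have "?A \<in> null_sets lborel" unfolding AE_iff_null_sets[OF emeasure_tree_measure(1)[OF V], symmetric] .
  then have "emeasure lborel ?A = 0" by (rule null_setsD1)
  then show ?thesis using emeasure_tree_measure(2)[OF V] by simp
qed

lemma dips_dense:
  assumes "0 \<le> a" "a < b" "b \<le> 1"
  obtains u where "a < u" "u < b" "dips_at x u"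
proof -
  have "\<not> (AE u in lborel. u \<notin> {a<..<b})"
  proof
    assume "AE u in lborel. u \<notin> {a<..<b}"
    then have "{a<..<b} \<in> null_sets lborel" by (subst AE_iff_null_sets) simp_all
    then have "emeasure lborel {a<..<b} = 0" by (rule null_setsD1)
    then show False using assms by simp
  qed
  moreover have "AE u in lborel. u \<notin> {a<..<b}" if no: "\<And>u. u \<in> {a<..<b} \<Longrightarrow> \<not> dips_at x u"
    using ae
  proof eventually_elim
    case (elim u)
    show ?case
    proof
      assume u: "u \<in> {a<..<b}"
      then have "0 < u" "u < 1" using assms by simp_all
      then show False using elim no[OF u] by blast
    qed
  qed
  ultimately obtain u where "u \<in> {a<..<b}" "dips_at x u" by blast
  then show ?thesis using that[of u] by simp
qed

text \<open>Between two parameters with different times there is a dip, whose parameter lies between them.\<close>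
lemma limit_of_leaves:
  assumes s: "s \<in> {0..1}"
    and var: "\<And>\<delta>. \<delta> > 0 \<Longrightarrow> \<exists>r1\<in>{0..1}. \<exists>r2\<in>{0..1}. \<bar>r1 - s\<bar> < \<delta> \<and> \<bar>r2 - s\<bar> < \<delta> \<and> \<tau> r1 < \<tau> r2"
  shows "tree_proj \<xi> s \<in> tree_top \<xi> closure_of tree_leaves \<xi>"
  unfolding in_closure_of
proof (intro conjI allI impI)
  show "tree_proj \<xi> s \<in> topspace (tree_top \<xi>)" using s by simp
  fix U assume U: "tree_proj \<xi> s \<in> U \<and> openin (tree_top \<xi>) U"
  then obtain r where r: "r > 0" "\<And>y. y \<in> tree_points \<xi> \<Longrightarrow> tree_dist \<xi> (tree_proj \<xi> s) y < r \<Longrightarrow> y \<in> U"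
    unfolding openin_tree_top by blast
  obtain \<delta> where \<delta>: "\<delta> > 0" "\<And>t. t \<in> {0..1} \<Longrightarrow> \<bar>t - s\<bar> < \<delta> \<Longrightarrow> code_dist \<xi> s t < r"
    using code_dist_small[OF s r(1)] by blast
  obtain r1 r2 where rr: "r1 \<in> {0..1}" "r2 \<in> {0..1}" "\<bar>r1 - s\<bar> < \<delta>" "\<bar>r2 - s\<bar> < \<delta>" "\<tau> r1 < \<tau> r2"
    using var[OF \<delta>(1)] by blast
  have t: "0 \<le> \<tau> r1" "\<tau> r2 \<le> 1" using in_graph[of r1] in_graph[of r2] rr by simp_all
  obtain u where u: "\<tau> r1 < u" "u < \<tau> r2" "dips_at x u" using dips_dense[OF t(1) rr(5) t(2)] by blast
  have u01: "0 < u" "u < 1" using u t by linarith+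
  define \<sigma> where "\<sigma> = right_inverse \<tau> u"
  have \<sigma>: "0 \<le> \<sigma>" "\<sigma> \<le> 1" "\<tau> \<sigma> = u" using right_inverse_props[of u] u01 by (simp_all add: \<sigma>_def)
  have "r1 < \<sigma>" "\<sigma> < r2" by (rule param_less; use rr \<sigma> u in simp)+
  then have "\<bar>\<sigma> - s\<bar> < \<delta>" using rr by simp
  then have "code_dist \<xi> s \<sigma> < r" using \<delta>(2) \<sigma> by simp
  then have "tree_proj \<xi> \<sigma> \<in> U" using r(2)[of "tree_proj \<xi> \<sigma>"] tree_dist_proj[OF cont_\<xi> s, of \<sigma>] \<sigma> by simp
  moreover have "tree_proj \<xi> \<sigma> \<in> tree_leaves \<xi>" unfolding \<sigma>_def by (rule dip_is_leaf[OF u01 u(3)])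
  ultimately show "\<exists>y. y \<in> tree_leaves \<xi> \<and> y \<in> U" by blast
qed

lemma last_representative:
  assumes s: "s \<in> {0..1}"
  obtains a where "a \<in> {0..1}" "tree_proj \<xi> a = tree_proj \<xi> s"
    "\<And>r. r \<in> {0..1} \<Longrightarrow> tree_proj \<xi> r = tree_proj \<xi> s \<Longrightarrow> r \<le> a"
proof -
  let ?A = "{r \<in> {0..1}. tree_proj \<xi> r \<in> {tree_proj \<xi> s}}"
  have "closedin (tree_top \<xi>) {tree_proj \<xi> s}"
    using closedin_Hausdorff_sing_eq[OF tree.Hausdorff_space_mtopology, folded tree_top_def] tree_proj_in[OF s]
    by (simp only: tree_topspace)
  then have "closedin (top_of_set {0..1}) {r \<in> topspace (top_of_set {0..1}). tree_proj \<xi> r \<in> {tree_proj \<xi> s}}"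
    by (rule closedin_continuous_map_preimage[OF continuous_map_tree_proj])
  then have "closedin (top_of_set {0..1}) ?A" by (simp only: topspace_euclidean_subtopology)
  then have "compact ?A" by (rule closedin_compact[OF compact_Icc])
  moreover have "?A \<noteq> {}" using s by blast
  ultimately have "\<exists>a\<in>?A. \<forall>r\<in>?A. r \<le> a" by (rule compact_attains_sup)
  then obtain a where a: "a \<in> ?A" "\<forall>r\<in>?A. r \<le> a" by (elim bexE)
  show ?thesis
  proof (rule that)
    show "a \<in> {0..1}" "tree_proj \<xi> a = tree_proj \<xi> s" using a(1) by simp_all
    fix r assume "r \<in> {0..1}" "tree_proj \<xi> r = tree_proj \<xi> s"
    then have "r \<in> ?A" by simp
    then show "r \<le> a" by (rule bspec[OF a(2)])
  qed
qed

text \<open>Take the last parameter \<open>a\<close> of the class of a point.  If \<open>\<tau>\<close> were constant just after \<open>a\<close>, the path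
  \<open>\<xi>\<close> would rise there along a jump and come back to the level of \<open>a\<close> later, because it
  ends at \<open>0\<close>; this would give a later parameter of the class.  So \<open>limit_of_leaves\<close> applies at
  \<open>a\<close>.  If \<open>a = 1\<close>, the point is the root, also coded by the first parameter at which \<open>\<tau>\<close> is \<open>1\<close>,
  and \<open>\<tau>\<close> is not constant just before that one.\<close>
lemma leaves_dense: "tree_top \<xi> closure_of tree_leaves \<xi> = tree_points \<xi>"
proof
  show "tree_top \<xi> closure_of tree_leaves \<xi> \<subseteq> tree_points \<xi>"
    using closure_of_subset_topspace[of "tree_top \<xi>" "tree_leaves \<xi>"] by simp
  show "tree_points \<xi> \<subseteq> tree_top \<xi> closure_of tree_leaves \<xi>"
  proof
    fix v assume "v \<in> tree_points \<xi>"
    then obtain s where s: "s \<in> {0..1}" "v = tree_proj \<xi> s" unfolding tree_points_eq by blast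
    obtain a where a: "a \<in> {0..1}" "tree_proj \<xi> a = v"
      "\<And>r. r \<in> {0..1} \<Longrightarrow> tree_proj \<xi> r = v \<Longrightarrow> r \<le> a"
      using last_representative[OF s(1), folded s(2)] by metis
    show "v \<in> tree_top \<xi> closure_of tree_leaves \<xi>"
    proof (cases "a = 1")
      case False
      then have a1: "0 \<le> a" "a < 1" using a by simp_all
      show ?thesis unfolding a(2)[symmetric]
      proof (rule limit_of_leaves[OF a(1)])
        fix \<delta> :: real assume \<delta>: "\<delta> > 0"
        define r where "r = min 1 (a + \<delta> / 2)"
        have r: "a < r" "r \<le> 1" "r - a < \<delta>" using \<delta> a1 by (simp_all add: r_def)
        have "\<tau> a < \<tau> r"
        proof (rule ccontr)
          assume "\<not> \<tau> a < \<tau> r"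
          then have c: "\<tau> r = \<tau> a" using param_mono(1)[of a r] r a1 by simp
          have up: "\<xi> a \<le> \<xi> q" if q: "a \<le> q" "q \<le> r" for q
          proof -
            have "\<tau> q = \<tau> a" using param_mono(1)[of a q] param_mono(1)[of q r] q r a1 c by simp
            show ?thesis by (rule param_mono(2)) (use \<open>\<tau> q = \<tau> a\<close> q r a1 in simp_all)
          qed
          have p: "0 \<le> r" "r \<le> 1" "1 \<le> (1::real)" "\<xi> 1 \<le> \<xi> a" "\<xi> a \<le> \<xi> r"
            using r a1 \<xi>_nonneg[of a] at_end up[of r] by simp_all
          obtain q where q: "r \<le> q" "q \<le> 1" "\<xi> q = \<xi> a" "\<And>p. r \<le> p \<Longrightarrow> p \<le> q \<Longrightarrow> \<xi> a \<le> \<xi> p"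
            using first_visit[OF p] by metis
          have "\<xi> a \<le> \<xi> p" if "a \<le> p" "p \<le> q" for p
            using up[of p] q(4)[of p] that by (cases "p \<le> r") simp_all
          then have "tree_proj \<xi> a = tree_proj \<xi> q"
            using a1 q r by (intro tree_proj_eqI[of _ _ "\<xi> a"]) simp_all
          then have "q \<le> a" using a(2) a(3)[of q] q r a1 by simp
          then show False using q r by simp
        qed
        moreover have "r \<in> {0..1}" "\<bar>a - a\<bar> < \<delta>" "\<bar>r - a\<bar> < \<delta>" using r a1 \<delta> by simp_all
        ultimately show "\<exists>r1\<in>{0..1}. \<exists>r2\<in>{0..1}. \<bar>r1 - a\<bar> < \<delta> \<and> \<bar>r2 - a\<bar> < \<delta> \<and> \<tau> r1 < \<tau> r2"
          using a(1) by blast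
      qed
    next
      case True
      define P where "P = {r \<in> {0..1}. \<tau> r = 1}"
      have "closed P" unfolding P_def
        by (rule continuous_closed_preimage_constant[OF cont_\<tau>]) simp
      moreover have "bounded P" by (rule bounded_subset[of "{0..1}"]) (auto simp: P_def)
      ultimately have "compact P" by (simp add: compact_eq_bounded_closed)
      moreover have "1 \<in> P" using at_end by (simp add: P_def)
      ultimately obtain p where p: "p \<in> P" "\<And>r. r \<in> P \<Longrightarrow> p \<le> r"
        using compact_attains_inf[of P] by blast
      have p01: "0 \<le> p" "p \<le> 1" "\<tau> p = 1" using p(1) by (simp_all add: P_def)
      have p0: "0 < p" using p01 \<tau>_0 by (cases "p = 0") simp_all
      have z: "\<xi> r = 0" if r: "p \<le> r" "r \<le> 1" for r
      proof -
        have "\<tau> r = 1" using param_mono(1)[of p r] in_graph(2)[of r] r p01 by simp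
        have "\<xi> r \<le> \<xi> 1" by (rule param_mono(2)) (use \<open>\<tau> r = 1\<close> at_end r p01 in simp_all)
        then show ?thesis using at_end \<xi>_nonneg[of r] r p01 by simp
      qed
      have "tree_proj \<xi> p = tree_proj \<xi> 1"
        using p01 z by (intro tree_proj_eqI[of _ _ 0]) simp_all
      then have v: "v = tree_proj \<xi> p" using a(2) True by simp
      show ?thesis unfolding v
      proof (rule limit_of_leaves)
        show "p \<in> {0..1}" using p01 by simp
        fix \<delta> :: real assume \<delta>: "\<delta> > 0"
        define r where "r = max 0 (p - \<delta> / 2)"
        have r: "0 \<le> r" "r < p" "p - r < \<delta>" using \<delta> p0 by (simp_all add: r_def)
        have "r \<notin> P" using p(2)[of r] r by auto
        then have "\<tau> r < \<tau> p" using p01 r in_graph(2)[of r] by (simp add: P_def)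
        moreover have "r \<in> {0..1}" "p \<in> {0..1}" "\<bar>p - p\<bar> < \<delta>" "\<bar>r - p\<bar> < \<delta>" using r p01 \<delta> by simp_all
        ultimately show "\<exists>r1\<in>{0..1}. \<exists>r2\<in>{0..1}. \<bar>r1 - p\<bar> < \<delta> \<and> \<bar>r2 - p\<bar> < \<delta> \<and> \<tau> r1 < \<tau> r2"
          by blast
      qed
    qed
  qed
qed

end

lemma tree_binary:
  assumes distinct_minima: "\<And>T A1 A2 B h. \<lbrakk>0 \<le> T; T < A1; A1 < A2; A2 < B; B \<le> 1;
      \<And>w. T < w \<Longrightarrow> w < B \<Longrightarrow> h \<le> x w; left_lim x A1 = h; left_lim x A2 = h\<rbrakk> \<Longrightarrow> False"
    and v: "v \<in> tree_points \<xi>"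
  shows "tree_degree \<xi> v \<in> {1, 2, 3}"
proof -
  obtain w where w: "w \<in> tree_points \<xi>" "w \<noteq> v" by (rule other_point)
  show ?thesis
  proof (rule tree_degree_in_123[OF v w])
    fix t1 a1 t2 a2 t3
    assume h: "0 \<le> t1" "t1 < a1" "a1 < t2" "t2 < a2" "a2 < t3" "t3 \<le> 1" "\<xi> a1 = \<xi> a2"
       "\<And>u. t1 \<le> u \<Longrightarrow> u \<le> t3 \<Longrightarrow> \<xi> a1 \<le> \<xi> u" "\<xi> a1 < \<xi> t1" "\<xi> a1 < \<xi> t2" "\<xi> a1 < \<xi> t3"
    show False
    proof (rule twin_minima[of t1 a1 t2 a2 t3])
      fix T A1 A2 B h'
      assume "0 \<le> T" "T < A1" "A1 < A2" "A2 < B" "B \<le> 1"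
        "\<And>w. T < w \<Longrightarrow> w < B \<Longrightarrow> h' \<le> x w" "left_lim x A1 = h'" "left_lim x A2 = h'"
      then show False by (rule distinct_minima)
    qed (use h in blast)+
  qed
qed

end

section \<open>Existence of a parametric representation\<close>

context excursion_path
begin

lemma close_right:
  assumes t: "0 \<le> t" "t < 1" and e: "\<epsilon> > 0"
  obtains \<delta> where "\<delta> > 0" "\<And>w. t < w \<Longrightarrow> w < t + \<delta> \<Longrightarrow> w \<le> 1 \<Longrightarrow> \<bar>x w - x t\<bar> \<le> \<epsilon> \<and> \<bar>left_lim x w - x t\<bar> \<le> \<epsilon>"
proof -
  have "\<forall>\<^sub>F w in at_right t. dist (x w) (x t) < \<epsilon>" by (rule tendstoD[OF right_cont[OF t] e])
  then obtain b where b: "t < b" "\<And>w. t < w \<Longrightarrow> w < b \<Longrightarrow> dist (x w) (x t) < \<epsilon>"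
    unfolding eventually_at_right_field by blast
  have "\<bar>x w - x t\<bar> \<le> \<epsilon> \<and> \<bar>left_lim x w - x t\<bar> \<le> \<epsilon>" if w: "t < w" "w < b" "w \<le> 1" for w
  proof
    show "\<bar>x w - x t\<bar> \<le> \<epsilon>" using b(2)[OF w(1,2)] by (simp add: dist_real_def)
    have w0: "0 < w" using t w by simp
    have "((\<lambda>v. \<bar>x v - x t\<bar>) \<longlongrightarrow> \<bar>left_lim x w - x t\<bar>) (at_left w)"
      by (intro tendsto_intros left_limit[OF w0 w(3)])
    moreover have "\<forall>\<^sub>F v in at_left w. \<bar>x v - x t\<bar> \<le> \<epsilon>"
      unfolding eventually_at_left[OF w(1)] 
    proof (intro exI[of _ t] conjI allI impI)
      fix v assume "t < v" "v < w"
      then have "dist (x v) (x t) < \<epsilon>" using b(2)[of v] w by simp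
      then show "\<bar>x v - x t\<bar> \<le> \<epsilon>" by (simp add: dist_real_def)
    qed (rule w(1))
    ultimately show "\<bar>left_lim x w - x t\<bar> \<le> \<epsilon>" by (rule tendsto_upperbound) simp
  qed
  then show ?thesis using that[of "b - t"] b(1) by simp
qed

lemma close_left:
  assumes t: "0 < t" "t \<le> 1" and e: "\<epsilon> > 0"
  obtains \<delta> where "\<delta> > 0" "\<And>w. t - \<delta> < w \<Longrightarrow> w < t \<Longrightarrow> 0 \<le> w \<Longrightarrow>
    \<bar>x w - left_lim x t\<bar> \<le> \<epsilon> \<and> \<bar>left_lim x w - left_lim x t\<bar> \<le> \<epsilon>"
proof -
  let ?l = "left_lim x t"
  have "\<forall>\<^sub>F w in at_left t. dist (x w) ?l < \<epsilon>" by (rule tendstoD[OF left_limit[OF t] e])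
  then obtain b where b: "b < t" "\<And>w. b < w \<Longrightarrow> w < t \<Longrightarrow> dist (x w) ?l < \<epsilon>"
    unfolding eventually_at_left_field by blast
  have "\<bar>x w - ?l\<bar> \<le> \<epsilon> \<and> \<bar>left_lim x w - ?l\<bar> \<le> \<epsilon>" if w: "b < w" "w < t" "0 \<le> w" for w
  proof
    show x: "\<bar>x w - ?l\<bar> \<le> \<epsilon>" using b(2)[OF w(1,2)] by (simp add: dist_real_def)
    show "\<bar>left_lim x w - ?l\<bar> \<le> \<epsilon>"
    proof (cases "w = 0")
      case True
      then show ?thesis using x by (simp add: left_lim_def)
    next
      case False
      then have w0: "0 < w" "w \<le> 1" using w t by simp_all
      have "((\<lambda>v. \<bar>x v - ?l\<bar>) \<longlongrightarrow> \<bar>left_lim x w - ?l\<bar>) (at_left w)"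
        by (intro tendsto_intros left_limit[OF w0])
      moreover have "\<forall>\<^sub>F v in at_left w. \<bar>x v - ?l\<bar> \<le> \<epsilon>"
        unfolding eventually_at_left[OF w(1)] 
      proof (intro exI[of _ b] conjI allI impI)
        fix v assume "b < v" "v < w"
        then have "dist (x v) ?l < \<epsilon>" using b(2)[of v] w by simp
        then show "\<bar>x v - ?l\<bar> \<le> \<epsilon>" by (simp add: dist_real_def)
      qed (rule w(1))
      ultimately show ?thesis by (rule tendsto_upperbound) simp
    qed
  qed
  then show ?thesis using that[of "t - b"] b(1) by simp
qed

text \<open>Near any time the path is close to one of two limits on either side, so large jumps do not
  accumulate.\<close>
lemma finite_large_jumps:
  assumes e: "\<epsilon> > 0"
  shows "finite {t \<in> {0..1}. \<epsilon> < x t - left_lim x t}" (is "finite ?J")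
proof (rule ccontr)
  assume "infinite ?J"
  moreover have "?J \<subseteq> {0..1}" by blast
  ultimately obtain t where t: "t \<in> {0..1}" "t islimpt ?J"
    using Heine_Borel_imp_Bolzano_Weierstrass[OF compact_Icc] by blast
  obtain d1 where d1: "d1 > 0" "\<And>w. t < w \<Longrightarrow> w < t + d1 \<Longrightarrow> w \<le> 1 \<Longrightarrow> x w - left_lim x w \<le> \<epsilon>"
  proof (cases "t < 1")
    case True
    then have t': "0 \<le> t" "t < 1" using t by simp_all
    obtain \<delta> where d: "\<delta> > 0" "\<And>w. t < w \<Longrightarrow> w < t + \<delta> \<Longrightarrow> w \<le> 1 \<Longrightarrow> \<bar>x w - x t\<bar> \<le> \<epsilon>/2 \<and> \<bar>left_lim x w - x t\<bar> \<le> \<epsilon>/2"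
      using close_right[OF t', of "\<epsilon>/2"] e by (metis half_gt_zero)
    have "x w - left_lim x w \<le> \<epsilon>" if "t < w" "w < t + \<delta>" "w \<le> 1" for w using d(2)[OF that] by linarith
    then show ?thesis using that d(1) by blast
  next
    case False
    then show ?thesis using that[of 1] by simp
  qed
  obtain d2 where d2: "d2 > 0" "\<And>w. t - d2 < w \<Longrightarrow> w < t \<Longrightarrow> 0 \<le> w \<Longrightarrow> x w - left_lim x w \<le> \<epsilon>"
  proof (cases "0 < t")
    case True
    then have t': "0 < t" "t \<le> 1" using t by simp_all
    obtain \<delta> where d: "\<delta> > 0" "\<And>w. t - \<delta> < w \<Longrightarrow> w < t \<Longrightarrow> 0 \<le> w \<Longrightarrow> \<bar>x w - left_lim x t\<bar> \<le> \<epsilon>/2 \<and> \<bar>left_lim x w - left_lim x t\<bar> \<le> \<epsilon>/2"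
      using close_left[OF t', of "\<epsilon>/2"] e by (metis half_gt_zero)
    have "x w - left_lim x w \<le> \<epsilon>" if "t - \<delta> < w" "w < t" "0 \<le> w" for w using d(2)[OF that] by linarith
    then show ?thesis using that d(1) by blast
  next
    case False
    then show ?thesis using that[of 1] t by simp
  qed
  have "0 < min d1 d2" using d1(1) d2(1) by simp
  then obtain w where w: "w \<in> ?J" "w \<noteq> t" "dist w t < min d1 d2"
    using t(2) unfolding islimpt_approachable by blast
  show False
  proof (cases "t < w")
    case True
    then show False using d1(2)[of w] w by (simp add: dist_real_def)
  next
    case False
    then show False using d2(2)[of w] w by (simp add: dist_real_def)
  qed
qed

lemma countable_jumps: "countable {t \<in> {0..1}. left_lim x t \<noteq> x t}"
proof -
  have "{t \<in> {0..1}. left_lim x t \<noteq> x t} \<subseteq> (\<Union>n. {t \<in> {0..1}. 1 / real (Suc n) < x t - left_lim x t})"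
  proof
    fix t assume t: "t \<in> {t \<in> {0..1}. left_lim x t \<noteq> x t}"
    then have "left_lim x t \<le> x t" by (intro left_lim_le) simp_all
    then have "0 < x t - left_lim x t" using t by simp
    then obtain n where "1 / real (Suc n) < x t - left_lim x t" by (rule nat_approx_posE)
    then show "t \<in> (\<Union>n. {t \<in> {0..1}. 1 / real (Suc n) < x t - left_lim x t})" using t by blast
  qed
  moreover have "countable (\<Union>n. {t \<in> {0..1}. 1 / real (Suc n) < x t - left_lim x t})"
    by (rule countable_UN[OF countableI_type countable_finite[OF finite_large_jumps]]) simp
  ultimately show ?thesis by (rule countable_subset)
qed

text \<open>A clock that runs at unit speed and halts at every jump time of \<open>x\<close>: \<open>B t\<close> and \<open>A t\<close> are the
  clock readings just before and just after the halt at \<open>t\<close>.  The halts are the atoms of a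
  probability measure that charges all jump times, and the one-sided limits are those of its
  distribution function.\<close>
lemma clock_exists:
  "\<exists>A B :: real \<Rightarrow> real. B 0 = 0 \<and> (\<forall>t. B t \<le> A t) \<and> (\<forall>t t'. t < t' \<longrightarrow> A t + (t' - t) \<le> B t') \<and>
    (\<forall>t. 0 \<le> t \<longrightarrow> t \<le> 1 \<longrightarrow> left_lim x t \<noteq> x t \<longrightarrow> B t < A t) \<and>
    (\<forall>t. (A \<longlongrightarrow> A t) (at_right t)) \<and> (\<forall>t. (A \<longlongrightarrow> B t) (at_left t))"
proof -
  \<comment> \<open>Inserting 1 makes the set nonempty; an further halt does no harm.\<close>
  define J where "J = insert 1 {t \<in> {0..1}. left_lim x t \<noteq> x t}"
  have J: "countable J" "J \<noteq> {}" using countable_jumps by (simp_all add: J_def)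
  define p where "p = map_pmf (from_nat_into J) (geometric_pmf (1/2))"
  have "set_pmf p = range (from_nat_into J)" unfolding p_def by (simp add: set_pmf_geometric)
  also have "\<dots> = J" by (rule range_from_nat_into[OF J(2,1)])
  finally have supp: "set_pmf p = J" .
  define N where "N = distr (measure_pmf p) borel (\<lambda>t. t)"
  have mN: "measure N S = measure_pmf.prob p S" if "S \<in> sets borel" for S
    unfolding N_def using that by (subst measure_distr) simp_all
  interpret N: real_distribution N unfolding N_def
    by (intro real_distribution.intro measure_pmf.prob_space_distr real_distribution_axioms.intro) simp_all
  define A where "A t = t + cdf N t" for t
  define B where "B t = t + measure N {..<t}" for t
  have notin: "0 \<notin> J" by (simp add: J_def left_lim_def)
  show ?thesis
  proof (rule exI[of _ A], rule exI[of _ B], intro conjI allI impI)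
    have "measure_pmf.prob p {..<0} = 0"
      unfolding measure_pmf_zero_iff supp by (auto simp: J_def)
    then show "B 0 = 0" by (simp add: B_def mN)
    show "B t \<le> A t" for t unfolding A_def B_def cdf_def2
      by (intro add_left_mono N.finite_measure_mono) auto
    show "A t + (t' - t) \<le> B t'" if "t < t'" for t t'
    proof -
      have "cdf N t \<le> measure N {..<t'}" unfolding cdf_def2
        by (intro N.finite_measure_mono) (use that in auto)
      then show ?thesis by (simp add: A_def B_def)
    qed
    show "B t < A t" if t: "0 \<le> t" "t \<le> 1" "left_lim x t \<noteq> x t" for t
    proof -
      have "t \<in> set_pmf p" using t by (simp add: supp J_def)
      then have "0 < measure N {t}" by (simp add: mN measure_pmf_single pmf_positive)
      moreover have "{..t} = {..<t} \<union> {t}" by auto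
      then have "cdf N t = measure N {..<t} + measure N {t}"
        unfolding cdf_def2 by (simp only:) (rule N.finite_measure_Union; simp)
      ultimately show ?thesis by (simp add: A_def B_def)
    qed
    show "(A \<longlongrightarrow> A t) (at_right t)" for t unfolding A_def
      using N.cdf_is_right_cont[of t] by (intro tendsto_intros) (simp add: continuous_within)
    show "(A \<longlongrightarrow> B t) (at_left t)" for t unfolding A_def B_def
      by (intro tendsto_intros N.cdf_at_left)
  qed
qed

text \<open>Read the clock of \<open>clock_exists\<close> backwards: at reading \<open>y\<close> the time is the unique \<open>T y\<close> with
  \<open>B (T y) \<le> y \<le> A (T y)\<close>, and during a halt the value moves at constant speed from the left limit
  to the right limit.  Dividing by the total duration \<open>L\<close> gives parameters in \<open>{0..1}\<close>.\<close>
lemma parametric_representation_exists: "\<exists>\<xi> \<tau>. parametric_representation x \<xi> \<tau>"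
proof -
  obtain A B :: "real \<Rightarrow> real" where B0: "B 0 = 0"
    and BA: "\<And>t. B t \<le> A t" and AB: "\<And>t t'. t < t' \<Longrightarrow> A t + (t' - t) \<le> B t'"
    and gap: "\<And>t. 0 \<le> t \<Longrightarrow> t \<le> 1 \<Longrightarrow> left_lim x t \<noteq> x t \<Longrightarrow> B t < A t"
    and Ar: "\<And>t. (A \<longlongrightarrow> A t) (at_right t)" and Al: "\<And>t. (A \<longlongrightarrow> B t) (at_left t)"
    using clock_exists by metis
  define L where "L = A 1"
  have L: "L \<ge> 1" using AB[of 0 1] BA[of 0] BA[of 1] B0 by (simp add: L_def)
  have ex: "\<exists>t. 0 \<le> t \<and> t \<le> 1 \<and> B t \<le> y \<and> y \<le> A t" if y: "0 \<le> y" "y \<le> L" for y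
  proof -
    define S where "S = {t \<in> {0..1}. B t \<le> y}"
    have S0: "0 \<in> S" using y B0 by (simp add: S_def)
    have bdd: "bdd_above S" by (rule bdd_aboveI[of _ 1]) (simp add: S_def)
    define T where "T = Sup S"
    have T0: "0 \<le> T" unfolding T_def by (rule cSup_upper[OF S0 bdd])
    have T1: "T \<le> 1" unfolding T_def using S0 by (intro cSup_least) (blast, simp add: S_def)
    have "B T \<le> y"
    proof (cases "T = 0")
      case True then show ?thesis using B0 y by simp
    next
      case False
      have "A t \<le> y" if t: "0 < t" "t < T" for t
      proof -
        obtain t' where "t' \<in> S" "t < t'" using less_cSupD[of S t] S0 t unfolding T_def by blast
        then show ?thesis using AB[of t t'] by (simp add: S_def)
      qed
      then have "\<forall>\<^sub>F t in at_left T. A t \<le> y"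
        unfolding eventually_at_left_field using T0 False by (intro exI[of _ 0]) simp
      with Al[of T] show ?thesis by (rule tendsto_upperbound) simp
    qed
    moreover have "y \<le> A T"
    proof (cases "T = 1")
      case True then show ?thesis using y by (simp add: L_def)
    next
      case False
      have "y \<le> A t" if t: "T < t" "t < 1" for t
      proof (rule ccontr)
        assume "\<not> y \<le> A t"
        then have "t \<in> S" using BA[of t] t T0 by (simp add: S_def)
        then have "t \<le> T" unfolding T_def by (rule cSup_upper[OF _ bdd])
        then show False using t by simp
      qed
      then have "\<forall>\<^sub>F t in at_right T. y \<le> A t"
        unfolding eventually_at_right_field using T1 False by (intro exI[of _ 1]) simp
      with Ar[of T] show ?thesis by (rule tendsto_lowerbound) simp
    qed
    ultimately show ?thesis using T0 T1 by blast
  qed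
  define T where "T y = (SOME t. 0 \<le> t \<and> t \<le> 1 \<and> B t \<le> y \<and> y \<le> A t)" for y
  have T: "0 \<le> T y" "T y \<le> 1" "B (T y) \<le> y" "y \<le> A (T y)" if "0 \<le> y" "y \<le> L" for y
    using someI_ex[OF ex[OF that]] unfolding T_def by blast+
  have T_mono: "T y \<le> T y'" "T y' - T y \<le> y' - y" if y: "0 \<le> y" "y \<le> y'" "y' \<le> L" for y y'
  proof -
    have y1: "y \<le> L" "0 \<le> y'" using y by simp_all
    note Ty = T[OF y(1) y1(1)] and Ty' = T[OF y1(2) y(3)]
    show le: "T y \<le> T y'"
      using AB[of "T y'" "T y"] Ty Ty' y(2) by (cases "T y \<le> T y'") simp_all
    show "T y' - T y \<le> y' - y"
      using AB[of "T y" "T y'"] le Ty Ty' y(2) by (cases "T y = T y'") simp_all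
  qed
  have T_unique: "T y = t" if "0 \<le> y" "y \<le> L" "B t \<le> y" "y \<le> A t" for y t
    using AB[of "T y" t] AB[of t "T y"] T[OF that(1,2)] that by (cases "T y" t rule: linorder_cases) simp_all
  \<comment> \<open>The speed during the halt at \<open>t\<close>; it is 0 where the clock does not halt.\<close>
  define K where "K t = (x t - left_lim x t) / (A t - B t)" for t
  have K: "0 \<le> K t" "K t * (A t - B t) = x t - left_lim x t" if t: "0 \<le> t" "t \<le> 1" for t
  proof -
    show "0 \<le> K t" unfolding K_def using left_lim_le[OF t] BA[of t] by simp
    show "K t * (A t - B t) = x t - left_lim x t"
      using gap[OF t] unfolding K_def by (cases "left_lim x t = x t") simp_all
  qed
  define Z where "Z y = left_lim x (T y) + K (T y) * (y - B (T y))" for y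
  have Z': "Z y = x (T y) - K (T y) * (A (T y) - y)" if "0 \<le> y" "y \<le> L" for y
    using K(2)[OF T(1,2)[OF that]] by (simp add: Z_def algebra_simps)
  have Z_bounds: "left_lim x (T y) \<le> Z y" "Z y \<le> x (T y)" if y: "0 \<le> y" "y \<le> L" for y
  proof -
    show "left_lim x (T y) \<le> Z y" unfolding Z_def using K(1)[OF T(1,2)[OF y]] T(3)[OF y] by simp
    show "Z y \<le> x (T y)" unfolding Z'[OF y] using K(1)[OF T(1,2)[OF y]] T(4)[OF y] by simp
  qed
  have Z_cont: "\<exists>d>0. \<forall>y. 0 \<le> y \<longrightarrow> y \<le> L \<longrightarrow> \<bar>y - y0\<bar> < d \<longrightarrow> \<bar>Z y - Z y0\<bar> < \<epsilon>"
    if y0: "0 \<le> y0" "y0 \<le> L" and e: "\<epsilon> > 0" for y0 \<epsilon>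
  proof -
    define t where "t = T y0"
    note t = T[OF y0, folded t_def]
    \<comment> \<open>Thirds of \<open>\<epsilon>\<close>: one for the change of time, one for the movement within the halt at \<open>t\<close>.\<close>
    obtain d1 where d1: "d1 > 0" "\<And>w. t < w \<Longrightarrow> w < t + d1 \<Longrightarrow> w \<le> 1 \<Longrightarrow> \<bar>x w - x t\<bar> \<le> \<epsilon>/3 \<and> \<bar>left_lim x w - x t\<bar> \<le> \<epsilon>/3"
    proof (cases "t < 1")
      case True
      have "\<epsilon>/3 > 0" using e by simp
      then show ?thesis using close_right[OF t(1) True] that by metis
    next
      case False
      then show ?thesis using that[of 1] by simp
    qed
    obtain d2 where d2: "d2 > 0" "\<And>w. t - d2 < w \<Longrightarrow> w < t \<Longrightarrow> 0 \<le> w \<Longrightarrow> \<bar>x w - left_lim x t\<bar> \<le> \<epsilon>/3 \<and> \<bar>left_lim x w - left_lim x t\<bar> \<le> \<epsilon>/3"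
    proof (cases "0 < t")
      case True
      have "\<epsilon>/3 > 0" using e by simp
      then show ?thesis using close_left[OF True t(2)] that by metis
    next
      case False
      then show ?thesis using that[of 1] by simp
    qed
    define d3 where "d3 = \<epsilon> / (3 * (K t + 1))"
    have K0: "0 \<le> K t" by (rule K(1)[OF t(1,2)])
    have d3: "d3 > 0" unfolding d3_def using e K0 by (intro divide_pos_pos) simp_all
    have small: "K t * r \<le> \<epsilon>/3" if r: "0 \<le> r" "r < d3" for r
    proof -
      have "K t * r \<le> (K t + 1) * d3" by (rule mult_mono) (use r K0 in simp_all)
      also have "\<dots> = \<epsilon>/3" unfolding d3_def using K0 by (simp add: divide_simps)
      finally show ?thesis .
    qed
    define d where "d = min (min d1 d2) d3"
    have d: "d > 0" "d \<le> d1" "d \<le> d2" "d \<le> d3" using d1(1) d2(1) d3 by (simp_all add: d_def)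
    have "\<bar>Z y - Z y0\<bar> < \<epsilon>" if y: "0 \<le> y" "y \<le> L" "\<bar>y - y0\<bar> < d" for y
    proof -
      note Ty = T[OF y(1,2)] and Zy = Z_bounds[OF y(1,2)]
      consider "T y = t" | "t < T y" | "T y < t" by linarith
      then show ?thesis
      proof cases
        case 1
        then have "Z y - Z y0 = K t * (y - y0)" unfolding Z_def t_def[symmetric] by (simp add: algebra_simps)
        then have "\<bar>Z y - Z y0\<bar> = K t * \<bar>y - y0\<bar>" using K0 by (simp add: abs_mult)
        also have "\<dots> \<le> \<epsilon>/3" using y d by (intro small) simp_all
        finally show ?thesis using e by simp
      next
        case 2
        have Ay: "A t < y" using AB[OF 2] Ty 2 by linarith
        then have yy: "y0 \<le> y" using t by simp
        have "T y - t \<le> y - y0" unfolding t_def by (rule T_mono(2)) (use yy y y0 in simp_all)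
        then have "T y < t + d1" using y d by linarith
        then have c: "\<bar>x (T y) - x t\<bar> \<le> \<epsilon>/3" "\<bar>left_lim x (T y) - x t\<bar> \<le> \<epsilon>/3" using d1(2)[OF 2 _ Ty(2)] by blast+
        have "K t * (A t - y0) \<le> \<epsilon>/3" using Ay t y d by (intro small) simp_all
        moreover have "0 \<le> K t * (A t - y0)" using K0 t by simp
        moreover have "Z y0 = x t - K t * (A t - y0)" using Z'[OF y0] by (simp add: t_def)
        ultimately show ?thesis using c Zy e by linarith
      next
        case 3
        have By: "y < B t" using AB[OF 3] Ty 3 by linarith
        then have yy: "y \<le> y0" using t by simp
        have "t - T y \<le> y0 - y" unfolding t_def by (rule T_mono(2)) (use yy y y0 in simp_all)
        then have "t - d2 < T y" using y d by linarith
        then have c: "\<bar>x (T y) - left_lim x t\<bar> \<le> \<epsilon>/3" "\<bar>left_lim x (T y) - left_lim x t\<bar> \<le> \<epsilon>/3"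
          using d2(2)[OF _ 3 Ty(1)] by blast+
        have "K t * (y0 - B t) \<le> \<epsilon>/3" using By t y d by (intro small) simp_all
        moreover have "0 \<le> K t * (y0 - B t)" using K0 t by simp
        moreover have "Z y0 = left_lim x t + K t * (y0 - B t)" by (simp add: Z_def t_def)
        ultimately show ?thesis using c Zy e by linarith
      qed
    qed
    then show ?thesis using d(1) by blast
  qed
  have cont_Z: "continuous_on {0..L} Z"
    unfolding continuous_on_iff
  proof (intro ballI allI impI)
    fix y0 \<epsilon> :: real assume "y0 \<in> {0..L}" "0 < \<epsilon>"
    then obtain d where "d > 0" "\<forall>y. 0 \<le> y \<longrightarrow> y \<le> L \<longrightarrow> \<bar>y - y0\<bar> < d \<longrightarrow> \<bar>Z y - Z y0\<bar> < \<epsilon>"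
      using Z_cont[of y0 \<epsilon>] by auto
    then show "\<exists>d>0. \<forall>y\<in>{0..L}. dist y y0 < d \<longrightarrow> dist (Z y) (Z y0) < \<epsilon>"
      by (intro exI[of _ d]) (simp add: dist_real_def)
  qed
  have "dist (T y) (T y') \<le> dist y y'" if "y \<in> {0..L}" "y' \<in> {0..L}" for y y'
  proof (cases "y \<le> y'")
    case True
    then show ?thesis using T_mono[of y y'] that by (simp add: dist_real_def)
  next
    case False
    then show ?thesis using T_mono[of y' y] that by (simp add: dist_real_def)
  qed
  then have cont_T: "continuous_on {0..L} T"
    unfolding continuous_on_iff by (meson le_less_trans)
  have sc: "continuous_on {0..1} (\<lambda>s. L * s)" "(\<lambda>s. L * s) ` {0..1} \<subseteq> {0..L}"
    using L by (auto intro!: continuous_intros simp: mult_left_le)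
  have scb: "0 \<le> L * s" "L * s \<le> L" if "0 \<le> s" "s \<le> 1" for s using that L by (simp_all add: mult_left_le)
  have "parametric_representation x (\<lambda>s. Z (L * s)) (\<lambda>s. T (L * s))"
    unfolding parametric_representation_def
  proof (intro conjI)
    show "continuous_on {0..1} (\<lambda>s. (Z (L * s), T (L * s)))"
      by (intro continuous_on_Pair continuous_on_compose2[OF cont_Z sc] continuous_on_compose2[OF cont_T sc])
    show "monotone_on {0..1} (\<le>) (graph_le x) (\<lambda>s. (Z (L * s), T (L * s)))"
    proof (rule monotone_onI)
      fix s s' :: real assume s: "s \<in> {0..1}" "s' \<in> {0..1}" "s \<le> s'"
      have y: "0 \<le> L * s" "L * s \<le> L" "0 \<le> L * s'" "L * s' \<le> L" "L * s \<le> L * s'"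
        using scb s L by (simp_all add: mult_left_mono)
      have le: "T (L * s) \<le> T (L * s')" by (rule T_mono) (use y in simp_all)
      show "graph_le x (Z (L * s), T (L * s)) (Z (L * s'), T (L * s'))"
      proof (cases "T (L * s) = T (L * s')")
        case True
        have "K (T (L * s')) * (L * s - B (T (L * s'))) \<le> K (T (L * s')) * (L * s' - B (T (L * s')))"
          by (rule mult_left_mono) (use y K(1) T in simp_all)
        then have "Z (L * s) \<le> Z (L * s')" unfolding Z_def True by simp
        then show ?thesis using True Z_bounds(1)[of "L * s"] y unfolding graph_le_def by simp
      next
        case False
        then show ?thesis using le unfolding graph_le_def by simp
      qed
    qed
    show "(\<lambda>s. (Z (L * s), T (L * s))) ` {0..1} = completed_graph x"
    proof
      show "(\<lambda>s. (Z (L * s), T (L * s))) ` {0..1} \<subseteq> completed_graph x"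
      proof
        fix q assume "q \<in> (\<lambda>s. (Z (L * s), T (L * s))) ` {0..1}"
        then obtain s where s: "0 \<le> s" "s \<le> 1" "q = (Z (L * s), T (L * s))" by auto
        show "q \<in> completed_graph x"
          unfolding s(3) mem_completed_graph_iff using T[OF scb[OF s(1,2)]] Z_bounds[OF scb[OF s(1,2)]] by blast
      qed
      show "completed_graph x \<subseteq> (\<lambda>s. (Z (L * s), T (L * s))) ` {0..1}"
      proof
        fix q assume q: "q \<in> completed_graph x"
        obtain z t where zt: "q = (z, t)" by (cases q)
        have b: "0 \<le> t" "t \<le> 1" "left_lim x t \<le> z" "z \<le> x t"
          using q unfolding zt mem_completed_graph_iff by blast+
        obtain y where y: "B t \<le> y" "y \<le> A t" "left_lim x t + K t * (y - B t) = z"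
        proof (cases "left_lim x t = x t")
          case True
          then show ?thesis using that[of "B t"] BA[of t] b by simp
        next
          case False
          have g: "0 < A t - B t" using gap[OF b(1,2) False] by simp
          have j: "0 < x t - left_lim x t" using False b by simp
          define y where "y = B t + (z - left_lim x t) / K t"
          have Kp: "0 < K t" unfolding K_def using g j by simp
          have "(z - left_lim x t) / K t \<le> (x t - left_lim x t) / K t" using b Kp by (simp add: divide_right_mono)
          also have "\<dots> = A t - B t" unfolding K_def using g j by simp
          finally have "y \<le> A t" by (simp add: y_def)
          moreover have "B t \<le> y" unfolding y_def using b Kp by simp
          moreover have "left_lim x t + K t * (y - B t) = z" unfolding y_def using Kp by simp
          ultimately show ?thesis using that by blast
        qed
        have "0 \<le> B t" using AB[of 0 t] BA[of 0] B0 b by (cases "t = 0") simp_all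
        moreover have "A t \<le> L" using AB[of t 1] BA[of 1] b by (cases "t = 1") (simp_all add: L_def)
        ultimately have y01: "0 \<le> y" "y \<le> L" using y by simp_all
        have Ty: "T y = t" by (rule T_unique[OF y01 y(1,2)])
        have "q = (Z (L * (y / L)), T (L * (y / L)))" unfolding zt using Ty y(3) L by (simp add: Z_def)
        moreover have "y / L \<in> {0..1}" using y01 L by simp
        ultimately show "q \<in> (\<lambda>s. (Z (L * s), T (L * s))) ` {0..1}" by blast
      qed
    qed
  qed
  then show ?thesis by blast
qed

end

section \<open>Paths without negative jumps and the excursion straddling time 1\<close>

locale skip_free_path =
  fixes p :: "real \<Rightarrow> real"
  assumes cadlag: "cadlag_on_halfline p"
    and jump_nonneg: "\<And>t. 0 < t \<Longrightarrow> left_lim p t \<le> p t"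
begin

lemma right_tendsto: "0 \<le> t \<Longrightarrow> (p \<longlongrightarrow> p t) (at_right t)"
  using cadlag unfolding cadlag_on_halfline_def by blast

lemma left_tendsto:
  assumes "0 < t" shows "(p \<longlongrightarrow> left_lim p t) (at_left t)"
proof -
  obtain l where l: "(p \<longlongrightarrow> l) (at_left t)"
    using cadlag assms unfolding cadlag_on_halfline_def by blast
  then have "Lim (at_left t) p = l" by (intro tendsto_Lim) simp_all
  then show ?thesis using l assms by (simp add: left_lim_def)
qed

text \<open>One-sided limits bound the path near each time; compactness then bounds it on intervals.\<close>
lemma locally_bounded_below:
  assumes t: "0 \<le> t"
  shows "\<exists>\<delta>>0. \<exists>C. \<forall>w. 0 \<le> w \<longrightarrow> \<bar>w - t\<bar> < \<delta> \<longrightarrow> C \<le> p w"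
proof -
  have "\<forall>\<^sub>F w in at_right t. p t - 1 < p w"
    by (rule order_tendstoD(1)[OF right_tendsto[OF t]]) simp
  then obtain b where b: "t < b" "\<And>w. t < w \<Longrightarrow> w < b \<Longrightarrow> p t - 1 < p w"
    unfolding eventually_at_right_field by blast
  obtain a where a: "a < t" "\<And>w. a < w \<Longrightarrow> w < t \<Longrightarrow> 0 \<le> w \<Longrightarrow> left_lim p t - 1 < p w"
  proof (cases "t = 0")
    case True
    then show ?thesis using that[of "-1"] by simp
  next
    case False
    then have "0 < t" using t by simp
    have "\<forall>\<^sub>F w in at_left t. left_lim p t - 1 < p w"
      by (rule order_tendstoD(1)[OF left_tendsto[OF \<open>0 < t\<close>]]) simp
    then show ?thesis using that unfolding eventually_at_left_field by blast
  qed
  define C where "C = min (p t - 1) (left_lim p t - 1)"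
  have "C \<le> p w" if w: "0 \<le> w" "\<bar>w - t\<bar> < min (b - t) (t - a)" for w
  proof -
    consider "w < t" | "w = t" | "t < w" by linarith
    then show ?thesis
    proof cases
      case 1
      then have "left_lim p t - 1 < p w" by (intro a(2)) (use w in simp_all)
      then show ?thesis by (simp add: C_def)
    next
      case 2
      then show ?thesis by (simp add: C_def)
    next
      case 3
      then have "p t - 1 < p w" by (intro b(2)) (use w in simp_all)
      then show ?thesis by (simp add: C_def)
    qed
  qed
  moreover have "0 < min (b - t) (t - a)" using a(1) b(1) by simp
  ultimately show ?thesis by blast
qed

lemma bdd_below_on: "bdd_below (p ` {0..T})"
proof (rule ccontr)
  assume n: "\<not> bdd_below (p ` {0..T})"
  have "\<exists>t\<in>{0..T}. p t < - real k" for k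
    using n unfolding bdd_below_def by (force simp: not_le)
  then obtain s where s: "\<And>k. s k \<in> {0..T}" "\<And>k. p (s k) < - real k" by metis
  obtain l r where l: "l \<in> {0..T}" "strict_mono r" "(s \<circ> r) \<longlonglongrightarrow> l"
    using compact_Icc[of 0 T] s(1) unfolding compact_def by blast
  have l0: "0 \<le> l" using l(1) by simp
  obtain \<delta> C where d: "\<delta> > 0" "\<And>w. 0 \<le> w \<Longrightarrow> \<bar>w - l\<bar> < \<delta> \<Longrightarrow> C \<le> p w"
    using locally_bounded_below[OF l0] by blast
  have "\<forall>\<^sub>F k in sequentially. dist ((s \<circ> r) k) l < \<delta>" by (rule tendstoD[OF l(3) d(1)])
  moreover have "\<forall>\<^sub>F k in sequentially. - C < real k"
    using filterlim_real_sequentially unfolding filterlim_at_top_dense by blast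
  ultimately have "\<forall>\<^sub>F k in sequentially. False"
  proof eventually_elim
    case (elim k)
    have "0 \<le> s (r k)" using s(1)[of "r k"] by simp
    then have "C \<le> p (s (r k))" using d(2)[of "s (r k)"] elim by (simp add: dist_real_def)
    moreover have "real k \<le> real (r k)" using seq_suble[OF l(2)] by simp
    ultimately show ?case using s(2)[of "r k"] elim by linarith
  qed
  then show False by simp
qed

definition past_inf :: "real \<Rightarrow> real" where
  "past_inf t = (INF s\<in>{0..t}. p s)"

lemma past_inf_le: "\<lbrakk>0 \<le> s; s \<le> t\<rbrakk> \<Longrightarrow> past_inf t \<le> p s"
  unfolding past_inf_def by (rule cInf_lower[OF _ bdd_below_on]) simp

lemma past_inf_greatest: "\<lbrakk>0 \<le> t; \<And>s. 0 \<le> s \<Longrightarrow> s \<le> t \<Longrightarrow> c \<le> p s\<rbrakk> \<Longrightarrow> c \<le> past_inf t"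
  unfolding past_inf_def by (rule cINF_greatest) auto

lemma above_past_inf_eq: "above_past_inf p t = p t - past_inf t"
  by (simp add: above_past_inf_def past_inf_def)

lemma infimum_from_left_limit:
  assumes "0 \<le> q" "q < a" "a \<le> r" "left_lim p a = k" "\<And>w. q \<le> w \<Longrightarrow> w \<le> r \<Longrightarrow> k \<le> p w"
  shows "(INF w\<in>{q..r}. p w) = k"
proof (rule antisym)
  show "k \<le> (INF w\<in>{q..r}. p w)" by (rule cINF_greatest) (use assms in auto)
  have bdd: "bdd_below (p ` {q..r})" by (rule bdd_belowI2[of _ k]) (use assms in auto)
  have ev: "\<forall>\<^sub>F w in at_left a. (INF w\<in>{q..r}. p w) \<le> p w"
    unfolding eventually_at_left_field using assms
    by (intro exI[of _ q]) (auto intro!: cINF_lower[OF bdd])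
  have "(p \<longlongrightarrow> k) (at_left a)" using left_tendsto[of a] assms by simp
  then show "(INF w\<in>{q..r}. p w) \<le> k" by (rule tendsto_lowerbound[OF _ ev]) simp
qed

text \<open>Let \<open>T\<close> be the infimum of the times at which the path is below \<open>c\<close>.  By right continuity
  \<open>p T \<le> c\<close>, and as the path does not jump down, \<open>p T \<ge> c\<close>.  So the level \<open>c\<close> is hit exactly, at a
  running minimum.\<close>
lemma creeps_downwards:
  assumes a: "0 \<le> a" "a \<le> v" and above: "\<And>s. 0 \<le> s \<Longrightarrow> s \<le> a \<Longrightarrow> c < p s" and v: "p v < c"
  obtains T where "a < T" "T < v" "above_past_inf p T = 0"
proof -
  define S where "S = {u. 0 \<le> u \<and> p u < c}"
  define T where "T = Inf S"
  have vS: "v \<in> S" using a v by (simp add: S_def)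
  have bdd: "bdd_below S" by (rule bdd_belowI[of _ 0]) (simp add: S_def)
  have before: "c \<le> p u" if "0 \<le> u" "u < T" for u
    using cInf_lower[OF _ bdd, of u] that unfolding T_def S_def by force
  have "a \<le> u" if "u \<in> S" for u using above[of u] that unfolding S_def by force
  then have aT: "a \<le> T" unfolding T_def using vS by (intro cInf_greatest) auto
  have Tv: "T \<le> v" unfolding T_def by (rule cInf_lower[OF vS bdd])
  have T0: "0 \<le> T" using aT a by simp
  have "p T \<le> c"
  proof (rule ccontr)
    assume "\<not> p T \<le> c"
    then have "c < p T" by simp
    then have "\<forall>\<^sub>F w in at_right T. c < p w" by (rule order_tendstoD(1)[OF right_tendsto[OF T0]])
    then obtain b where b: "T < b" "\<And>w. T < w \<Longrightarrow> w < b \<Longrightarrow> c < p w"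
      unfolding eventually_at_right_field by blast
    have "b \<le> u" if u: "u \<in> S" for u
    proof -
      have "T \<le> u" unfolding T_def by (rule cInf_lower[OF u bdd])
      then show ?thesis using b(2)[of u] u \<open>c < p T\<close> unfolding S_def by (cases "u = T") force+
    qed
    then have "b \<le> T" unfolding T_def using vS by (intro cInf_greatest) auto
    then show False using b by simp
  qed
  moreover have "c \<le> p T"
  proof (cases "T = 0")
    case True
    then show ?thesis using above[of 0] a by simp
  next
    case False
    then have "0 < T" using T0 by simp
    have "\<forall>\<^sub>F u in at_left T. c \<le> p u"
      unfolding eventually_at_left_field using before \<open>0 < T\<close> by (intro exI[of _ 0]) simp
    then have "c \<le> left_lim p T"
      by (intro tendsto_lowerbound[OF left_tendsto[OF \<open>0 < T\<close>]]) simp_all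
    then show ?thesis using jump_nonneg[OF \<open>0 < T\<close>] by simp
  qed
  ultimately have pT: "p T = c" by simp
  have "c \<le> past_inf T"
  proof (rule past_inf_greatest[OF T0])
    fix s assume "0 \<le> s" "s \<le> T"
    then show "c \<le> p s" using before[of s] pT by (cases "s = T") simp_all
  qed
  moreover have "past_inf T \<le> p T" by (rule past_inf_le) (use T0 in simp_all)
  ultimately have "above_past_inf p T = 0" using pT by (simp add: above_past_inf_eq)
  moreover have "a \<noteq> T" using above[of a] pT a by auto
  moreover have "T \<noteq> v" using pT v by auto
  ultimately show ?thesis using that[of T] aT Tv by simp
qed

end

text \<open>The first two conditions make time 1 interior to an excursion above the past infimum, the third one
  makes this excursion end.\<close>
locale straddling_path = skip_free_path +
  assumes no_jump_at_1: "left_lim p 1 = p 1"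
    and not_minimal_at_1: "\<exists>s. 0 \<le> s \<and> s < 1 \<and> p s < p 1"
    and new_minimum_after_1: "\<exists>s\<ge>1. p s < (INF u\<in>{0..1}. p u)"
begin

abbreviation "g \<equiv> exc_left p"
abbreviation "d \<equiv> exc_right p"

text \<open>Left of time 1 the path stays near \<open>p 1\<close>, above an earlier value, so running minima stay
  away from 1.  After time 1 a new minimum is reached by creeping.  The set of running minima is
  closed from the right because the path is right continuous.\<close>
lemma zeros:
  shows g_nonneg: "0 \<le> g" and g_less: "g < 1" and d_greater: "1 < d"
    and zero_at_d: "above_past_inf p d = 0"
    and no_zero_between: "\<And>u. g < u \<Longrightarrow> u < d \<Longrightarrow> above_past_inf p u \<noteq> 0"
proof -
  define Z where "Z = {t \<in> {0..1}. above_past_inf p t = 0}"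
  define W where "W = {t \<in> {1..}. above_past_inf p t = 0}"
  have gZ: "g = Sup Z" and dW: "d = Inf W" by (simp_all add: exc_left_def exc_right_def Z_def W_def)
  have "above_past_inf p 0 = 0" by (simp add: above_past_inf_def)
  then have Z0: "0 \<in> Z" by (simp add: Z_def)
  have Zb: "bdd_above Z" by (rule bdd_aboveI[of _ 1]) (simp add: Z_def)
  have Wb: "bdd_below W" by (rule bdd_belowI[of _ 1]) (simp add: W_def)
  show g0: "0 \<le> g" unfolding gZ by (rule cSup_upper[OF Z0 Zb])
  have g1: "g \<le> 1" unfolding gZ using Z0 by (intro cSup_least) (blast, simp add: Z_def)
  obtain s where s: "0 \<le> s" "s < 1" "p s < p 1" using not_minimal_at_1 by blast
  \<comment> \<open>Running minima after \<open>s\<close> lie below \<open>p s\<close>.\<close>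
  have low: "p t \<le> p s" if "t \<in> Z" "s \<le> t" for t
    using that past_inf_le[of s t] s by (simp add: Z_def above_past_inf_eq)
  have "\<forall>\<^sub>F t in at_left 1. p s < p t"
    by (rule order_tendstoD(1)[OF left_tendsto]) (use no_jump_at_1 s in simp_all)
  then obtain a where a: "a < 1" "\<And>t. a < t \<Longrightarrow> t < 1 \<Longrightarrow> p s < p t"
    unfolding eventually_at_left_field by blast
  have "t \<le> max a s" if t: "t \<in> Z" for t
  proof (rule ccontr)
    assume "\<not> t \<le> max a s"
    then have "a < t" "s < t" by simp_all
    moreover have "t \<noteq> 1" using low[OF t] s by auto
    ultimately show False using a(2)[of t] low[OF t] t by (simp add: Z_def)
  qed
  then have "g \<le> max a s" unfolding gZ using Z0 by (intro cSup_least) auto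
  then show "g < 1" using a s by simp
  have n1: "above_past_inf p 1 \<noteq> 0"
    using past_inf_le[of s 1] s by (simp add: above_past_inf_eq)
  obtain v where v: "1 \<le> v" "p v < past_inf 1" using new_minimum_after_1 by (auto simp: past_inf_def)
  obtain c where c: "p v < c" "c < past_inf 1" using dense[OF v(2)] by blast
  have "c < p u" if "0 \<le> u" "u \<le> 1" for u using past_inf_le[OF that] c by simp
  then obtain T where "1 < T" "above_past_inf p T = 0"
    using creeps_downwards[of 1 v c] v c by auto
  then have TW: "T \<in> W" by (simp add: W_def)
  have d1: "1 \<le> d" unfolding dW using TW by (intro cInf_greatest) (blast, simp add: W_def)
  show zd: "above_past_inf p d = 0"
  proof (rule ccontr)
    assume n: "above_past_inf p d \<noteq> 0"
    have d0: "0 \<le> d" using d1 by simp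
    have "past_inf d < p d" using n past_inf_le[of d d] d0 by (simp add: above_past_inf_eq)
    then have "\<exists>s\<in>{0..d}. p s < p d"
      unfolding past_inf_def by (subst (asm) cINF_less_iff[OF _ bdd_below_on]) (use d0 in auto)
    then obtain s where s: "0 \<le> s" "s \<le> d" "p s < p d" by auto
    have "\<forall>\<^sub>F w in at_right d. p s < p w" by (rule order_tendstoD(1)[OF right_tendsto[OF d0] s(3)])
    then obtain b where b: "d < b" "\<And>w. d < w \<Longrightarrow> w < b \<Longrightarrow> p s < p w"
      unfolding eventually_at_right_field by blast
    have "b \<le> w" if w: "w \<in> W" for w
    proof (rule ccontr)
      assume "\<not> b \<le> w"
      moreover have dw: "d \<le> w" unfolding dW by (rule cInf_lower[OF w Wb])
      ultimately have "p s < p w" using b(2)[of w] s by (cases "w = d") simp_all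
      moreover have "past_inf w \<le> p s" by (rule past_inf_le) (use s dw in simp_all)
      ultimately show False using w by (simp add: W_def above_past_inf_eq)
    qed
    then have "b \<le> d" unfolding dW using TW by (intro cInf_greatest) auto
    then show False using b by simp
  qed
  then have "d \<noteq> 1" using n1 by auto
  then show "1 < d" using d1 by simp
  show "above_past_inf p u \<noteq> 0" if u: "g < u" "u < d" for u
  proof
    assume z: "above_past_inf p u = 0"
    show False
    proof (cases "u \<le> 1")
      case True
      then have "u \<in> Z" using z u g0 by (simp add: Z_def)
      then have "u \<le> g" unfolding gZ by (rule cSup_upper[OF _ Zb])
      then show False using u by simp
    next
      case False
      then have "u \<in> W" using z by (simp add: W_def)
      then have "d \<le> u" unfolding dW by (rule cInf_lower[OF _ Wb])
      then show False using u by simp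
    qed
  qed
qed

text \<open>A value below the infimum at \<open>g\<close> would be reached by creeping, which produces a running minimum
  strictly inside the excursion.\<close>
lemma past_inf_const:
  assumes v: "g \<le> v" "v \<le> d"
  shows "past_inf v = past_inf g"
proof -
  have above: "past_inf g \<le> p u" if u: "g \<le> u" "u \<le> d" for u
  proof (rule ccontr)
    assume "\<not> past_inf g \<le> p u"
    then have "p u < past_inf g" by simp
    then obtain c where c: "p u < c" "c < past_inf g" using dense by blast
    have "c < p s" if "0 \<le> s" "s \<le> g" for s using past_inf_le[OF that] c by simp
    then obtain T where "g < T" "T < u" "above_past_inf p T = 0"
      using creeps_downwards[OF g_nonneg u(1) _ c(1)] by blast
    then show False using no_zero_between[of T] u by simp
  qed
  have v0: "0 \<le> v" using v g_nonneg by simp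
  have "past_inf g \<le> past_inf v"
  proof (rule past_inf_greatest[OF v0])
    fix s assume s: "0 \<le> s" "s \<le> v"
    show "past_inf g \<le> p s"
      using past_inf_le[of s g] above[of s] s v by (cases "s \<le> g") simp_all
  qed
  moreover have "past_inf v \<le> past_inf g"
    by (rule past_inf_greatest[OF g_nonneg], rule past_inf_le) (use v in simp_all)
  ultimately show ?thesis by simp
qed

context
  fixes \<alpha> :: real
begin

abbreviation "exc \<equiv> normalized_excursion \<alpha> p"
definition "\<zeta> = d - g"
definition "\<kappa> = \<zeta> powr (- 1 / \<alpha>)"

lemma \<zeta>_pos: "0 < \<zeta>" using g_less d_greater by (simp add: \<zeta>_def)

lemma \<kappa>_pos: "0 < \<kappa>" using \<zeta>_pos by (simp add: \<kappa>_def)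

lemma time_range: "\<lbrakk>0 \<le> t; t \<le> 1\<rbrakk> \<Longrightarrow> g \<le> g + \<zeta> * t \<and> g + \<zeta> * t \<le> d"
proof -
  assume t: "0 \<le> t" "t \<le> 1"
  have "0 \<le> \<zeta> * t" "\<zeta> * t \<le> \<zeta>" using \<zeta>_pos t by (simp_all add: mult_left_le)
  moreover have "d = g + \<zeta>" by (simp add: \<zeta>_def)
  ultimately show ?thesis by linarith
qed

lemma time_inverse:
  assumes "g + \<zeta> * a < w" "w < g + \<zeta> * b"
  shows "a < (w - g) / \<zeta>" "(w - g) / \<zeta> < b" "g + \<zeta> * ((w - g) / \<zeta>) = w"
  using assms \<zeta>_pos by (simp_all add: field_simps)

lemma excursion_eq:
  assumes "0 \<le> t" "t \<le> 1"
  shows "exc t = \<kappa> * (p (g + \<zeta> * t) - past_inf g)"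
  using past_inf_const[of "g + \<zeta> * t"] time_range[OF assms]
  by (simp add: normalized_excursion_def Let_def \<kappa>_def \<zeta>_def above_past_inf_eq)

lemma excursion_left_limit:
  assumes t: "0 < t" "t \<le> 1"
  shows "(exc \<longlongrightarrow> \<kappa> * (left_lim p (g + \<zeta> * t) - past_inf g)) (at_left t)"
    and "left_lim exc t = \<kappa> * (left_lim p (g + \<zeta> * t) - past_inf g)"
proof -
  have pos: "0 < g + \<zeta> * t" using g_nonneg \<zeta>_pos t by (simp add: add_nonneg_pos)
  have "filterlim (\<lambda>w. g + \<zeta> * w) (at_left (g + \<zeta> * t)) (at_left t)"
    unfolding filterlim_at
  proof
    show "\<forall>\<^sub>F w in at_left t. g + \<zeta> * w \<in> {..<g + \<zeta> * t} \<and> g + \<zeta> * w \<noteq> g + \<zeta> * t"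
      unfolding eventually_at_left_field using \<zeta>_pos by (intro exI[of _ "t - 1"]) simp
    show "((\<lambda>w. g + \<zeta> * w) \<longlongrightarrow> g + \<zeta> * t) (at_left t)" by (intro tendsto_intros)
  qed
  from filterlim_compose[OF left_tendsto[OF pos] this]
  have "((\<lambda>w. \<kappa> * (p (g + \<zeta> * w) - past_inf g)) \<longlongrightarrow> \<kappa> * (left_lim p (g + \<zeta> * t) - past_inf g)) (at_left t)"
    by (intro tendsto_intros)
  moreover have "\<forall>\<^sub>F w in at_left t. \<kappa> * (p (g + \<zeta> * w) - past_inf g) = exc w"
    unfolding eventually_at_left_field using t by (intro exI[of _ 0]) (simp add: excursion_eq)
  ultimately show lim: "(exc \<longlongrightarrow> \<kappa> * (left_lim p (g + \<zeta> * t) - past_inf g)) (at_left t)"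
    by (rule Lim_transform_eventually)
  then have "Lim (at_left t) exc = \<kappa> * (left_lim p (g + \<zeta> * t) - past_inf g)"
    by (intro tendsto_Lim) simp_all
  then show "left_lim exc t = \<kappa> * (left_lim p (g + \<zeta> * t) - past_inf g)"
    using t by (simp add: left_lim_def)
qed

lemma excursion_path_normalized: "excursion_path exc"
proof
  fix t :: real
  show "(exc \<longlongrightarrow> exc t) (at_right t)" if t: "0 \<le> t" "t < 1"
  proof -
    have pos: "0 \<le> g + \<zeta> * t" using g_nonneg \<zeta>_pos t by simp
    have "filterlim (\<lambda>w. g + \<zeta> * w) (at_right (g + \<zeta> * t)) (at_right t)"
      unfolding filterlim_at
    proof
      show "\<forall>\<^sub>F w in at_right t. g + \<zeta> * w \<in> {g + \<zeta> * t<..} \<and> g + \<zeta> * w \<noteq> g + \<zeta> * t"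
        unfolding eventually_at_right_field using \<zeta>_pos by (intro exI[of _ "t + 1"]) simp
      show "((\<lambda>w. g + \<zeta> * w) \<longlongrightarrow> g + \<zeta> * t) (at_right t)" by (intro tendsto_intros)
    qed
    from filterlim_compose[OF right_tendsto[OF pos] this]
    have "((\<lambda>w. \<kappa> * (p (g + \<zeta> * w) - past_inf g)) \<longlongrightarrow> \<kappa> * (p (g + \<zeta> * t) - past_inf g)) (at_right t)"
      by (intro tendsto_intros)
    moreover have "\<forall>\<^sub>F w in at_right t. \<kappa> * (p (g + \<zeta> * w) - past_inf g) = exc w"
      unfolding eventually_at_right_field using t by (intro exI[of _ 1]) (simp add: excursion_eq)
    ultimately have "(exc \<longlongrightarrow> \<kappa> * (p (g + \<zeta> * t) - past_inf g)) (at_right t)"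
      by (rule Lim_transform_eventually)
    then show ?thesis using excursion_eq[of t] t by simp
  qed
  show "(exc \<longlongrightarrow> left_lim exc t) (at_left t)" if t: "0 < t" "t \<le> 1"
    using excursion_left_limit[OF t] by simp
  show "left_lim exc t \<le> exc t" if t: "0 < t" "t \<le> 1"
  proof -
    have pos: "0 < g + \<zeta> * t" using g_nonneg \<zeta>_pos t by (simp add: add_nonneg_pos)
    show ?thesis
      using excursion_left_limit(2)[OF t] excursion_eq[of t] jump_nonneg[OF pos] \<kappa>_pos t by simp
  qed
  show "0 \<le> exc t" if t: "0 \<le> t" "t \<le> 1"
  proof -
    have "past_inf (g + \<zeta> * t) \<le> p (g + \<zeta> * t)"
      by (rule past_inf_le) (use time_range[OF t] g_nonneg in simp_all)
    then show ?thesis using excursion_eq[OF t] past_inf_const[of "g + \<zeta> * t"] time_range[OF t] \<kappa>_pos by simp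
  qed
  show "0 < exc t" if t: "0 < t" "t < 1"
  proof -
    have r: "g < g + \<zeta> * t" "g + \<zeta> * t < d"
    proof -
      have "0 < \<zeta> * t" "\<zeta> * t < \<zeta>" using \<zeta>_pos t by simp_all
      moreover have "d = g + \<zeta>" by (simp add: \<zeta>_def)
      ultimately show "g < g + \<zeta> * t" "g + \<zeta> * t < d" by linarith+
    qed
    have "past_inf (g + \<zeta> * t) \<le> p (g + \<zeta> * t)"
      by (rule past_inf_le) (use r g_nonneg in simp_all)
    moreover have "p (g + \<zeta> * t) \<noteq> past_inf (g + \<zeta> * t)"
      using no_zero_between[OF r] by (simp add: above_past_inf_eq)
    ultimately show ?thesis using excursion_eq[of t] past_inf_const[of "g + \<zeta> * t"] r t \<kappa>_pos by simp
  qed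
  have "p d = past_inf d" using zero_at_d by (simp add: above_past_inf_eq)
  moreover have "past_inf d = past_inf g" by (rule past_inf_const) (use g_less d_greater in simp_all)
  ultimately show "exc 1 = 0" using excursion_eq[of 1] by (simp add: \<zeta>_def)
qed

lemma dips_at_scaled:
  assumes "dips_at p (g + \<zeta> * u)" "0 < u" "u < 1"
  shows "dips_at exc u"
  unfolding dips_at_def
proof (intro conjI allI impI)
  have dec: "exc w < exc u" if "0 \<le> w" "w \<le> 1" "p (g + \<zeta> * w) < p (g + \<zeta> * u)" for w
    using that excursion_eq[of w] excursion_eq[of u] assms \<kappa>_pos by simp
  fix a assume a: "a < u"
  define a' where "a' = max a 0"
  have a': "a \<le> a'" "0 \<le> a'" "a' < u" using a assms by (simp_all add: a'_def)
  then have "g + \<zeta> * a' < g + \<zeta> * u" using \<zeta>_pos by simp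
  then obtain v where v: "g + \<zeta> * a' < v" "v < g + \<zeta> * u" "p v < p (g + \<zeta> * u)"
    using assms(1) unfolding dips_at_def by force
  note w = time_inverse[OF v(1,2)]
  show "\<exists>w\<in>{a<..<u}. exc w < exc u"
    using dec[of "(v - g) / \<zeta>"] w v(3) a' assms by (intro bexI[of _ "(v - g) / \<zeta>"]) simp_all
next
  have dec: "exc w < exc u" if "0 \<le> w" "w \<le> 1" "p (g + \<zeta> * w) < p (g + \<zeta> * u)" for w
    using that excursion_eq[of w] excursion_eq[of u] assms \<kappa>_pos by simp
  fix b assume b: "u < b"
  define b' where "b' = min b 1"
  have b': "b' \<le> b" "b' \<le> 1" "u < b'" using b assms by (simp_all add: b'_def)
  then have "g + \<zeta> * u < g + \<zeta> * b'" using \<zeta>_pos by simp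
  then obtain v where v: "g + \<zeta> * u < v" "v < g + \<zeta> * b'" "p v < p (g + \<zeta> * u)"
    using assms(1) unfolding dips_at_def by force
  note w = time_inverse[OF v(1,2)]
  show "\<exists>w\<in>{u<..<b}. exc w < exc u"
    using dec[of "(v - g) / \<zeta>"] w v(3) b' assms by (intro bexI[of _ "(v - g) / \<zeta>"]) simp_all
qed

text \<open>An affine change of time preserves null sets.\<close>
lemma AE_dips_scaled:
  assumes "AE t in lborel. 0 < t \<longrightarrow> dips_at p t"
  shows "AE u in lborel. 0 < u \<longrightarrow> u < 1 \<longrightarrow> dips_at exc u"
proof -
  obtain N where N: "{t \<in> space lborel. \<not> (0 < t \<longrightarrow> dips_at p t)} \<subseteq> N" "N \<in> null_sets lborel"
    using AE_E[OF assms] by (metis null_setsI)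
  have "N \<in> sets borel" using N(2) by auto
  then have "Measurable.pred borel (\<lambda>t. t \<notin> N)" by measurable
  moreover have "AE t in lborel. t \<notin> N" using N(2) by (rule AE_not_in)
  ultimately have "AE u in lborel. g + \<zeta> * u \<notin> N"
    using \<zeta>_pos by (intro AE_borel_affine) simp_all
  then show ?thesis
  proof eventually_elim
    case (elim u)
    show ?case
    proof (intro impI)
      assume u: "0 < u" "u < 1"
      have "0 < g + \<zeta> * u" using g_nonneg \<zeta>_pos u by (simp add: add_nonneg_pos)
      then have "dips_at p (g + \<zeta> * u)" using elim N(1) by auto
      then show "dips_at exc u" by (rule dips_at_scaled[OF _ u])
    qed
  qed
qed

text \<open>Around two local minima of the excursion at one level there are disjoint intervals with rational
  end points on which the path has the same infimum.\<close>
lemma distinct_minima_scaled: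
  assumes distinct: "\<And>q1 q2 q3 q4. \<lbrakk>q1 \<in> \<rat>; q2 \<in> \<rat>; q3 \<in> \<rat>; q4 \<in> \<rat>; 0 \<le> q1; q1 < q2; q2 < q3; q3 < q4\<rbrakk>
      \<Longrightarrow> (INF w\<in>{q1..q2}. p w) \<noteq> (INF w\<in>{q3..q4}. p w)"
    and T: "0 \<le> T" "T < A1" "A1 < A2" "A2 < B" "B \<le> 1"
    and h: "\<And>w. T < w \<Longrightarrow> w < B \<Longrightarrow> h \<le> exc w" "left_lim exc A1 = h" "left_lim exc A2 = h"
  shows False
proof -
  define \<theta> where "\<theta> t = g + \<zeta> * t" for t
  have mono: "\<theta> s < \<theta> t" if "s < t" for s t using that \<zeta>_pos by (simp add: \<theta>_def)
  define k where "k = past_inf g + h / \<kappa>"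
  have above: "k \<le> p w" if w: "\<theta> T < w" "w < \<theta> B" for w
  proof -
    note i = time_inverse[OF w[unfolded \<theta>_def]]
    have "h \<le> exc ((w - g) / \<zeta>)" by (rule h(1)[OF i(1,2)])
    also have "\<dots> = \<kappa> * (p w - past_inf g)" using excursion_eq[of "(w - g) / \<zeta>"] i T by simp
    finally have "h / \<kappa> \<le> p w - past_inf g" using \<kappa>_pos by (simp add: pos_divide_le_eq mult.commute)
    then show ?thesis by (simp add: k_def)
  qed
  have ll: "left_lim p (\<theta> A) = k" if "left_lim exc A = h" "0 < A" "A \<le> 1" for A
    using excursion_left_limit(2)[of A] that \<kappa>_pos by (simp add: k_def \<theta>_def)
  obtain q1 where q1: "q1 \<in> \<rat>" "\<theta> T < q1" "q1 < \<theta> A1" using Rats_dense_in_real[OF mono[OF T(2)]] by blast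
  obtain q2 where q2: "q2 \<in> \<rat>" "\<theta> A1 < q2" "q2 < \<theta> A2" using Rats_dense_in_real[OF mono[OF T(3)]] by blast
  obtain q3 where q3: "q3 \<in> \<rat>" "q2 < q3" "q3 < \<theta> A2" using Rats_dense_in_real[OF q2(3)] by blast
  obtain q4 where q4: "q4 \<in> \<rat>" "\<theta> A2 < q4" "q4 < \<theta> B" using Rats_dense_in_real[OF mono[OF T(4)]] by blast
  have "0 \<le> \<theta> T" unfolding \<theta>_def using g_nonneg \<zeta>_pos T by (intro add_nonneg_nonneg mult_nonneg_nonneg) simp_all
  then have pos: "0 \<le> q1" using q1 by simp
  have "(INF w\<in>{q1..q2}. p w) = k"
    by (rule infimum_from_left_limit[OF pos, of "\<theta> A1"]) (use q1 q2 q3 q4 T ll[OF h(2)] above in simp_all)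
  moreover have "(INF w\<in>{q3..q4}. p w) = k"
    by (rule infimum_from_left_limit[of _ "\<theta> A2"]) (use pos q1 q2 q3 q4 T ll[OF h(3)] above in simp_all)
  moreover have "(INF w\<in>{q1..q2}. p w) \<noteq> (INF w\<in>{q3..q4}. p w)"
    by (rule distinct) (use pos q1 q2 q3 q4 in simp_all)
  ultimately show False by simp
qed

end

text \<open>The deterministic half of the argument; what remains is to show that almost every path of the
  process meets the hypotheses.\<close>
theorem coded_tree_properties:
  assumes distinct: "\<And>q1 q2 q3 q4. \<lbrakk>q1 \<in> \<rat>; q2 \<in> \<rat>; q3 \<in> \<rat>; q4 \<in> \<rat>; 0 \<le> q1; q1 < q2; q2 < q3; q3 < q4\<rbrakk>
      \<Longrightarrow> (INF w\<in>{q1..q2}. p w) \<noteq> (INF w\<in>{q3..q4}. p w)"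
    and dips: "AE t in lborel. 0 < t \<longrightarrow> dips_at p t"
  shows "let x = normalized_excursion \<alpha> p in
      (\<exists>\<xi> \<tau>. parametric_representation x \<xi> \<tau>) \<and>
      (\<forall>\<xi> \<tau>. parametric_representation x \<xi> \<tau> \<longrightarrow>
        (\<forall>v \<in> tree_points \<xi>. tree_degree \<xi> v \<in> {1, 2, 3}) \<and>
        tree_top \<xi> closure_of tree_leaves \<xi> = tree_points \<xi> \<and>
        (\<forall>v \<in> tree_points \<xi>. emeasure (tree_measure \<xi> \<tau>) {v} = 0) \<and>
        emeasure (tree_measure \<xi> \<tau>) (tree_leaves \<xi>) = 1)"
  unfolding Let_def
proof (intro conjI allI impI)
  let ?x = "normalized_excursion \<alpha> p"
  interpret excursion_path ?x by (rule excursion_path_normalized)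
  show "\<exists>\<xi> \<tau>. parametric_representation ?x \<xi> \<tau>" by (rule parametric_representation_exists)
  fix \<xi> \<tau> assume "parametric_representation ?x \<xi> \<tau>"
  then interpret parametrized_excursion ?x \<xi> \<tau> by unfold_locales
  note ae = AE_dips_scaled[OF dips, of \<alpha>]
  show "\<forall>v \<in> tree_points \<xi>. tree_degree \<xi> v \<in> {1, 2, 3}"
  proof (intro ballI tree_binary)
    fix T A1 A2 B h
    assume *: "0 \<le> T" "T < A1" "A1 < A2" "A2 < B" "B \<le> 1"
      "\<And>w. T < w \<Longrightarrow> w < B \<Longrightarrow> h \<le> ?x w" "left_lim ?x A1 = h" "left_lim ?x A2 = h"
    show False
    proof (rule distinct_minima_scaled[where T = T and ?A1.0 = A1 and ?A2.0 = A2 and B = B and h = h and \<alpha> = \<alpha>])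
      fix q1 q2 q3 q4 :: real
      assume "q1 \<in> \<rat>" "q2 \<in> \<rat>" "q3 \<in> \<rat>" "q4 \<in> \<rat>" "0 \<le> q1" "q1 < q2" "q2 < q3" "q3 < q4"
      then show "(INF w\<in>{q1..q2}. p w) \<noteq> (INF w\<in>{q3..q4}. p w)" by (rule distinct)
    qed (use * in blast)+
  qed
  show "tree_top \<xi> closure_of tree_leaves \<xi> = tree_points \<xi>" by (rule leaves_dense[OF ae])
  show "\<forall>v \<in> tree_points \<xi>. emeasure (tree_measure \<xi> \<tau>) {v} = 0"
    by (intro ballI tree_measure_no_atom[OF ae])
  show "emeasure (tree_measure \<xi> \<tau>) (tree_leaves \<xi>) = 1" by (rule tree_measure_leaves[OF ae])
qed

end

section \<open>Laws, exceptional sets and concentration\<close>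

lemma (in prob_space) prob_law_cong:
  assumes "U \<in> borel_measurable M" "V \<in> borel_measurable M" "distr M borel U = distr M borel V" "A \<in> sets borel"
  shows "prob {\<omega> \<in> space M. U \<omega> \<in> A} = prob {\<omega> \<in> space M. V \<omega> \<in> A}"
proof -
  have "measure (distr M borel U) A = measure (distr M borel V) A" using assms(3) by simp
  then show ?thesis using assms(1,2,4) by (simp add: measure_distr vimage_def Int_def conj_commute)
qed

text \<open>The exceptional set itself need not be known to be measurable; it only has to be covered by events
  of arbitrarily small probability.\<close>
lemma (in prob_space) AE_if_small_exceptions:
  assumes small: "\<And>\<eta>. \<eta> > 0 \<Longrightarrow> \<exists>E\<in>events. prob E \<le> \<eta> \<and> {\<omega> \<in> space M. \<not> P \<omega>} \<subseteq> E"
  shows "AE \<omega> in M. P \<omega>"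
proof -
  have "\<forall>n. \<exists>E\<in>events. prob E \<le> 1 / real (Suc n) \<and> {\<omega> \<in> space M. \<not> P \<omega>} \<subseteq> E"
    by (intro allI small) simp
  then obtain E where E: "\<And>n. E n \<in> events" "\<And>n. prob (E n) \<le> 1 / real (Suc n)" "\<And>n. {\<omega> \<in> space M. \<not> P \<omega>} \<subseteq> E n"
    by metis
  define N where "N = (\<Inter>n. E n)"
  have N: "N \<in> events" unfolding N_def using E(1) by (intro sets.countable_INT) auto
  have "prob N \<le> 1 / real (Suc n)" for n
    using finite_measure_mono[of N "E n"] E(1,2)[of n] by (force simp: N_def)
  then have "prob N \<le> 0" using nat_approx_posE[of "prob N"] by (metis not_le)
  then have "prob N = 0" by (simp add: measure_le_0_iff)
  then have "N \<in> null_sets M" using N by (simp add: null_sets_def emeasure_eq_measure)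
  moreover have "{\<omega> \<in> space M. \<not> P \<omega>} \<subseteq> N" unfolding N_def using E(3) by blast
  ultimately show ?thesis by (rule AE_I')
qed

lemma (in prob_space) indep_vars_reindex_inj:
  assumes ind: "indep_vars (\<lambda>_. N) Z I" and f: "inj_on f L" "f ` L \<subseteq> I"
  shows "indep_vars (\<lambda>_. N) (\<lambda>j. Z (f j)) L"
proof -
  have "indep_vars (\<lambda>j. PiM {f j} (\<lambda>_. N)) (\<lambda>j \<omega>. restrict (\<lambda>i. Z i \<omega>) {f j}) L"
    using f by (intro indep_vars_restrict[OF ind]) (auto simp: disjoint_family_on_def inj_on_def)
  then have "indep_vars (\<lambda>_. N) (\<lambda>j \<omega>. (\<lambda>g. g (f j)) (restrict (\<lambda>i. Z i \<omega>) {f j})) L"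
    by (rule indep_vars_compose2) (rule measurable_component_singleton, simp)
  then show ?thesis by simp
qed

lemma (in prob_space) indep_var_of_indep_vars:
  assumes ind: "indep_vars (\<lambda>_. N) Z I" and ij: "i \<noteq> j" "i \<in> I" "j \<in> I"
  shows "indep_var N (Z i) N (Z j)"
proof -
  have "indep_var (PiM {i} (\<lambda>_. N)) (\<lambda>\<omega>. restrict (\<lambda>i. Z i \<omega>) {i}) (PiM {j} (\<lambda>_. N)) (\<lambda>\<omega>. restrict (\<lambda>i. Z i \<omega>) {j})"
    by (rule indep_var_restrict[OF ind]) (use ij in auto)
  then have "indep_var N ((\<lambda>g. g i) \<circ> (\<lambda>\<omega>. restrict (\<lambda>i. Z i \<omega>) {i})) N ((\<lambda>g. g j) \<circ> (\<lambda>\<omega>. restrict (\<lambda>i. Z i \<omega>) {j}))"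
    by (rule indep_var_compose) (rule measurable_component_singleton, simp)+
  then show ?thesis by (simp add: comp_def)
qed

lemma (in real_distribution) finite_heavy_atoms:
  assumes e: "\<epsilon> > 0"
  shows "finite {a. \<epsilon> \<le> prob {a}}"
proof (rule ccontr)
  assume inf: "infinite {a. \<epsilon> \<le> prob {a}}"
  obtain n where n: "1 / \<epsilon> < real n" using reals_Archimedean2 by blast
  obtain B where B: "finite B" "card B = n" "B \<subseteq> {a. \<epsilon> \<le> prob {a}}"
    using infinite_arbitrarily_large[OF inf] by blast
  have "\<epsilon> * real n = (\<Sum>a\<in>B. \<epsilon>)" using B by simp
  also have "\<dots> \<le> (\<Sum>a\<in>B. prob {a})" by (rule sum_mono) (use B in blast)
  also have "\<dots> = prob (\<Union>a\<in>B. {a})"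
    by (rule finite_measure_finite_Union[symmetric]) (use B in \<open>auto simp: disjoint_family_on_def\<close>)
  also have "\<dots> \<le> 1" by simp
  finally have "\<epsilon> * real n \<le> 1" .
  then show False using n e by (simp add: pos_divide_less_eq mult.commute)
qed

lemma (in real_distribution) max_atom:
  assumes "prob {b} > 0"
  obtains a where "prob {a} > 0" "\<And>c. prob {c} \<le> prob {a}"
proof -
  let ?F = "{a. prob {b} \<le> prob {a}}"
  have fin: "finite ?F" by (rule finite_heavy_atoms[OF assms])
  have "?F \<noteq> {}" by blast
  then have "Max ((\<lambda>a. prob {a}) ` ?F) \<in> (\<lambda>a. prob {a}) ` ?F" using fin by (intro Max_in) simp_all
  then obtain a where a: "a \<in> ?F" "Max ((\<lambda>a. prob {a}) ` ?F) = prob {a}" by blast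
  have "prob {c} \<le> prob {a}" for c
  proof (cases "c \<in> ?F")
    case True
    then show ?thesis unfolding a(2)[symmetric] using fin by (intro Max_ge) simp_all
  next
    case False
    then have "prob {c} < prob {b}" by simp
    also have "prob {b} \<le> prob {a}" using a(1) by simp
    finally show ?thesis by simp
  qed
  moreover have "prob {a} > 0" using a(1) assms by simp
  ultimately show ?thesis using that by blast
qed

text \<open>Otherwise there are intervals of vanishing length and mass at least \<open>\<eta>\<close>.  Their centres stay in
  a compact set because the law is tight, and any limit of the centres is an atom.\<close>
lemma (in real_distribution) concentration_small:
  assumes no_atom: "\<And>a. prob {a} = 0" and \<eta>: "\<eta> > 0"
  shows "\<exists>\<delta>>0. \<forall>s. prob {s-\<delta>..s+\<delta>} \<le> \<eta>"
proof (rule ccontr)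
  assume n: "\<not> ?thesis"
  have "\<exists>s. \<eta> < prob {s - 1 / real (Suc k)..s + 1 / real (Suc k)}" for k
    using n by (metis (no_types, lifting) not_le of_nat_0_less_iff zero_less_Suc zero_less_divide_1_iff)
  then obtain s where s: "\<And>k. \<eta> < prob {s k - 1 / real (Suc k)..s k + 1 / real (Suc k)}" by metis
  have "(\<lambda>n. prob {-real n..real n}) \<longlonglongrightarrow> prob (\<Union>n. {-real n..real n})"
    by (rule finite_Lim_measure_incseq) (auto simp: incseq_def)
  moreover have "(\<Union>n. {-real n..real n}) = (UNIV :: real set)"
  proof -
    have "\<exists>n. x \<in> {-real n..real n}" for x :: real
    proof -
      obtain n where "\<bar>x\<bar> \<le> real n" using real_arch_simple by blast
      then have "x \<in> {-real n..real n}" by (simp add: abs_le_iff)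
      then show ?thesis by blast
    qed
    then show ?thesis by blast
  qed
  ultimately have "(\<lambda>n. prob {-real n..real n}) \<longlonglongrightarrow> 1" using prob_space by simp
  then have "\<forall>\<^sub>F n in sequentially. 1 - \<eta> < prob {-real n..real n}"
    by (rule order_tendstoD(1)) (use \<eta> in simp)
  then obtain R where R: "1 - \<eta> < prob {-real R..real R}" by (meson eventually_sequentially order_refl)
  have bd: "s k \<in> {-(real R + 1)..real R + 1}" for k
  proof (rule ccontr)
    assume o: "s k \<notin> {-(real R + 1)..real R + 1}"
    define d where "d = 1 / real (Suc k)"
    have "d \<le> 1" by (simp add: d_def)
    moreover have "s k + 1 < - real R \<or> real R < s k - 1" using o by auto
    ultimately have "{s k - d..s k + d} \<inter> {-real R..real R} = {}" by auto
    then have "{s k - 1 / real (Suc k)..s k + 1 / real (Suc k)} \<inter> {-real R..real R} = {}" unfolding d_def .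
    then have "prob {s k - 1 / real (Suc k)..s k + 1 / real (Suc k)} + prob {-real R..real R}
        = prob ({s k - 1 / real (Suc k)..s k + 1 / real (Suc k)} \<union> {-real R..real R})"
      by (intro finite_measure_Union[symmetric]) simp_all
    also have "\<dots> \<le> 1" by simp
    finally show False using s[of k] R by linarith
  qed
  obtain l r where l: "strict_mono r" "(s \<circ> r) \<longlonglongrightarrow> l"
    using compact_Icc[of "-(real R + 1)" "real R + 1"] bd unfolding compact_def by blast
  have big: "\<eta> \<le> prob {l - \<epsilon>..l + \<epsilon>}" if e: "\<epsilon> > 0" for \<epsilon>
  proof -
    have e2: "\<epsilon> / 2 > 0" using e by simp
    have "\<forall>\<^sub>F k in sequentially. dist ((s \<circ> r) k) l < \<epsilon> / 2" by (rule tendstoD[OF l(2) e2])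
    moreover have "\<forall>\<^sub>F k in sequentially. 1 / real (Suc k) < \<epsilon> / 2"
      by (rule order_tendstoD(2)[OF LIMSEQ_Suc[OF lim_1_over_n] e2])
    ultimately have "\<forall>\<^sub>F k in sequentially. \<eta> \<le> prob {l - \<epsilon>..l + \<epsilon>}"
    proof eventually_elim
      case (elim k)
      have "k \<le> r k" by (rule seq_suble[OF l(1)])
      then have "1 / real (Suc (r k)) \<le> 1 / real (Suc k)" by (intro divide_left_mono) simp_all
      then have "1 / real (Suc (r k)) < \<epsilon> / 2" using elim by linarith
      moreover have "\<bar>s (r k) - l\<bar> < \<epsilon> / 2" using elim by (simp add: dist_real_def)
      ultimately have "l - \<epsilon> \<le> s (r k) - 1 / real (Suc (r k))" "s (r k) + 1 / real (Suc (r k)) \<le> l + \<epsilon>"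
        by argo+
      then have "{s (r k) - 1 / real (Suc (r k))..s (r k) + 1 / real (Suc (r k))} \<subseteq> {l - \<epsilon>..l + \<epsilon>}"
        by (rule atLeastatMost_subset_iff[THEN iffD2, OF disjI2, OF conjI])
      then have "prob {s (r k) - 1 / real (Suc (r k))..s (r k) + 1 / real (Suc (r k))} \<le> prob {l - \<epsilon>..l + \<epsilon>}"
        by (intro finite_measure_mono) simp_all
      then show ?case using s[of "r k"] by linarith
    qed
    then show ?thesis by simp
  qed
  have "(\<lambda>n. prob {l - 1 / real (Suc n)..l + 1 / real (Suc n)}) \<longlonglongrightarrow> prob (\<Inter>n. {l - 1 / real (Suc n)..l + 1 / real (Suc n)})"
  proof (rule finite_Lim_measure_decseq)
    show "decseq (\<lambda>n. {l - 1 / real (Suc n)..l + 1 / real (Suc n)})"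
    proof (rule decseq_SucI)
      fix n
      have "1 / real (Suc (Suc n)) \<le> 1 / real (Suc n)" by (intro divide_left_mono) simp_all
      then show "{l - 1 / real (Suc (Suc n))..l + 1 / real (Suc (Suc n))} \<subseteq> {l - 1 / real (Suc n)..l + 1 / real (Suc n)}"
        by (auto simp del: of_nat_Suc)
    qed
  qed auto
  moreover have "(\<Inter>n. {l - 1 / real (Suc n)..l + 1 / real (Suc n)}) = {l}"
  proof -
    have "x = l" if "\<And>n. x \<in> {l - 1 / real (Suc n)..l + 1 / real (Suc n)}" for x
    proof (rule ccontr)
      assume "x \<noteq> l"
      then obtain n where "1 / real (Suc n) < \<bar>x - l\<bar>" using nat_approx_posE[of "\<bar>x - l\<bar>"] by auto
      then show False using that[of n] by (auto simp del: of_nat_Suc)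
    qed
    then show ?thesis by (auto simp del: of_nat_Suc)
  qed
  ultimately have "\<eta> \<le> prob {l}"
    by (intro tendsto_lowerbound[where F = sequentially]) (auto intro!: always_eventually big simp del: of_nat_Suc)
  then show False using no_atom[of l] \<eta> by simp
qed

section \<open>One-dimensional laws of the stable process\<close>

locale stable_levy = 
  fixes M :: "'a measure" and X :: "real \<Rightarrow> 'a \<Rightarrow> real" and \<alpha> :: real
  assumes alpha: "1 < \<alpha>" and stable: "spectrally_positive_stable_levy M \<alpha> X"
begin

lemma levy: "levy_process M X"
  using stable by (simp add: spectrally_positive_stable_levy_def)

sublocale prob_space M
  using levy by (simp add: levy_process_def)

lemma meas [measurable]: "0 \<le> t \<Longrightarrow> X t \<in> borel_measurable M"
  using levy by (simp add: levy_process_def)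

lemma start: "AE \<omega> in M. X 0 \<omega> = 0"
  using levy by (simp add: levy_process_def)

lemma increments_indep:
  "\<lbrakk>0 \<le> t 0; \<And>i. i < n \<Longrightarrow> t i \<le> t (Suc i)\<rbrakk> \<Longrightarrow>
     indep_vars (\<lambda>_. borel) (\<lambda>i \<omega>. X (t (Suc i)) \<omega> - X (t i) \<omega>) {..<n}"
  using levy unfolding levy_process_def by blast

lemma increment_law:
  assumes "0 \<le> s" "s \<le> t"
  shows "distr M borel (\<lambda>\<omega>. X t \<omega> - X s \<omega>) = distr M borel (X (t - s))"
proof -
  have "\<forall>s\<ge>0. \<forall>h\<ge>0. distr M borel (\<lambda>\<omega>. X (s + h) \<omega> - X s \<omega>) = distr M borel (X h)"
    using levy by (simp add: levy_process_def)
  then have "distr M borel (\<lambda>\<omega>. X (s + (t - s)) \<omega> - X s \<omega>) = distr M borel (X (t - s))"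
    using assms by (metis diff_ge_0_iff_ge)
  then show ?thesis by simp
qed

lemma scaling:
  assumes c: "0 < c"
  shows "distr M borel (X c) = distr M borel (\<lambda>\<omega>. c powr (1 / \<alpha>) * X 1 \<omega>)"
proof -
  let ?P = "\<Pi>\<^sub>M t\<in>{0::real..}. (borel :: real measure)"
  let ?F = "\<lambda>\<omega>. \<lambda>t\<in>{0..}. X (c * t) \<omega>" and ?G = "\<lambda>\<omega>. \<lambda>t\<in>{0..}. c powr (1 / \<alpha>) * X t \<omega>"
  have eq: "distr M ?P ?F = distr M ?P ?G"
    using stable c by (simp add: spectrally_positive_stable_levy_def stable_scaling_def)
  have F: "?F \<in> measurable M ?P" using c by (intro measurable_restrict meas) simp
  have G: "?G \<in> measurable M ?P" by (intro measurable_restrict borel_measurable_times meas) simp_all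
  have p: "(\<lambda>f. f 1) \<in> measurable ?P borel" by (rule measurable_component_singleton) simp
  have "distr (distr M ?P ?F) borel (\<lambda>f. f 1) = distr (distr M ?P ?G) borel (\<lambda>f. f 1)" using eq by simp
  then show ?thesis by (simp add: distr_distr[OF p F] distr_distr[OF p G] comp_def)
qed

lemma prob_scaling:
  assumes "0 < c" "A \<in> sets borel"
  shows "prob {\<omega> \<in> space M. X c \<omega> \<in> A} = prob {\<omega> \<in> space M. c powr (1/\<alpha>) * X 1 \<omega> \<in> A}"
  by (rule prob_law_cong) (use assms scaling[OF assms(1)] in simp_all)

lemma laplace:
  assumes "0 < q"
  shows "integrable M (\<lambda>\<omega>. exp (- q * X 1 \<omega>))" "expectation (\<lambda>\<omega>. exp (- q * X 1 \<omega>)) = exp (q powr \<alpha>)"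
proof -
  have "\<forall>t>0. \<forall>q>0. integrable M (\<lambda>\<omega>. exp (- q * X t \<omega>)) \<and>
        (\<integral>\<omega>. exp (- q * X t \<omega>) \<partial>M) = exp (t * q powr \<alpha>)"
    using stable by (simp add: spectrally_positive_stable_levy_def)
  from this[rule_format, of 1 q] assms
  show "integrable M (\<lambda>\<omega>. exp (- q * X 1 \<omega>))" "expectation (\<lambda>\<omega>. exp (- q * X 1 \<omega>)) = exp (q powr \<alpha>)" by simp_all
qed

text \<open>If \<open>X 1 \<ge> -b\<close>, the Laplace transform at \<open>q\<close> is at most \<open>exp (q b)\<close>, which is smaller than
  \<open>exp (q powr \<alpha>)\<close> for large \<open>q\<close>.\<close>
lemma unbounded_below: "0 < prob {\<omega> \<in> space M. X 1 \<omega> < - b}"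
proof (rule ccontr)
  assume "\<not> 0 < prob {\<omega> \<in> space M. X 1 \<omega> < - b}"
  then have "prob {\<omega> \<in> space M. X 1 \<omega> < - b} = 0" by (simp only: zero_less_measure_iff not_not)
  then have ae: "AE \<omega> in M. - b \<le> X 1 \<omega>"
    by (subst (asm) prob_eq_0) (simp_all add: not_less)
  define c where "c = \<bar>b\<bar> + 1"
  \<comment> \<open>Chosen such that \<open>q powr \<alpha> = c * q\<close>.\<close>
  define q where "q = c powr (1 / (\<alpha> - 1))"
  have q: "0 < q" by (simp add: q_def c_def)
  have "q powr (\<alpha> - 1) = c" using alpha by (simp add: q_def c_def powr_powr)
  moreover have "q powr \<alpha> = q powr (\<alpha> - 1) * q powr 1" unfolding powr_add[symmetric] by simp
  ultimately have qa: "q powr \<alpha> = c * q" using q by simp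
  have "exp (q powr \<alpha>) = expectation (\<lambda>\<omega>. exp (- q * X 1 \<omega>))" by (rule laplace(2)[OF q, symmetric])
  also have "\<dots> \<le> expectation (\<lambda>\<omega>. exp (q * b))"
  proof (rule integral_mono_AE)
    show "integrable M (\<lambda>\<omega>. exp (- q * X 1 \<omega>))" by (rule laplace(1)[OF q])
    show "AE \<omega> in M. exp (- q * X 1 \<omega>) \<le> exp (q * b)"
      using ae
    proof eventually_elim
      case (elim \<omega>)
      then have "q * (- b) \<le> q * X 1 \<omega>" using q by (intro mult_left_mono) simp_all
      then show ?case by simp
    qed
  qed simp
  also have "\<dots> = exp (q * b)" using prob_space by simp
  finally have "c * q \<le> b * q" using qa by (simp add: mult.commute)
  then have "c \<le> b" using q by simp
  then show False by (simp add: c_def)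
qed

text \<open>If \<open>X 1 \<le> 0\<close>, then \<open>exp (- q * X 1) \<ge> 1 + q\<close> on the event \<open>X 1 < -1\<close>, so the Laplace transform
  is at least \<open>1 + q * c\<close> with \<open>c\<close> the probability of that event.  But it is \<open>1 + O(q powr \<alpha>)\<close>
  as \<open>q\<close> tends to 0, and \<open>\<alpha> > 1\<close>.\<close>
lemma positive_part: "\<exists>\<delta>>0. 0 < prob {\<omega> \<in> space M. \<delta> < X 1 \<omega>}"
proof (rule ccontr)
  assume n: "\<not> ?thesis"
  have "AE \<omega> in M. X 1 \<omega> \<le> 1 / real (Suc k)" for k
  proof -
    have "\<not> 0 < prob {\<omega> \<in> space M. 1 / real (Suc k) < X 1 \<omega>}"
      using n by (metis of_nat_0_less_iff zero_less_Suc zero_less_divide_1_iff)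
    then have "prob {\<omega> \<in> space M. 1 / real (Suc k) < X 1 \<omega>} = 0" by (simp only: zero_less_measure_iff not_not)
    then show ?thesis by (subst (asm) prob_eq_0) (simp_all add: not_less)
  qed
  then have "AE \<omega> in M. \<forall>k. X 1 \<omega> \<le> 1 / real (Suc k)" by (simp add: AE_all_countable)
  then have ae: "AE \<omega> in M. X 1 \<omega> \<le> 0"
  proof eventually_elim
    case (elim \<omega>)
    show ?case
    proof (rule ccontr)
      assume "\<not> X 1 \<omega> \<le> 0"
      then obtain k where "1 / real (Suc k) < X 1 \<omega>" using nat_approx_posE[of "X 1 \<omega>"] by auto
      then show False using elim by (metis not_le)
    qed
  qed
  define c where "c = prob {\<omega> \<in> space M. X 1 \<omega> < - 1}"
  have c: "0 < c" unfolding c_def by (rule unbounded_below)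
  \<comment> \<open>Small enough for \<open>2 * q powr \<alpha> < q * c\<close>.\<close>
  define q where "q = min 1 ((c / 4) powr (1 / (\<alpha> - 1)))"
  have q: "0 < q" "q \<le> 1" using c by (simp_all add: q_def)
  have "q powr (\<alpha> - 1) \<le> ((c / 4) powr (1 / (\<alpha> - 1))) powr (\<alpha> - 1)"
    by (rule powr_mono2) (use q alpha in \<open>simp_all add: q_def\<close>)
  also have "\<dots> = c / 4" using c alpha by (simp add: powr_powr)
  finally have qs: "q powr (\<alpha> - 1) \<le> c / 4" .
  have "q powr \<alpha> = q powr (\<alpha> - 1) * q powr 1" unfolding powr_add[symmetric] by simp
  then have qa: "q powr \<alpha> = q powr (\<alpha> - 1) * q" using q by simp
  have "q powr (\<alpha> - 1) \<le> 1 powr (\<alpha> - 1)" by (rule powr_mono2) (use q alpha in simp_all)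
  then have "q powr (\<alpha> - 1) * q \<le> 1 * 1" by (intro mult_mono) (use q in simp_all)
  then have qa1: "q powr \<alpha> \<le> 1" using qa by simp
  define A where "A = {\<omega> \<in> space M. X 1 \<omega> < - 1}"
  have A: "A \<in> events" unfolding A_def by measurable
  have iA: "integrable M (\<lambda>\<omega>. q * indicator A \<omega>)" using A by (intro integrable_mult_right integrable_real_indicator) (simp_all add: less_top[symmetric])
  have "1 + q * c = expectation (\<lambda>\<omega>. 1 + q * indicator A \<omega>)"
    using A iA prob_space by (subst Bochner_Integration.integral_add) (simp_all add: c_def A_def[symmetric])
  also have "\<dots> \<le> expectation (\<lambda>\<omega>. exp (- q * X 1 \<omega>))"
  proof (rule integral_mono_AE)
    show "integrable M (\<lambda>\<omega>. 1 + q * indicator A \<omega>)" using iA by simp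
    show "integrable M (\<lambda>\<omega>. exp (- q * X 1 \<omega>))" by (rule laplace(1)[OF q(1)])
    show "AE \<omega> in M. 1 + q * indicator A \<omega> \<le> exp (- q * X 1 \<omega>)"
      using ae
    proof eventually_elim
      case (elim \<omega>)
      have "1 + q * indicator A \<omega> \<le> 1 + (- q * X 1 \<omega>)"
        using elim q mult_left_mono[of 1 "- X 1 \<omega>" q] mult_left_mono[of 0 "- X 1 \<omega>" q] by (auto simp: indicator_def A_def)
      also have "\<dots> \<le> exp (- q * X 1 \<omega>)" by (rule exp_ge_add_one_self)
      finally show ?case .
    qed
  qed
  also have "\<dots> = exp (q powr \<alpha>)" by (rule laplace(2)[OF q(1)])
  also have "\<dots> \<le> 1 + q powr \<alpha> + (q powr \<alpha>)\<^sup>2" by (rule exp_bound) (use qa1 in simp_all)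
  also have "(q powr \<alpha>)\<^sup>2 \<le> q powr \<alpha>"
    using mult_left_mono[OF qa1, of "q powr \<alpha>"] by (simp add: power2_eq_square)
  finally have "q * c \<le> 2 * (q powr (\<alpha> - 1) * q)" using qa by (simp add: mult.commute)
  also have "\<dots> \<le> 2 * (c / 4 * q)" using qs q by (intro mult_left_mono mult_right_mono) simp_all
  finally show False using q c by simp
qed

lemma tight:
  assumes "\<eta> > 0" obtains R where "R > 0" "prob {\<omega> \<in> space M. R < \<bar>X 1 \<omega>\<bar>} \<le> \<eta>"
proof -
  have "(\<lambda>n. prob {\<omega> \<in> space M. real n < \<bar>X 1 \<omega>\<bar>}) \<longlonglongrightarrow> prob (\<Inter>n. {\<omega> \<in> space M. real n < \<bar>X 1 \<omega>\<bar>})"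
    by (rule finite_Lim_measure_decseq) (auto simp: decseq_def)
  moreover have "(\<Inter>n. {\<omega> \<in> space M. real n < \<bar>X 1 \<omega>\<bar>}) = {}"
  proof -
    have "\<exists>n. \<not> real n < \<bar>X 1 \<omega>\<bar>" for \<omega>
      using real_arch_simple[of "\<bar>X 1 \<omega>\<bar>"] by (auto simp: not_less)
    then show ?thesis by blast
  qed
  ultimately have "(\<lambda>n. prob {\<omega> \<in> space M. real n < \<bar>X 1 \<omega>\<bar>}) \<longlonglongrightarrow> 0" by simp
  then have "\<forall>\<^sub>F n in sequentially. prob {\<omega> \<in> space M. real n < \<bar>X 1 \<omega>\<bar>} < \<eta>"
    by (rule order_tendstoD(2)) (rule assms)
  then obtain n0 where n0: "\<And>n. n \<ge> n0 \<Longrightarrow> prob {\<omega> \<in> space M. real n < \<bar>X 1 \<omega>\<bar>} < \<eta>"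
    unfolding eventually_sequentially by blast
  have "prob {\<omega> \<in> space M. real (Suc n0) < \<bar>X 1 \<omega>\<bar>} < \<eta>" by (rule n0) simp
  then show ?thesis using that[of "real (Suc n0)"] by simp
qed

text \<open>Write \<open>X 1\<close> as a sum of two independent increments over half the time.  By scaling, their law
  has atoms of the same sizes as the law of \<open>X 1\<close>.  A largest atom, of mass \<open>m\<close> at \<open>a0\<close>,
  satisfies \<open>m = E (P {a0 - Y})\<close> with an integrand bounded by \<open>m\<close>.  Hence \<open>a0 - Y\<close>
  is almost surely one of the finitely many atoms of mass \<open>m\<close>, and \<open>Y\<close> is bounded, against
  \<open>unbounded_below\<close>.\<close>
lemma no_atom_1: "prob {\<omega> \<in> space M. X 1 \<omega> = a} = 0"
proof (rule ccontr)
  assume pos: "prob {\<omega> \<in> space M. X 1 \<omega> = a} \<noteq> 0"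
  define D where "D = distr M borel (X 1)"
  define Y where "Y \<omega> = X (1/2) \<omega> - X 0 \<omega>" for \<omega>
  define Y' where "Y' \<omega> = X 1 \<omega> - X (1/2) \<omega>" for \<omega>
  have [measurable]: "Y \<in> borel_measurable M" "Y' \<in> borel_measurable M"
    unfolding Y_def Y'_def by simp_all
  define D2 where "D2 = distr M borel (X (1/2))"
  interpret D: real_distribution D unfolding D_def by simp
  interpret D2: real_distribution D2 unfolding D2_def by simp
  have DY: "distr M borel Y = D2" "distr M borel Y' = D2"
    unfolding Y_def Y'_def D2_def using increment_law[of 0 "1/2"] increment_law[of "1/2" 1] by simp_all
  define \<kappa> where "\<kappa> = (1/2::real) powr (1/\<alpha>)"
  have \<kappa>: "0 < \<kappa>" by (simp add: \<kappa>_def)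
  have atoms: "measure D2 {b} = measure D {b / \<kappa>}" for b
  proof -
    have "measure D2 {b} = prob {\<omega> \<in> space M. X (1/2) \<omega> \<in> {b}}"
      by (simp add: D2_def measure_distr vimage_def Int_def conj_commute)
    also have "\<dots> = prob {\<omega> \<in> space M. \<kappa> * X 1 \<omega> \<in> {b}}"
      unfolding \<kappa>_def by (rule prob_scaling) simp_all
    also have "\<dots> = prob {\<omega> \<in> space M. X 1 \<omega> = b / \<kappa>}" using \<kappa> by (simp add: field_simps)
    also have "\<dots> = measure D {b / \<kappa>}"
      by (simp add: D_def measure_distr vimage_def Int_def conj_commute)
    finally show ?thesis .
  qed
  have "measure D {a} > 0" using pos
    by (simp add: D_def measure_distr vimage_def Int_def conj_commute zero_less_measure_iff)
  then obtain a0 where a0: "measure D {a0} > 0" "\<And>c. measure D {c} \<le> measure D {a0}" by (rule D.max_atom) blast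
  define m where "m = measure D {a0}"
  define F where "F = {y. measure D2 {a0 - y} = m}"
  have D2_le: "measure D2 {b} \<le> m" for b unfolding atoms m_def by (rule a0)
  have m0: "m > 0" using a0 by (simp add: m_def)
  define H where "H = {b. m / 2 \<le> measure D2 {b}}"
  have finH: "finite H" unfolding H_def by (rule D2.finite_heavy_atoms) (use m0 in simp)
  have "F \<subseteq> (\<lambda>b. a0 - b) ` H"
  proof
    fix y assume "y \<in> F"
    then have "a0 - y \<in> H" using m0 by (simp add: F_def H_def)
    then show "y \<in> (\<lambda>b. a0 - b) ` H" by (intro image_eqI[of _ _ "a0 - y"]) simp_all
  qed
  then have finF: "finite F" using finH finite_surj by blast
  \<comment> \<open>Off \<open>F\<close> the masses are bounded by the second largest one, or by \<open>m / 2\<close>.\<close>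
  obtain m' where m': "m' < m" "0 \<le> m'" "\<And>y. y \<notin> F \<Longrightarrow> measure D2 {a0 - y} \<le> m'"
  proof -
    define S where "S = insert (m / 2) ((\<lambda>b. measure D2 {b}) ` {b \<in> H. measure D2 {b} \<noteq> m})"
    have finS: "finite S" using finH by (simp add: S_def)
    have S: "Max S \<in> S" by (rule Max_in[OF finS]) (simp add: S_def)
    have "Max S < m"
    proof -
      have "x < m" if "x \<in> S" for x
      proof -
        from that consider "x = m / 2" | b where "x = measure D2 {b}" "measure D2 {b} \<noteq> m" unfolding S_def by blast
        then show ?thesis
        proof cases
          case 1 then show ?thesis using m0 by simp
        next
          case 2 then show ?thesis using D2_le[of b] by simp
        qed
      qed
      then show ?thesis using S by blast
    qed
    moreover have half: "m / 2 \<le> Max S" by (rule Max_ge[OF finS]) (simp add: S_def)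
    moreover have "measure D2 {a0 - y} \<le> Max S" if "y \<notin> F" for y
    proof (cases "a0 - y \<in> H")
      case True
      then show ?thesis using that by (intro Max_ge[OF finS]) (auto simp: S_def F_def)
    next
      case False
      then show ?thesis using half by (simp add: H_def)
    qed
    ultimately show ?thesis using that[of "Max S"] m0 by simp
  qed
  have indep: "indep_var borel Y borel Y'"
  proof -
    define t where "t i = real i / 2" for i :: nat
    have "indep_vars (\<lambda>_. borel) (\<lambda>i \<omega>. X (t (Suc i)) \<omega> - X (t i) \<omega>) {..<2}"
      by (rule increments_indep) (simp_all add: t_def divide_right_mono)
    from indep_var_of_indep_vars[OF this, of 0 1]
    show ?thesis by (simp add: t_def Y_def[abs_def] Y'_def[abs_def])
  qed
  have "D = distr M borel (\<lambda>\<omega>. Y \<omega> + Y' \<omega>)"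
    unfolding D_def Y_def Y'_def using increment_law[of 0 1] by simp
  also have "\<dots> = convolution D2 D2"
    using sum_indep_random_variable[OF indep] by (simp add: DY)
  finally have conv: "D = convolution D2 D2" .
  have F: "F \<in> sets D2" using finF by (simp add: D2.events_eq_borel finite_imp_closed borel_closed)
  have iF: "integrable D2 (\<lambda>y. (m - m') * indicator F y)"
    using F by (intro integrable_mult_right integrable_real_indicator) (simp_all add: less_top[symmetric])
  have "ennreal m = emeasure D {a0}" by (simp add: m_def D.emeasure_eq_measure)
  also have "\<dots> = (\<integral>\<^sup>+y. emeasure D2 {b. b + y \<in> {a0}} \<partial>D2)"
    unfolding conv by (rule convolution_emeasure) (simp_all add: D2.finite_measure_axioms)
  also have "\<dots> = (\<integral>\<^sup>+y. ennreal (measure D2 {a0 - y}) \<partial>D2)"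
  proof (rule nn_integral_cong)
    fix y
    have "{b. b + y \<in> {a0}} = {a0 - y}" by auto
    then show "emeasure D2 {b. b + y \<in> {a0}} = ennreal (measure D2 {a0 - y})"
      by (simp add: D2.emeasure_eq_measure)
  qed
  also have "\<dots> \<le> (\<integral>\<^sup>+y. ennreal (m' + (m - m') * indicator F y) \<partial>D2)"
    using D2_le m' by (intro nn_integral_mono ennreal_leI) (simp add: indicator_def)
  also have "\<dots> = ennreal (\<integral>y. m' + (m - m') * indicator F y \<partial>D2)"
    by (rule nn_integral_eq_integral) (use m' iF in simp_all)
  also have "(\<integral>y. m' + (m - m') * indicator F y \<partial>D2) = m' + (m - m') * measure D2 F"
    using F iF D2.prob_space by (subst Bochner_Integration.integral_add) simp_all
  finally have "m \<le> m' + (m - m') * measure D2 F"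
    using m0 m' by (subst (asm) ennreal_le_iff) simp_all
  then have "(m - m') * 1 \<le> (m - m') * measure D2 F" by simp
  then have "1 \<le> measure D2 F" using m' by simp
  then have F1: "measure D2 F = 1" using D2.prob_le_1[of F] by simp
  define b where "b = - Min F"
  have low: "- b \<le> y" if "y \<in> F" for y unfolding b_def minus_minus by (rule Min_le[OF finF that])
  have "0 < prob {\<omega> \<in> space M. X 1 \<omega> < - (b / \<kappa>)}" by (rule unbounded_below)
  also have "{\<omega> \<in> space M. X 1 \<omega> < - (b / \<kappa>)} = {\<omega> \<in> space M. \<kappa> * X 1 \<omega> \<in> {..< - b}}"
    using \<kappa> by (auto simp: field_simps)
  also have "prob \<dots> = prob {\<omega> \<in> space M. X (1/2) \<omega> \<in> {..< - b}}"
    unfolding \<kappa>_def by (rule prob_scaling[symmetric]) simp_all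
  also have "\<dots> = measure D2 {..< - b}"
    by (simp add: D2_def measure_distr vimage_def Int_def conj_commute)
  finally have "0 < measure D2 {..< - b}" .
  moreover have "measure D2 {..< - b} + measure D2 F = measure D2 ({..< - b} \<union> F)"
    using low finF by (intro D2.finite_measure_Union[symmetric]) (force simp: finite_imp_closed borel_closed)+
  moreover have "measure D2 ({..< - b} \<union> F) \<le> 1" by simp
  ultimately show False using F1 by simp
qed

end

section \<open>Dips at fixed times and divergence to minus infinity\<close>

lemma (in prob_space) law_compose:
  assumes "distr M borel U = distr M borel V" "U \<in> borel_measurable M" "V \<in> borel_measurable M"
    and f: "f \<in> borel_measurable borel"
  shows "distr M borel (\<lambda>\<omega>. f (U \<omega>)) = distr M borel (\<lambda>\<omega>. f (V \<omega>))"
proof -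
  have "distr (distr M borel U) borel f = distr (distr M borel V) borel f" using assms(1) by simp
  then show ?thesis using f assms(2,3) by (simp add: distr_distr comp_def)
qed

context stable_levy
begin

text \<open>The common structure of \<open>- (X (t + T \<rho>\<^sup>k) - X t)\<close> for \<open>\<sigma> = -1\<close> and of \<open>X t - X (t - T \<rho>\<^sup>k)\<close> for
  \<open>\<sigma> = 1\<close>: the process looked at from time \<open>t\<close> forwards or backwards.\<close>
definition geometric_scheme :: "real \<Rightarrow> real \<Rightarrow> real \<Rightarrow> nat \<Rightarrow> (nat \<Rightarrow> 'a \<Rightarrow> real) \<Rightarrow> bool" where
  "geometric_scheme \<sigma> T \<rho> K Y \<longleftrightarrow>
    (\<forall>k. Y k \<in> borel_measurable M) \<and>
    indep_vars (\<lambda>_. borel) (\<lambda>k \<omega>. Y k \<omega> - Y (Suc k) \<omega>) {..<K} \<and>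
    (\<forall>k. distr M borel (Y k) = distr M borel (\<lambda>\<omega>. \<sigma> * X (T * \<rho> ^ k) \<omega>)) \<and>
    (\<forall>k. distr M borel (\<lambda>\<omega>. Y k \<omega> - Y (Suc k) \<omega>) = distr M borel (\<lambda>\<omega>. \<sigma> * X (T * \<rho> ^ k - T * \<rho> ^ Suc k) \<omega>))"

text \<open>With \<open>\<rho>\<close> small, \<open>Y k\<close> is dominated by the increment \<open>Y k - Y (k+1)\<close>: at the scale of \<open>Y k\<close>
  the variable \<open>Y (k+1)\<close> is negligible with high probability.  The increments are independent,
  and each exceeds a fixed multiple of its scale with a probability bounded below.  So it is
  unlikely that all of \<open>K\<close> of them fail to do so.\<close>
lemma geometric_times:
  assumes \<sigma>: "\<sigma> = 1 \<or> \<sigma> = (-1::real)"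
  shows "\<exists>\<delta>>0. \<forall>\<eta>>0. \<exists>K \<rho>. 0 < \<rho> \<and> \<rho> \<le> 1/2 \<and> (\<forall>T>0. \<forall>Y.
    geometric_scheme \<sigma> T \<rho> K Y \<longrightarrow>
    prob {\<omega> \<in> space M. \<forall>k<K. Y k \<omega> \<le> \<delta> * (T * \<rho> ^ k) powr (1/\<alpha>)} \<le> \<eta>)"
proof -
  obtain \<delta>0 where \<delta>0: "\<delta>0 > 0" "0 < prob {\<omega> \<in> space M. \<delta>0 < \<sigma> * X 1 \<omega>}"
  proof (cases "\<sigma> = 1")
    case True
    then show ?thesis using positive_part that by auto
  next
    case False
    then have s: "\<sigma> = -1" using \<sigma> by simp
    have "{\<omega> \<in> space M. 1 < \<sigma> * X 1 \<omega>} = {\<omega> \<in> space M. X 1 \<omega> < - 1}" using s by auto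
    then show ?thesis using unbounded_below[of 1] that[of 1] by simp
  qed
  define p where "p = prob {\<omega> \<in> space M. \<delta>0 < \<sigma> * X 1 \<omega>}"
  have p: "0 < p" "p \<le> 1" using \<delta>0 by (simp_all add: p_def)
  define \<delta> where "\<delta> = \<delta>0 / 4"
  have \<delta>: "\<delta> > 0" using \<delta>0 by (simp add: \<delta>_def)
  show ?thesis
  proof (intro exI[of _ \<delta>] conjI allI impI)
    show "\<delta> > 0" by (rule \<delta>)
    fix \<eta> :: real assume \<eta>: "\<eta> > 0"
    \<comment> \<open>First \<open>K\<close> makes the failure of all increments unlikely, then \<open>\<rho>\<close> makes the \<open>K\<close> remainders negligible.\<close>
    obtain n where n: "(1 - p) ^ n < \<eta> / 2" using real_arch_pow_inv[of "\<eta>/2" "1 - p"] \<eta> p by auto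
    define K where "K = Suc n"
    have "(1 - p) ^ K \<le> (1 - p) ^ n" unfolding K_def by (rule power_decreasing) (use p in simp_all)
    then have K: "(1 - p) ^ K \<le> \<eta> / 2" using n by simp
    have "\<eta> / (2 * real K) > 0" using \<eta> by (simp add: K_def)
    then obtain R where R: "R > 0" "prob {\<omega> \<in> space M. R < \<bar>X 1 \<omega>\<bar>} \<le> \<eta> / (2 * real K)" by (rule tight)
    define \<rho> where "\<rho> = min (1/2) ((\<delta> / R) powr \<alpha>)"
    have \<rho>: "0 < \<rho>" "\<rho> \<le> 1/2" using \<delta> R by (simp_all add: \<rho>_def)
    have "\<rho> powr (1/\<alpha>) \<le> ((\<delta> / R) powr \<alpha>) powr (1/\<alpha>)"
      by (rule powr_mono2) (use \<rho> alpha in \<open>simp_all add: \<rho>_def\<close>)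
    also have "\<dots> = \<delta> / R" using \<delta> R alpha by (simp add: powr_powr)
    finally have \<rho>R: "\<rho> powr (1/\<alpha>) \<le> \<delta> / R" .
    have "(1 - \<rho>) powr 1 \<le> (1 - \<rho>) powr (1/\<alpha>)" by (rule powr_mono') (use \<rho> alpha in simp_all)
    then have half: "1/2 \<le> (1 - \<rho>) powr (1/\<alpha>)" using \<rho> by simp
    show "\<exists>K \<rho>. 0 < \<rho> \<and> \<rho> \<le> 1/2 \<and> (\<forall>T>0. \<forall>Y.
      geometric_scheme \<sigma> T \<rho> K Y \<longrightarrow>
      prob {\<omega> \<in> space M. \<forall>k<K. Y k \<omega> \<le> \<delta> * (T * \<rho> ^ k) powr (1/\<alpha>)} \<le> \<eta>)"
    proof (intro exI[of _ K] exI[of _ \<rho>] conjI \<rho> allI impI)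
      fix T :: real and Y :: "nat \<Rightarrow> 'a \<Rightarrow> real"
      assume T: "T > 0" and scheme: "geometric_scheme \<sigma> T \<rho> K Y"
      note scheme = scheme[unfolded geometric_scheme_def]
      have Ym: "\<forall>k. Y k \<in> borel_measurable M"
        by (rule scheme[THEN conjunct1])
      have ind: "indep_vars (\<lambda>_. borel) (\<lambda>k \<omega>. Y k \<omega> - Y (Suc k) \<omega>) {..<K}"
        by (rule scheme[THEN conjunct2, THEN conjunct1])
      have Ylaw: "\<forall>k. distr M borel (Y k) = distr M borel (\<lambda>\<omega>. \<sigma> * X (T * \<rho> ^ k) \<omega>)"
        by (rule scheme[THEN conjunct2, THEN conjunct2, THEN conjunct1])
      have Wlaw: "\<forall>k. distr M borel (\<lambda>\<omega>. Y k \<omega> - Y (Suc k) \<omega>) = distr M borel (\<lambda>\<omega>. \<sigma> * X (T * \<rho> ^ k - T * \<rho> ^ Suc k) \<omega>)"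
        by (rule scheme[THEN conjunct2, THEN conjunct2, THEN conjunct2])
      have [measurable]: "Y k \<in> borel_measurable M" for k using Ym by simp
      define a where "a k = T * \<rho> ^ k" for k
      have a: "0 < a k" "a (Suc k) = \<rho> * a k" for k using T \<rho> by (simp_all add: a_def)
      define s where "s k = a k powr (1/\<alpha>)" for k
      have s: "0 < s k" for k using a(1)[of k] by (simp add: s_def)
      have s_Suc: "a (Suc k) powr (1/\<alpha>) = \<rho> powr (1/\<alpha>) * s k" for k
        unfolding s_def a(2) by (rule powr_mult)
      \<comment> \<open>\<open>F k\<close>: the remainder \<open>Y (k+1)\<close> is large; \<open>W k\<close>: the increment is small.\<close>
      define F where "F k = {\<omega> \<in> space M. \<delta> * s k < \<bar>Y (Suc k) \<omega>\<bar>}" for k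
      define W where "W k = {\<omega> \<in> space M. Y k \<omega> - Y (Suc k) \<omega> \<le> 2 * \<delta> * s k}" for k
      have [measurable]: "F k \<in> events" "W k \<in> events" for k unfolding F_def W_def by measurable
      have F: "prob (F k) \<le> \<eta> / (2 * real K)" for k
      proof -
        let ?A = "{y::real. \<delta> * s k < \<bar>y\<bar>}"
        have A: "?A \<in> sets borel" by measurable
        have "0 \<le> a (Suc k)" using a(1)[of "Suc k"] by simp
        note m = meas[OF this]
        have "prob (F k) = prob {\<omega> \<in> space M. Y (Suc k) \<omega> \<in> ?A}" by (simp add: F_def)
        also have "\<dots> = prob {\<omega> \<in> space M. \<sigma> * X (a (Suc k)) \<omega> \<in> ?A}"
          by (rule prob_law_cong[OF _ _ _ A]) (use Ylaw m in \<open>simp_all add: a_def\<close>)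
        also have "\<dots> = prob {\<omega> \<in> space M. X (a (Suc k)) \<omega> \<in> ?A}" using \<sigma> by (auto simp: abs_mult)
        also have "\<dots> = prob {\<omega> \<in> space M. a (Suc k) powr (1/\<alpha>) * X 1 \<omega> \<in> ?A}"
          by (rule prob_scaling[OF a(1) A])
        also have "\<dots> \<le> prob {\<omega> \<in> space M. R < \<bar>X 1 \<omega>\<bar>}"
        proof (rule finite_measure_mono)
          show "{\<omega> \<in> space M. a (Suc k) powr (1/\<alpha>) * X 1 \<omega> \<in> ?A} \<subseteq> {\<omega> \<in> space M. R < \<bar>X 1 \<omega>\<bar>}"
          proof
            fix \<omega> assume w: "\<omega> \<in> {\<omega> \<in> space M. a (Suc k) powr (1/\<alpha>) * X 1 \<omega> \<in> ?A}"
            then have "\<delta> * s k < \<bar>\<rho> powr (1/\<alpha>) * s k * X 1 \<omega>\<bar>" by (simp add: s_Suc)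
            also have "\<dots> = (\<rho> powr (1/\<alpha>) * \<bar>X 1 \<omega>\<bar>) * s k" using s[of k] by (simp add: abs_mult)
            finally have "\<delta> < \<rho> powr (1/\<alpha>) * \<bar>X 1 \<omega>\<bar>" using s[of k] by simp
            also have "\<dots> \<le> \<delta> / R * \<bar>X 1 \<omega>\<bar>" by (rule mult_right_mono[OF \<rho>R]) simp
            finally have "\<delta> * R < \<delta> * \<bar>X 1 \<omega>\<bar>" using R by (simp add: field_simps)
            then show "\<omega> \<in> {\<omega> \<in> space M. R < \<bar>X 1 \<omega>\<bar>}" using \<delta> w by simp
          qed
        qed measurable
        finally show ?thesis using R by simp
      qed
      have W: "prob (W k) \<le> 1 - p" for k
      proof -
        define b where "b = T * \<rho> ^ k - T * \<rho> ^ Suc k"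
        have ba: "b = (1 - \<rho>) * a k" by (simp add: b_def a_def algebra_simps)
        have b: "0 < b" using ba a(1)[of k] \<rho> by simp
        then have b0: "0 \<le> b" by simp
        have bs: "s k / 2 \<le> b powr (1/\<alpha>)"
        proof -
          have "b powr (1/\<alpha>) = (1 - \<rho>) powr (1/\<alpha>) * s k" unfolding ba s_def by (rule powr_mult)
          then show ?thesis using mult_right_mono[OF half, of "s k"] s[of k] by simp
        qed
        let ?A = "{y::real. \<sigma> * y \<le> 2 * \<delta> * s k}"
        have A: "?A \<in> sets borel" by measurable
        have "prob (W k) = prob {\<omega> \<in> space M. Y k \<omega> - Y (Suc k) \<omega> \<in> {..2 * \<delta> * s k}}" by (simp add: W_def)
        also have "\<dots> = prob {\<omega> \<in> space M. \<sigma> * X b \<omega> \<in> {..2 * \<delta> * s k}}"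
          by (rule prob_law_cong) (use Wlaw meas[OF b0] in \<open>simp_all add: b_def\<close>)
        also have "\<dots> = prob {\<omega> \<in> space M. X b \<omega> \<in> ?A}" by simp
        also have "\<dots> = prob {\<omega> \<in> space M. b powr (1/\<alpha>) * X 1 \<omega> \<in> ?A}"
          by (rule prob_scaling[OF b A])
        also have "\<dots> \<le> prob (space M - {\<omega> \<in> space M. \<delta>0 < \<sigma> * X 1 \<omega>})"
        proof (rule finite_measure_mono)
          show "{\<omega> \<in> space M. b powr (1/\<alpha>) * X 1 \<omega> \<in> ?A} \<subseteq> space M - {\<omega> \<in> space M. \<delta>0 < \<sigma> * X 1 \<omega>}"
          proof
            fix \<omega> assume w: "\<omega> \<in> {\<omega> \<in> space M. b powr (1/\<alpha>) * X 1 \<omega> \<in> ?A}"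
            have "\<not> \<delta>0 < \<sigma> * X 1 \<omega>"
            proof
              assume d: "\<delta>0 < \<sigma> * X 1 \<omega>"
              have "2 * \<delta> * s k = s k / 2 * \<delta>0" by (simp add: \<delta>_def)
              also have "\<dots> < s k / 2 * (\<sigma> * X 1 \<omega>)" using d s[of k] by simp
              also have "\<dots> \<le> b powr (1/\<alpha>) * (\<sigma> * X 1 \<omega>)"
                by (rule mult_right_mono[OF bs]) (use d \<delta>0 in simp)
              also have "\<dots> \<le> 2 * \<delta> * s k" using w by (simp add: mult_ac)
              finally show False by simp
            qed
            then show "\<omega> \<in> space M - {\<omega> \<in> space M. \<delta>0 < \<sigma> * X 1 \<omega>}" using w by simp
          qed
        qed measurable
        also have "\<dots> = 1 - p" unfolding p_def by (rule prob_compl) measurable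
        finally show ?thesis .
      qed
      have K0: "{..<K} \<noteq> {}" by (auto simp: K_def lessThan_empty_iff)
      have "prob (\<Inter>k\<in>{..<K}. (\<lambda>\<omega>. Y k \<omega> - Y (Suc k) \<omega>) -` {..2 * \<delta> * s k} \<inter> space M)
          = (\<Prod>k\<in>{..<K}. prob ((\<lambda>\<omega>. Y k \<omega> - Y (Suc k) \<omega>) -` {..2 * \<delta> * s k} \<inter> space M))"
        by (rule indep_varsD_finite[OF ind K0]) simp_all
      also have "(\<lambda>k. (\<lambda>\<omega>. Y k \<omega> - Y (Suc k) \<omega>) -` {..2 * \<delta> * s k} \<inter> space M) = W" by (auto simp: W_def)
      finally have "prob (\<Inter>k\<in>{..<K}. W k) = (\<Prod>k\<in>{..<K}. prob (W k))" by simp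
      also have "\<dots> \<le> (\<Prod>k\<in>{..<K}. 1 - p)" by (rule prod_mono) (use W in simp)
      also have "\<dots> = (1 - p) ^ K" by simp
      finally have PW: "prob (\<Inter>k\<in>{..<K}. W k) \<le> \<eta> / 2" using K by simp
      have PF: "prob (\<Union>k\<in>{..<K}. F k) \<le> \<eta> / 2"
      proof -
        have "prob (\<Union>k\<in>{..<K}. F k) \<le> (\<Sum>k\<in>{..<K}. prob (F k))"
          by (rule finite_measure_subadditive_finite) auto
        also have "\<dots> \<le> (\<Sum>k\<in>{..<K}. \<eta> / (2 * real K))" by (rule sum_mono[OF F])
        also have "\<dots> = real K * (\<eta> / (2 * real K))" by simp
        also have "\<dots> = \<eta> / 2"
        proof -
          have "real K \<noteq> 0" by (simp add: K_def)
          then show ?thesis by (simp add: field_simps)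
        qed
        finally show ?thesis .
      qed
      have [measurable]: "(\<Inter>k\<in>{..<K}. W k) \<in> events" using K0 by (intro sets.finite_INT) auto
      have "prob {\<omega> \<in> space M. \<forall>k<K. Y k \<omega> \<le> \<delta> * (T * \<rho> ^ k) powr (1/\<alpha>)} \<le> prob ((\<Union>k\<in>{..<K}. F k) \<union> (\<Inter>k\<in>{..<K}. W k))"
      proof (rule finite_measure_mono)
        show "{\<omega> \<in> space M. \<forall>k<K. Y k \<omega> \<le> \<delta> * (T * \<rho> ^ k) powr (1/\<alpha>)} \<subseteq> (\<Union>k\<in>{..<K}. F k) \<union> (\<Inter>k\<in>{..<K}. W k)"
        proof
          fix \<omega> assume w: "\<omega> \<in> {\<omega> \<in> space M. \<forall>k<K. Y k \<omega> \<le> \<delta> * (T * \<rho> ^ k) powr (1/\<alpha>)}"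
          have "\<omega> \<in> W k" if "k < K" "\<omega> \<notin> F k" for k
          proof -
            have "Y k \<omega> \<le> \<delta> * s k" using w that by (simp add: s_def a_def)
            moreover have "\<bar>Y (Suc k) \<omega>\<bar> \<le> \<delta> * s k" using that w by (simp add: F_def)
            ultimately have "Y k \<omega> - Y (Suc k) \<omega> \<le> 2 * \<delta> * s k" by linarith
            then show ?thesis using w by (simp add: W_def)
          qed
          then show "\<omega> \<in> (\<Union>k\<in>{..<K}. F k) \<union> (\<Inter>k\<in>{..<K}. W k)" by blast
        qed
      qed measurable
      also have "\<dots> \<le> prob (\<Union>k\<in>{..<K}. F k) + prob (\<Inter>k\<in>{..<K}. W k)"
        by (rule measure_Un_le) measurable
      finally show "prob {\<omega> \<in> space M. \<forall>k<K. Y k \<omega> \<le> \<delta> * (T * \<rho> ^ k) powr (1/\<alpha>)} \<le> \<eta>"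
        using PF PW by simp
    qed
  qed
qed

text \<open>The bound keeps the level \<open>\<delta> * (T * \<rho> ^ k) powr (1/\<alpha>)\<close> because, for large \<open>T\<close>, it also shows
  that the path is unbounded below.\<close>
lemma forward_dip:
  "\<exists>\<delta>>0. \<forall>\<eta>>0. \<exists>K \<rho>. 0 < \<rho> \<and> \<rho> \<le> 1/2 \<and> (\<forall>T>0. \<forall>t\<ge>0.
     prob {\<omega> \<in> space M. \<forall>k<K. X t \<omega> - X (t + T * \<rho> ^ k) \<omega> \<le> \<delta> * (T * \<rho> ^ k) powr (1/\<alpha>)} \<le> \<eta>)"
proof -
  obtain \<delta> where \<delta>: "\<delta> > 0" and main: "\<And>\<eta>. \<eta> > 0 \<Longrightarrow> \<exists>K \<rho>. 0 < \<rho> \<and> \<rho> \<le> 1/2 \<and> (\<forall>T>0. \<forall>Y.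
    geometric_scheme (-1) T \<rho> K Y \<longrightarrow>
    prob {\<omega> \<in> space M. \<forall>k<K. Y k \<omega> \<le> \<delta> * (T * \<rho> ^ k) powr (1/\<alpha>)} \<le> \<eta>)"
    using geometric_times[of "-1"] by blast
  show ?thesis
  proof (intro exI[of _ \<delta>] conjI \<delta> allI impI)
    fix \<eta> :: real assume "\<eta> > 0"
    from main[OF this] obtain K \<rho> where \<rho>: "0 < \<rho>" "\<rho> \<le> 1/2" and main': "\<And>T Y. T > 0 \<Longrightarrow>
      geometric_scheme (-1) T \<rho> K Y \<Longrightarrow>
      prob {\<omega> \<in> space M. \<forall>k<K. Y k \<omega> \<le> \<delta> * (T * \<rho> ^ k) powr (1/\<alpha>)} \<le> \<eta>"
      by blast
    show "\<exists>K \<rho>. 0 < \<rho> \<and> \<rho> \<le> 1/2 \<and> (\<forall>T>0. \<forall>t\<ge>0.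
      prob {\<omega> \<in> space M. \<forall>k<K. X t \<omega> - X (t + T * \<rho> ^ k) \<omega> \<le> \<delta> * (T * \<rho> ^ k) powr (1/\<alpha>)} \<le> \<eta>)"
    proof (intro exI[of _ K] exI[of _ \<rho>] conjI \<rho> allI impI)
      fix T t :: real assume T: "T > 0" and t: "t \<ge> 0"
      define a where "a k = T * \<rho> ^ k" for k
      have a0: "0 \<le> a k" for k using T \<rho> by (simp add: a_def)
      have a_Suc: "a (Suc k) \<le> a k" for k
        using T \<rho> mult_right_mono[of \<rho> 1 "T * \<rho> ^ k"] by (simp add: a_def mult_ac)
      have a_mono: "a j \<le> a i" if "i \<le> j" for i j
        using that by (rule lift_Suc_antimono_le[of a, OF a_Suc])
      have m [measurable]: "X (t + a k) \<in> borel_measurable M" for k using t a0 by (intro meas) simp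
      have mt [measurable]: "X t \<in> borel_measurable M" using t by (intro meas)
      have "geometric_scheme (-1) T \<rho> K (\<lambda>k \<omega>. X t \<omega> - X (t + T * \<rho> ^ k) \<omega>)"
        unfolding geometric_scheme_def a_def[symmetric]
      proof (intro conjI)
        show "\<forall>k. (\<lambda>\<omega>. X t \<omega> - X (t + a k) \<omega>) \<in> borel_measurable M" by simp
        \<comment> \<open>The times decrease in \<open>k\<close>, so the increments have to be listed backwards.\<close>
        define \<theta> where "\<theta> i = t + a (K - i)" for i
        have "indep_vars (\<lambda>_. borel) (\<lambda>i \<omega>. X (\<theta> (Suc i)) \<omega> - X (\<theta> i) \<omega>) {..<K}"
          by (rule increments_indep) (use t a0 in \<open>simp_all add: \<theta>_def a_mono\<close>)
        then have "indep_vars (\<lambda>_. borel) (\<lambda>k. (\<lambda>i \<omega>. X (\<theta> (Suc i)) \<omega> - X (\<theta> i) \<omega>) (K - Suc k)) {..<K}"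
          by (rule indep_vars_reindex_inj) (auto simp: inj_on_def)
        then have "indep_vars (\<lambda>_. borel) (\<lambda>k \<omega>. - ((\<lambda>i \<omega>. X (\<theta> (Suc i)) \<omega> - X (\<theta> i) \<omega>) (K - Suc k) \<omega>)) {..<K}"
          by (rule indep_vars_compose2) simp
        moreover have "- ((\<lambda>i \<omega>. X (\<theta> (Suc i)) \<omega> - X (\<theta> i) \<omega>) (K - Suc k) \<omega>)
            = X t \<omega> - X (t + a k) \<omega> - (X t \<omega> - X (t + a (Suc k)) \<omega>)" if "k < K" for k \<omega>
          using that by (simp add: \<theta>_def Suc_diff_Suc)
        ultimately show "indep_vars (\<lambda>_. borel) (\<lambda>k \<omega>. X t \<omega> - X (t + a k) \<omega> - (X t \<omega> - X (t + a (Suc k)) \<omega>)) {..<K}"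
          by (subst indep_vars_cong[OF refl _ refl, where Y = "\<lambda>k \<omega>. - ((\<lambda>i \<omega>. X (\<theta> (Suc i)) \<omega> - X (\<theta> i) \<omega>) (K - Suc k) \<omega>)"]) auto
        show "\<forall>k. distr M borel (\<lambda>\<omega>. X t \<omega> - X (t + a k) \<omega>) = distr M borel (\<lambda>\<omega>. (-1) * X (a k) \<omega>)"
        proof
          fix k
          have "distr M borel (\<lambda>\<omega>. X (t + a k) \<omega> - X t \<omega>) = distr M borel (X (a k))"
            using increment_law[of t "t + a k"] t a0[of k] by simp
          from law_compose[OF this, of "\<lambda>y. (-1) * y"]
          show "distr M borel (\<lambda>\<omega>. X t \<omega> - X (t + a k) \<omega>) = distr M borel (\<lambda>\<omega>. (-1) * X (a k) \<omega>)"
            using meas[OF a0[of k]] by simp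
        qed
        show "\<forall>k. distr M borel (\<lambda>\<omega>. X t \<omega> - X (t + a k) \<omega> - (X t \<omega> - X (t + a (Suc k)) \<omega>))
             = distr M borel (\<lambda>\<omega>. (-1) * X (a k - a (Suc k)) \<omega>)"
        proof
          fix k
          have d: "0 \<le> a k - a (Suc k)" using a_Suc[of k] by simp
          have "distr M borel (\<lambda>\<omega>. X (t + a k) \<omega> - X (t + a (Suc k)) \<omega>) = distr M borel (X (a k - a (Suc k)))"
            using increment_law[of "t + a (Suc k)" "t + a k"] t a0[of "Suc k"] a_Suc[of k] by simp
          from law_compose[OF this, of "\<lambda>y. (-1) * y"]
          show "distr M borel (\<lambda>\<omega>. X t \<omega> - X (t + a k) \<omega> - (X t \<omega> - X (t + a (Suc k)) \<omega>))
             = distr M borel (\<lambda>\<omega>. (-1) * X (a k - a (Suc k)) \<omega>)"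
            using meas[OF d] by simp
        qed
      qed
      then show "prob {\<omega> \<in> space M. \<forall>k<K. X t \<omega> - X (t + T * \<rho> ^ k) \<omega> \<le> \<delta> * (T * \<rho> ^ k) powr (1/\<alpha>)} \<le> \<eta>"
        by (rule main'[OF T])
    qed
  qed
qed

lemma backward_dip:
  "\<forall>\<eta>>0. \<exists>K \<rho>. 0 < \<rho> \<and> \<rho> \<le> 1/2 \<and> (\<forall>T>0. \<forall>t\<ge>T.
     prob {\<omega> \<in> space M. \<forall>k<K. X t \<omega> - X (t - T * \<rho> ^ k) \<omega> \<le> 0} \<le> \<eta>)"
proof -
  obtain \<delta> where \<delta>: "\<delta> > 0" and main: "\<And>\<eta>. \<eta> > 0 \<Longrightarrow> \<exists>K \<rho>. 0 < \<rho> \<and> \<rho> \<le> 1/2 \<and> (\<forall>T>0. \<forall>Y.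
    geometric_scheme 1 T \<rho> K Y \<longrightarrow>
    prob {\<omega> \<in> space M. \<forall>k<K. Y k \<omega> \<le> \<delta> * (T * \<rho> ^ k) powr (1/\<alpha>)} \<le> \<eta>)"
    using geometric_times[of 1] by blast
  show ?thesis
  proof (intro allI impI)
    fix \<eta> :: real assume "\<eta> > 0"
    from main[OF this] obtain K \<rho> where \<rho>: "0 < \<rho>" "\<rho> \<le> 1/2" and main': "\<And>T Y. T > 0 \<Longrightarrow>
      geometric_scheme 1 T \<rho> K Y \<Longrightarrow>
      prob {\<omega> \<in> space M. \<forall>k<K. Y k \<omega> \<le> \<delta> * (T * \<rho> ^ k) powr (1/\<alpha>)} \<le> \<eta>"
      by blast
    show "\<exists>K \<rho>. 0 < \<rho> \<and> \<rho> \<le> 1/2 \<and> (\<forall>T>0. \<forall>t\<ge>T.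
      prob {\<omega> \<in> space M. \<forall>k<K. X t \<omega> - X (t - T * \<rho> ^ k) \<omega> \<le> 0} \<le> \<eta>)"
    proof (intro exI[of _ K] exI[of _ \<rho>] conjI \<rho> allI impI)
      fix T t :: real assume T: "T > 0" and tT: "t \<ge> T"
      then have t: "0 \<le> t" by simp
      define a where "a k = T * \<rho> ^ k" for k
      have a0: "0 \<le> a k" for k using T \<rho> by (simp add: a_def)
      have a_Suc: "a (Suc k) \<le> a k" for k
        using T \<rho> mult_right_mono[of \<rho> 1 "T * \<rho> ^ k"] by (simp add: a_def mult_ac)
      have aT: "a k \<le> t" for k
        using lift_Suc_antimono_le[of a, OF a_Suc, of 0 k] tT by (simp add: a_def)
      have m [measurable]: "X (t - a k) \<in> borel_measurable M" for k using aT by (intro meas) simp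
      have mt [measurable]: "X t \<in> borel_measurable M" using t by (intro meas)
      have "geometric_scheme 1 T \<rho> K (\<lambda>k \<omega>. X t \<omega> - X (t - T * \<rho> ^ k) \<omega>)"
        unfolding geometric_scheme_def a_def[symmetric]
      proof (intro conjI)
        show "\<forall>k. (\<lambda>\<omega>. X t \<omega> - X (t - a k) \<omega>) \<in> borel_measurable M" by simp
        have "indep_vars (\<lambda>_. borel) (\<lambda>k \<omega>. X (t - a (Suc k)) \<omega> - X (t - a k) \<omega>) {..<K}"
          by (rule increments_indep[of "\<lambda>k. t - a k"]) (use aT a_Suc in simp_all)
        then show "indep_vars (\<lambda>_. borel) (\<lambda>k \<omega>. X t \<omega> - X (t - a k) \<omega> - (X t \<omega> - X (t - a (Suc k)) \<omega>)) {..<K}"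
          by simp
        show "\<forall>k. distr M borel (\<lambda>\<omega>. X t \<omega> - X (t - a k) \<omega>) = distr M borel (\<lambda>\<omega>. 1 * X (a k) \<omega>)"
          using increment_law[of "t - a k" t for k] aT a0 by simp
        show "\<forall>k. distr M borel (\<lambda>\<omega>. X t \<omega> - X (t - a k) \<omega> - (X t \<omega> - X (t - a (Suc k)) \<omega>))
             = distr M borel (\<lambda>\<omega>. 1 * X (a k - a (Suc k)) \<omega>)"
          using increment_law[of "t - a k" "t - a (Suc k)" for k] aT a_Suc by simp
      qed
      then have "prob {\<omega> \<in> space M. \<forall>k<K. X t \<omega> - X (t - T * \<rho> ^ k) \<omega> \<le> \<delta> * (T * \<rho> ^ k) powr (1/\<alpha>)} \<le> \<eta>"
        by (rule main'[OF T])
      moreover have "{\<omega> \<in> space M. \<forall>k<K. X t \<omega> - X (t - T * \<rho> ^ k) \<omega> \<le> 0}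
         \<subseteq> {\<omega> \<in> space M. \<forall>k<K. X t \<omega> - X (t - T * \<rho> ^ k) \<omega> \<le> \<delta> * (T * \<rho> ^ k) powr (1/\<alpha>)}"
      proof -
        have "0 \<le> \<delta> * (T * \<rho> ^ k) powr (1/\<alpha>)" for k using \<delta> by simp
        then show ?thesis using order_trans by blast
      qed
      then have "prob {\<omega> \<in> space M. \<forall>k<K. X t \<omega> - X (t - T * \<rho> ^ k) \<omega> \<le> 0}
         \<le> prob {\<omega> \<in> space M. \<forall>k<K. X t \<omega> - X (t - T * \<rho> ^ k) \<omega> \<le> \<delta> * (T * \<rho> ^ k) powr (1/\<alpha>)}"
        unfolding a_def[symmetric] by (rule finite_measure_mono) measurable
      ultimately show "prob {\<omega> \<in> space M. \<forall>k<K. X t \<omega> - X (t - T * \<rho> ^ k) \<omega> \<le> 0} \<le> \<eta>" by simp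
    qed
  qed
qed

lemma AE_small_positive:
  fixes P :: "real \<Rightarrow> 'a \<Rightarrow> bool"
  assumes "\<And>\<epsilon>. \<epsilon> > 0 \<Longrightarrow> AE \<omega> in M. P \<epsilon> \<omega>" and mono: "\<And>\<epsilon> \<epsilon>' \<omega>. P \<epsilon> \<omega> \<Longrightarrow> \<epsilon> \<le> \<epsilon>' \<Longrightarrow> P \<epsilon>' \<omega>"
  shows "AE \<omega> in M. \<forall>\<epsilon>>0. P \<epsilon> \<omega>"
proof -
  have "AE \<omega> in M. \<forall>n. P (1 / real (Suc n)) \<omega>"
    unfolding AE_all_countable by (intro allI assms(1)) simp
  then show ?thesis
  proof eventually_elim
    case (elim \<omega>)
    show ?case
    proof (intro allI impI)
      fix \<epsilon> :: real assume "\<epsilon> > 0"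
      then obtain n where "1 / real (Suc n) < \<epsilon>" by (rule nat_approx_posE)
      then show "P \<epsilon> \<omega>" using mono[of "1 / real (Suc n)" \<omega> \<epsilon>] elim by simp
    qed
  qed
qed

lemma dips_right:
  assumes t: "0 \<le> t"
  shows "AE \<omega> in M. \<forall>\<epsilon>>0. \<exists>s. t < s \<and> s < t + \<epsilon> \<and> X s \<omega> < X t \<omega>"
proof (rule AE_small_positive)
  fix \<epsilon> :: real assume e: "\<epsilon> > 0"
  obtain \<delta> where \<delta>: "\<delta> > 0" and main: "\<forall>\<eta>>0. \<exists>K \<rho>. 0 < \<rho> \<and> \<rho> \<le> 1/2 \<and> (\<forall>T>0. \<forall>t\<ge>0.
     prob {\<omega> \<in> space M. \<forall>k<K. X t \<omega> - X (t + T * \<rho> ^ k) \<omega> \<le> \<delta> * (T * \<rho> ^ k) powr (1/\<alpha>)} \<le> \<eta>)"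
    using forward_dip by (elim exE conjE) (rule that, assumption+)
  show "AE \<omega> in M. \<exists>s. t < s \<and> s < t + \<epsilon> \<and> X s \<omega> < X t \<omega>"
  proof (rule AE_if_small_exceptions)
    fix \<eta> :: real assume \<eta>: "\<eta> > 0"
    obtain K \<rho> where \<rho>: "0 < \<rho>" "\<rho> \<le> 1/2" and b: "\<forall>T>0. \<forall>t\<ge>0.
     prob {\<omega> \<in> space M. \<forall>k<K. X t \<omega> - X (t + T * \<rho> ^ k) \<omega> \<le> \<delta> * (T * \<rho> ^ k) powr (1/\<alpha>)} \<le> \<eta>"
      using main[rule_format, OF \<eta>] by (elim exE conjE) (rule that, assumption+)
    define T where "T = \<epsilon> / 2"
    have T: "T > 0" using e by (simp add: T_def)
    let ?E = "{\<omega> \<in> space M. \<forall>k<K. X t \<omega> - X (t + T * \<rho> ^ k) \<omega> \<le> \<delta> * (T * \<rho> ^ k) powr (1/\<alpha>)}"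
    have pos: "0 < T * \<rho> ^ k" "T * \<rho> ^ k < \<epsilon>" for k
    proof -
      show "0 < T * \<rho> ^ k" using T \<rho> by simp
      have "\<rho> ^ k \<le> 1" using \<rho> by (intro power_le_one) simp_all
      then have "T * \<rho> ^ k \<le> T" using T by (simp add: mult_left_le)
      then show "T * \<rho> ^ k < \<epsilon>" using e by (simp add: T_def)
    qed
    have [measurable]: "X (t + T * \<rho> ^ k) \<in> borel_measurable M" "X t \<in> borel_measurable M" for k
      using t pos(1)[of k] by (auto intro!: meas)
    have "?E \<in> events" by measurable
    moreover have "{\<omega> \<in> space M. \<not> (\<exists>s. t < s \<and> s < t + \<epsilon> \<and> X s \<omega> < X t \<omega>)} \<subseteq> ?E"
    proof
      fix \<omega> assume w: "\<omega> \<in> {\<omega> \<in> space M. \<not> (\<exists>s. t < s \<and> s < t + \<epsilon> \<and> X s \<omega> < X t \<omega>)}"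
      have "X t \<omega> - X (t + T * \<rho> ^ k) \<omega> \<le> \<delta> * (T * \<rho> ^ k) powr (1/\<alpha>)" for k
      proof -
        have "\<not> X (t + T * \<rho> ^ k) \<omega> < X t \<omega>" using w pos[of k] by auto
        moreover have "0 \<le> \<delta> * (T * \<rho> ^ k) powr (1/\<alpha>)" using \<delta> by simp
        ultimately show ?thesis by linarith
      qed
      then show "\<omega> \<in> ?E" using w by simp
    qed
    ultimately show "\<exists>E\<in>events. prob E \<le> \<eta> \<and> {\<omega> \<in> space M. \<not> (\<exists>s. t < s \<and> s < t + \<epsilon> \<and> X s \<omega> < X t \<omega>)} \<subseteq> E"
      using b[rule_format, OF T t] by (intro bexI[of _ ?E] conjI)
  qed
next
  fix \<epsilon> \<epsilon>' :: real and \<omega>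
  assume "\<exists>s. t < s \<and> s < t + \<epsilon> \<and> X s \<omega> < X t \<omega>" "\<epsilon> \<le> \<epsilon>'"
  then show "\<exists>s. t < s \<and> s < t + \<epsilon>' \<and> X s \<omega> < X t \<omega>" by (smt (verit, best))
qed

lemma dips_left:
  assumes t: "0 < t"
  shows "AE \<omega> in M. \<forall>\<epsilon>>0. \<exists>s. 0 \<le> s \<and> t - \<epsilon> < s \<and> s < t \<and> X s \<omega> < X t \<omega>"
proof (rule AE_small_positive)
  fix \<epsilon> :: real assume e: "\<epsilon> > 0"
  show "AE \<omega> in M. \<exists>s. 0 \<le> s \<and> t - \<epsilon> < s \<and> s < t \<and> X s \<omega> < X t \<omega>"
  proof (rule AE_if_small_exceptions)
    fix \<eta> :: real assume \<eta>: "\<eta> > 0"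
    obtain K \<rho> where \<rho>: "0 < \<rho>" "\<rho> \<le> 1/2" and b: "\<forall>T>0. \<forall>t\<ge>T.
     prob {\<omega> \<in> space M. \<forall>k<K. X t \<omega> - X (t - T * \<rho> ^ k) \<omega> \<le> 0} \<le> \<eta>"
      using backward_dip[rule_format, OF \<eta>] by (elim exE conjE) (rule that, assumption+)
    define T where "T = min t (\<epsilon> / 2)"
    have T: "T > 0" "T \<le> t" "T < \<epsilon>" using e t by (auto simp: T_def)
    let ?E = "{\<omega> \<in> space M. \<forall>k<K. X t \<omega> - X (t - T * \<rho> ^ k) \<omega> \<le> 0}"
    have pos: "0 < T * \<rho> ^ k" "T * \<rho> ^ k \<le> T" for k
    proof -
      show "0 < T * \<rho> ^ k" using T \<rho> by simp
      have "\<rho> ^ k \<le> 1" using \<rho> by (intro power_le_one) simp_all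
      then show "T * \<rho> ^ k \<le> T" using T by (simp add: mult_left_le)
    qed
    have ge0: "0 \<le> t - T * \<rho> ^ k" for k using pos(2)[of k] T by linarith
    have [measurable]: "X (t - T * \<rho> ^ k) \<in> borel_measurable M" "X t \<in> borel_measurable M" for k
      using t ge0[of k] by (auto intro!: meas)
    have "?E \<in> events" by measurable
    moreover have "{\<omega> \<in> space M. \<not> (\<exists>s. 0 \<le> s \<and> t - \<epsilon> < s \<and> s < t \<and> X s \<omega> < X t \<omega>)} \<subseteq> ?E"
    proof
      fix \<omega> assume w: "\<omega> \<in> {\<omega> \<in> space M. \<not> (\<exists>s. 0 \<le> s \<and> t - \<epsilon> < s \<and> s < t \<and> X s \<omega> < X t \<omega>)}"
      have "X t \<omega> - X (t - T * \<rho> ^ k) \<omega> \<le> 0" for k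
      proof -
        have "t - \<epsilon> < t - T * \<rho> ^ k" "t - T * \<rho> ^ k < t" using pos[of k] T by linarith+
        then have "\<not> X (t - T * \<rho> ^ k) \<omega> < X t \<omega>" using w ge0[of k] by blast
        then show ?thesis by simp
      qed
      then show "\<omega> \<in> ?E" using w by simp
    qed
    ultimately show "\<exists>E\<in>events. prob E \<le> \<eta> \<and> {\<omega> \<in> space M. \<not> (\<exists>s. 0 \<le> s \<and> t - \<epsilon> < s \<and> s < t \<and> X s \<omega> < X t \<omega>)} \<subseteq> E"
      using b[rule_format, OF T(1,2)] by (intro bexI[of _ ?E] conjI)
  qed
next
  fix \<epsilon> \<epsilon>' :: real and \<omega>
  assume "\<exists>s. 0 \<le> s \<and> t - \<epsilon> < s \<and> s < t \<and> X s \<omega> < X t \<omega>" "\<epsilon> \<le> \<epsilon>'"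
  then show "\<exists>s. 0 \<le> s \<and> t - \<epsilon>' < s \<and> s < t \<and> X s \<omega> < X t \<omega>" by (smt (verit, best))
qed

text \<open>The times of \<open>forward_dip\<close> are taken so late that all of them are at least 1 and all the levels
  exceed \<open>b\<close>.\<close>
lemma unbounded_below_paths: "AE \<omega> in M. \<forall>b::nat. \<exists>s\<ge>1. X s \<omega> < - real b"
  unfolding AE_all_countable
proof
  fix b :: nat
  obtain \<delta> where \<delta>: "\<delta> > 0" and main: "\<forall>\<eta>>0. \<exists>K \<rho>. 0 < \<rho> \<and> \<rho> \<le> 1/2 \<and> (\<forall>T>0. \<forall>t\<ge>0.
     prob {\<omega> \<in> space M. \<forall>k<K. X t \<omega> - X (t + T * \<rho> ^ k) \<omega> \<le> \<delta> * (T * \<rho> ^ k) powr (1/\<alpha>)} \<le> \<eta>)"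
    using forward_dip by (elim exE conjE) (rule that, assumption+)
  have "AE \<omega> in M. X 0 \<omega> = 0 \<longrightarrow> (\<exists>s\<ge>1. X s \<omega> < - real b)"
  proof (rule AE_if_small_exceptions)
    fix \<eta> :: real assume \<eta>: "\<eta> > 0"
    obtain K \<rho> where \<rho>: "0 < \<rho>" "\<rho> \<le> 1/2" and bd: "\<forall>T>0. \<forall>t\<ge>0.
     prob {\<omega> \<in> space M. \<forall>k<K. X t \<omega> - X (t + T * \<rho> ^ k) \<omega> \<le> \<delta> * (T * \<rho> ^ k) powr (1/\<alpha>)} \<le> \<eta>"
      using main[rule_format, OF \<eta>] by (elim exE conjE) (rule that, assumption+)
    define c where "c = 1 + (real b / \<delta>) powr \<alpha>"
    have c: "c \<ge> 1" by (simp add: c_def)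
    define T where "T = c / \<rho> ^ K"
    have T: "T > 0" using c \<rho> by (simp add: T_def)
    have big: "c \<le> T * \<rho> ^ k" if "k < K" for k
    proof -
      have "\<rho> ^ K \<le> \<rho> ^ k" by (rule power_decreasing) (use that \<rho> in simp_all)
      then have "T * \<rho> ^ K \<le> T * \<rho> ^ k" using T by simp
      moreover have "T * \<rho> ^ K = c" unfolding T_def using \<rho> by simp
      ultimately show ?thesis by simp
    qed
    have lev: "real b \<le> \<delta> * (T * \<rho> ^ k) powr (1/\<alpha>)" if "k < K" for k
    proof -
      have "((real b / \<delta>) powr \<alpha>) powr (1/\<alpha>) \<le> (T * \<rho> ^ k) powr (1/\<alpha>)"
        by (rule powr_mono2) (use big[OF that] alpha in \<open>simp_all add: c_def\<close>)
      moreover have "((real b / \<delta>) powr \<alpha>) powr (1/\<alpha>) = real b / \<delta>"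
        using \<delta> alpha by (simp add: powr_powr)
      ultimately show ?thesis using \<delta> by (simp add: pos_divide_le_eq mult.commute)
    qed
    let ?E = "{\<omega> \<in> space M. \<forall>k<K. X 0 \<omega> - X (0 + T * \<rho> ^ k) \<omega> \<le> \<delta> * (T * \<rho> ^ k) powr (1/\<alpha>)}"
    have [measurable]: "X (0 + T * \<rho> ^ k) \<in> borel_measurable M" "X 0 \<in> borel_measurable M" for k
      using T \<rho> by (auto intro!: meas)
    have "?E \<in> events" by measurable
    moreover have "{\<omega> \<in> space M. \<not> (X 0 \<omega> = 0 \<longrightarrow> (\<exists>s\<ge>1. X s \<omega> < - real b))} \<subseteq> ?E"
    proof
      fix \<omega> assume w: "\<omega> \<in> {\<omega> \<in> space M. \<not> (X 0 \<omega> = 0 \<longrightarrow> (\<exists>s\<ge>1. X s \<omega> < - real b))}"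
      have "X 0 \<omega> - X (0 + T * \<rho> ^ k) \<omega> \<le> \<delta> * (T * \<rho> ^ k) powr (1/\<alpha>)" if k: "k < K" for k
      proof -
        have "1 \<le> 0 + T * \<rho> ^ k" using big[OF k] c by simp
        then have "\<not> X (0 + T * \<rho> ^ k) \<omega> < - real b" using w by blast
        moreover have "X 0 \<omega> = 0" using w by blast
        ultimately show ?thesis using lev[OF k] by linarith
      qed
      then show "\<omega> \<in> ?E" using w by simp
    qed
    ultimately show "\<exists>E\<in>events. prob E \<le> \<eta> \<and> {\<omega> \<in> space M. \<not> (X 0 \<omega> = 0 \<longrightarrow> (\<exists>s\<ge>1. X s \<omega> < - real b))} \<subseteq> E"
      using bd[rule_format, OF T order_refl] by (intro bexI[of _ ?E] conjI)
  qed
  with start show "AE \<omega> in M. \<exists>s\<ge>1. X s \<omega> < - real b"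
    by eventually_elim blast
qed

end

section \<open>Infima over disjoint intervals differ\<close>

text \<open>An almost minimal point is approximated from the right by grid points; the right end point itself
  belongs to the grid.\<close>
lemma grid_minimum_tendsto:
  fixes f :: "real \<Rightarrow> real"
  assumes ab: "a < b" and bdd: "bdd_below (f ` {a..b})"
    and rc: "\<And>u. a \<le> u \<Longrightarrow> u < b \<Longrightarrow> (f \<longlongrightarrow> f u) (at_right u)"
  shows "(\<lambda>N. Min ((\<lambda>i. f (a + (b - a) * real i / real (Suc N))) ` {..Suc N})) \<longlonglongrightarrow> (INF u\<in>{a..b}. f u)"
    (is "?m \<longlonglongrightarrow> ?I")
proof (rule LIMSEQ_I)
  fix \<epsilon> :: real assume e: "0 < \<epsilon>"
  have grid: "a + (b - a) * real i / real (Suc N) \<in> {a..b}" if "i \<le> Suc N" for i N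
  proof -
    have "0 \<le> (b - a) * real i / real (Suc N)" using ab by simp
    moreover have "(b - a) * (real i / real (Suc N)) \<le> (b - a) * 1"
      using ab that by (intro mult_left_mono) (simp_all add: divide_le_eq)
    ultimately show ?thesis by simp
  qed
  have lower: "?I \<le> ?m N" for N
  proof (rule Min.boundedI)
    fix y assume "y \<in> (\<lambda>i. f (a + (b - a) * real i / real (Suc N))) ` {..Suc N}"
    then obtain i where i: "i \<le> Suc N" "y = f (a + (b - a) * real i / real (Suc N))" by blast
    show "?I \<le> y" unfolding i(2) by (rule cINF_lower[OF bdd grid[OF i(1)]])
  qed simp_all
  have "?I < ?I + \<epsilon>" using e by simp
  then obtain u where u: "u \<in> {a..b}" "f u < ?I + \<epsilon>"
    using cINF_less_iff[OF _ bdd, of "?I + \<epsilon>"] ab by auto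
  have ev: "\<exists>N0. \<forall>N\<ge>N0. \<exists>i\<le>Suc N. f (a + (b - a) * real i / real (Suc N)) < ?I + \<epsilon>"
  proof (cases "u = b")
    case True
    have "f (a + (b - a) * real (Suc N) / real (Suc N)) < ?I + \<epsilon>" for N
      using u True by (simp del: of_nat_Suc)
    then show ?thesis by blast
  next
    case False
    then have ub: "a \<le> u" "u < b" using u by simp_all
    have "\<forall>\<^sub>F w in at_right u. f w < ?I + \<epsilon>" by (rule order_tendstoD(2)[OF rc[OF ub] u(2)])
    then obtain c where c: "u < c" "\<And>w. u < w \<Longrightarrow> w < c \<Longrightarrow> f w < ?I + \<epsilon>"
      unfolding eventually_at_right_field by blast
    define h where "h = min c b - u"
    have h: "h > 0" using c ub by (simp add: h_def)
    obtain N0 where N0: "(b - a) / h < real N0" using reals_Archimedean2 by blast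
    have "\<exists>i\<le>Suc N. f (a + (b - a) * real i / real (Suc N)) < ?I + \<epsilon>" if N: "N \<ge> N0" for N
    proof -
      define n where "n = real (Suc N)"
      have n: "n > 0" "(b - a) / h < n" using N N0 by (simp_all add: n_def)
      define z where "z = (u - a) * n / (b - a)"
      define i where "i = nat \<lceil>z\<rceil>"
      have z: "0 \<le> z" using ub n ab by (simp add: z_def)
      then have i: "z \<le> real i" "real i < z + 1" unfolding i_def by linarith+
      have za: "(b - a) * z = (u - a) * n" using ab by (simp add: z_def)
      define w where "w = a + (b - a) * real i / n"
      have wn: "(w - a) * n = (b - a) * real i" using n by (simp add: w_def)
      have "(b - a) * z \<le> (b - a) * real i" using ab i by simp
      then have "(u - a) * n \<le> (w - a) * n" using za wn by simp
      then have uw: "u \<le> w" using n by simp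
      have "(b - a) * real i < (b - a) * (z + 1)" using ab i by simp
      then have "(w - a) * n < (u - a) * n + (b - a)" using za wn by (simp add: algebra_simps)
      also have "b - a < h * n" using n h by (simp add: pos_divide_less_eq mult.commute)
      finally have "(w - a) * n < (u - a + h) * n" by (simp add: algebra_simps)
      then have wh: "w < u + h" using n by simp
      then have wb: "w < b" "w < c" by (simp_all add: h_def)
      have "f w < ?I + \<epsilon>" using u(2) c(2)[of w] wb uw by (cases "w = u") simp_all
      moreover have "i \<le> Suc N"
      proof -
        have "(b - a) * real i < (b - a) * n" using wn wb n by (metis diff_strict_right_mono mult_strict_right_mono)
        then have "real i < n" using ab by simp
        then show ?thesis by (simp add: n_def)
      qed
      ultimately show ?thesis unfolding w_def n_def by blast
    qed
    then show ?thesis by blast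
  qed
  then obtain N0 where N0: "\<And>N. N \<ge> N0 \<Longrightarrow> \<exists>i\<le>Suc N. f (a + (b - a) * real i / real (Suc N)) < ?I + \<epsilon>" by blast
  show "\<exists>no. \<forall>N\<ge>no. norm (?m N - ?I) < \<epsilon>"
  proof (intro exI[of _ N0] allI impI)
    fix N assume "N0 \<le> N"
    from N0[OF this] obtain i where i: "i \<le> Suc N" "f (a + (b - a) * real i / real (Suc N)) < ?I + \<epsilon>" by blast
    have "?m N \<le> f (a + (b - a) * real i / real (Suc N))" by (rule Min_le) (use i in auto)
    then have "?m N < ?I + \<epsilon>" using i(2) by (rule le_less_trans)
    then show "norm (?m N - ?I) < \<epsilon>" using lower[of N] unfolding real_norm_def by linarith
  qed
qed

context stable_levy
begin

text \<open>By stationarity and scaling, \<open>X 1 - X (1 - h)\<close> tends to 0 in probability as \<open>h\<close> does.\<close>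
lemma no_fixed_jump: "AE \<omega> in M. \<forall>m N. \<exists>n\<ge>N. \<bar>X 1 \<omega> - X (1 - 1 / real (Suc n)) \<omega>\<bar> \<le> 1 / real (Suc m)"
  unfolding AE_all_countable
proof (intro allI)
  fix m N :: nat
  define \<epsilon> where "\<epsilon> = 1 / real (Suc m)"
  have e: "\<epsilon> > 0" by (simp add: \<epsilon>_def)
  show "AE \<omega> in M. \<exists>n\<ge>N. \<bar>X 1 \<omega> - X (1 - 1 / real (Suc n)) \<omega>\<bar> \<le> 1 / real (Suc m)"
    unfolding \<epsilon>_def[symmetric]
  proof (rule AE_if_small_exceptions)
    fix \<eta> :: real assume "\<eta> > 0"
    then obtain R where R: "R > 0" "prob {\<omega> \<in> space M. R < \<bar>X 1 \<omega>\<bar>} \<le> \<eta>" by (rule tight)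
    obtain n0 where n0: "(R / \<epsilon>) powr \<alpha> < real n0" using reals_Archimedean2 by blast
    define n where "n = max N n0"
    define h where "h = 1 / real (Suc n)"
    have h: "0 < h" "h \<le> 1" by (simp_all add: h_def)
    have "real n0 \<le> real (Suc n)" by (simp add: n_def)
    then have "(R / \<epsilon>) powr \<alpha> \<le> real (Suc n)" using n0 by linarith
    then have "((R / \<epsilon>) powr \<alpha>) powr (1/\<alpha>) \<le> real (Suc n) powr (1/\<alpha>)"
      by (intro powr_mono2) (use alpha in simp_all)
    then have hR: "R / \<epsilon> \<le> real (Suc n) powr (1/\<alpha>)" using R e alpha by (simp add: powr_powr)
    have hp: "h powr (1/\<alpha>) = 1 / real (Suc n) powr (1/\<alpha>)" unfolding h_def by (simp add: powr_divide)
    let ?E = "{\<omega> \<in> space M. \<epsilon> < \<bar>X 1 \<omega> - X (1 - h) \<omega>\<bar>}"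
    let ?A = "{y::real. \<epsilon> < \<bar>y\<bar>}"
    have A: "?A \<in> sets borel" by measurable
    have [measurable]: "X (1 - h) \<in> borel_measurable M" "X 1 \<in> borel_measurable M" "X h \<in> borel_measurable M"
      using h by (auto intro!: meas)
    have "prob ?E = prob {\<omega> \<in> space M. X 1 \<omega> - X (1 - h) \<omega> \<in> ?A}" by simp
    also have "\<dots> = prob {\<omega> \<in> space M. X h \<omega> \<in> ?A}"
      by (rule prob_law_cong[OF _ _ _ A]) (use increment_law[of "1 - h" 1] h in simp_all)
    also have "\<dots> = prob {\<omega> \<in> space M. h powr (1/\<alpha>) * X 1 \<omega> \<in> ?A}" by (rule prob_scaling[OF h(1) A])
    also have "\<dots> \<le> prob {\<omega> \<in> space M. R < \<bar>X 1 \<omega>\<bar>}"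
    proof (rule finite_measure_mono)
      show "{\<omega> \<in> space M. h powr (1/\<alpha>) * X 1 \<omega> \<in> ?A} \<subseteq> {\<omega> \<in> space M. R < \<bar>X 1 \<omega>\<bar>}"
      proof
        fix \<omega> assume w: "\<omega> \<in> {\<omega> \<in> space M. h powr (1/\<alpha>) * X 1 \<omega> \<in> ?A}"
        define c where "c = real (Suc n) powr (1/\<alpha>)"
        have c: "c > 0" by (simp add: c_def del: of_nat_Suc)
        have "\<epsilon> < \<bar>1 / c * X 1 \<omega>\<bar>" using w hp by (simp add: c_def)
        also have "\<dots> = \<bar>X 1 \<omega>\<bar> / c" using c by (simp add: abs_mult)
        finally have "\<epsilon> * c < \<bar>X 1 \<omega>\<bar>" using c by (simp add: pos_less_divide_eq)
        moreover have "R \<le> \<epsilon> * c" using hR e by (simp add: c_def pos_divide_le_eq mult.commute)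
        ultimately show "\<omega> \<in> {\<omega> \<in> space M. R < \<bar>X 1 \<omega>\<bar>}" using w by simp
      qed
    qed measurable
    finally have "prob ?E \<le> \<eta>" using R by simp
    moreover have "?E \<in> events" by measurable
    moreover have "{\<omega> \<in> space M. \<not> (\<exists>n\<ge>N. \<bar>X 1 \<omega> - X (1 - 1 / real (Suc n)) \<omega>\<bar> \<le> \<epsilon>)} \<subseteq> ?E"
    proof
      fix \<omega> assume w: "\<omega> \<in> {\<omega> \<in> space M. \<not> (\<exists>n\<ge>N. \<bar>X 1 \<omega> - X (1 - 1 / real (Suc n)) \<omega>\<bar> \<le> \<epsilon>)}"
      moreover have "N \<le> n" by (simp add: n_def)
      ultimately have "\<not> \<bar>X 1 \<omega> - X (1 - 1 / real (Suc n)) \<omega>\<bar> \<le> \<epsilon>" by blast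
      then show "\<omega> \<in> ?E" using w by (simp add: h_def)
    qed
    ultimately show "\<exists>E\<in>events. prob E \<le> \<eta> \<and>
        {\<omega> \<in> space M. \<not> (\<exists>n\<ge>N. \<bar>X 1 \<omega> - X (1 - 1 / real (Suc n)) \<omega>\<bar> \<le> \<epsilon>)} \<subseteq> E"
      by (intro bexI[of _ ?E] conjI)
  qed
qed

lemma no_atom:
  assumes c: "0 < c" shows "prob {\<omega> \<in> space M. X c \<omega> \<in> {a}} = 0"
proof -
  have "prob {\<omega> \<in> space M. X c \<omega> \<in> {a}} = prob {\<omega> \<in> space M. c powr (1/\<alpha>) * X 1 \<omega> \<in> {a}}"
    by (rule prob_scaling) (use c in simp_all)
  also have "{\<omega> \<in> space M. c powr (1/\<alpha>) * X 1 \<omega> \<in> {a}} = {\<omega> \<in> space M. X 1 \<omega> = a / c powr (1/\<alpha>)}"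
    using c by (auto simp: field_simps)
  finally show ?thesis using no_atom_1 by simp
qed

text \<open>Conditioning on \<open>S\<close>, the event says that \<open>V\<close> lies in an interval of length \<open>2 \<delta>\<close>.  The bound is
  uniform in \<open>S\<close>, so that it survives the passage from grids to intervals.\<close>
lemma increment_plus_independent_small:
  assumes c: "0 < c" and \<eta>: "\<eta> > 0"
  shows "\<exists>\<delta>>0. \<forall>V S. indep_var borel V borel S \<longrightarrow> distr M borel V = distr M borel (X c) \<longrightarrow>
    prob {\<omega> \<in> space M. \<bar>V \<omega> + S \<omega>\<bar> < \<delta>} \<le> \<eta>"
proof -
  define D where "D = distr M borel (X c)"
  have mc [measurable]: "X c \<in> borel_measurable M" using c by (intro meas) simp
  interpret D: real_distribution D unfolding D_def by simp
  have "measure D {a} = 0" for a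
    using no_atom[OF c, of a] by (simp add: D_def measure_distr vimage_def Int_def conj_commute)
  then obtain \<delta> where \<delta>: "\<delta> > 0" "\<And>s. measure D {s-\<delta>..s+\<delta>} \<le> \<eta>"
    using D.concentration_small[OF _ \<eta>] by blast
  have "prob {\<omega> \<in> space M. \<bar>V \<omega> + S \<omega>\<bar> < \<delta>} \<le> \<eta>"
    if ind: "indep_var borel V borel S" and V: "distr M borel V = distr M borel (X c)" for V S
  proof -
    have [measurable]: "V \<in> borel_measurable M" "S \<in> borel_measurable M"
      using indep_var_rv1[OF ind] indep_var_rv2[OF ind] by simp_all
    define L where "L = distr M borel S"
    interpret L: real_distribution L unfolding L_def by simp
    let ?A = "{y::real. \<bar>y\<bar> < \<delta>}"
    have A: "?A \<in> sets borel" by measurable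
    have "emeasure M {\<omega> \<in> space M. \<bar>V \<omega> + S \<omega>\<bar> < \<delta>} = emeasure (distr M borel (\<lambda>\<omega>. V \<omega> + S \<omega>)) ?A"
      using A by (subst emeasure_distr) (auto intro!: arg_cong2[where f = emeasure])
    also have "distr M borel (\<lambda>\<omega>. V \<omega> + S \<omega>) = convolution D L"
      using sum_indep_random_variable[OF ind] by (simp add: V L_def D_def)
    also have "\<dots> = convolution L D"
      by (rule convolution_commutative) (simp_all add: D.finite_measure_axioms L.finite_measure_axioms)
    also have "emeasure (convolution L D) ?A = (\<integral>\<^sup>+y. emeasure D {a. a + y \<in> ?A} \<partial>L)"
      by (rule convolution_emeasure[OF A]) (simp_all add: D.finite_measure_axioms L.finite_measure_axioms)
    also have "\<dots> \<le> (\<integral>\<^sup>+y. ennreal \<eta> \<partial>L)"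
    proof (rule nn_integral_mono)
      fix y
      have "emeasure D {a. a + y \<in> ?A} \<le> emeasure D {- y - \<delta>..- y + \<delta>}"
        by (rule emeasure_mono) (auto simp: D.events_eq_borel)
      also have "\<dots> \<le> ennreal \<eta>" using \<delta>(2)[of "- y"] by (simp add: D.emeasure_eq_measure ennreal_leI)
      finally show "emeasure D {a. a + y \<in> ?A} \<le> ennreal \<eta>" .
    qed
    also have "\<dots> = ennreal \<eta>" using L.emeasure_space_1 by simp
    finally show ?thesis using \<eta> by (simp add: emeasure_eq_measure)
  qed
  with \<delta>(1) show ?thesis by blast
qed

text \<open>Minima over the two grids, relative to the values at \<open>q\<close> and \<open>r\<close>, are functions of the grid
  increments other than the one from \<open>q\<close> to \<open>r\<close>.\<close>
lemma separated_minima_grid_indep: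
  assumes ord: "0 \<le> p" "p < q" "q < r" "r < s"
  defines "P \<equiv> \<lambda>N i. p + (q - p) * real i / real (Suc N)" and "R \<equiv> \<lambda>N i. r + (s - r) * real i / real (Suc N)"
  shows "indep_var borel (\<lambda>\<omega>. X r \<omega> - X q \<omega>) borel
    (\<lambda>\<omega>. Min ((\<lambda>i. X (R N i) \<omega> - X r \<omega>) ` {..Suc N}) - Min ((\<lambda>i. X (P N i) \<omega> - X q \<omega>) ` {..Suc N}))"
proof -
  define n where "n = Suc N"
  \<comment> \<open>The increment with index \<open>n\<close> is the one from \<open>q\<close> to \<open>r\<close>.\<close>
  define \<theta> where "\<theta> i = (if i \<le> n then P N i else R N (i - Suc n))" for i
  have P0: "P N n = q" and R0: "R N 0 = r" by (simp_all add: P_def R_def n_def del: of_nat_Suc)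
  have P_mono: "P N i \<le> P N j" if "i \<le> j" for i j
    using that ord by (simp add: P_def divide_right_mono mult_left_mono del: of_nat_Suc)
  have R_mono: "R N i \<le> R N j" if "i \<le> j" for i j
    using that ord by (simp add: R_def divide_right_mono mult_left_mono del: of_nat_Suc)
  have \<theta>_0: "0 \<le> \<theta> 0" using ord by (simp add: \<theta>_def P_def)
  have \<theta>_Suc: "\<theta> i \<le> \<theta> (Suc i)" for i
  proof -
    consider "Suc i \<le> n" | "i = n" | "n < i" by linarith
    then show ?thesis
    proof cases
      case 1 then show ?thesis by (simp add: \<theta>_def P_mono)
    next
      case 2 then show ?thesis using P0 R0 ord by (simp add: \<theta>_def)
    next
      case 3 then show ?thesis by (simp add: \<theta>_def R_mono)
    qed
  qed
  define Z where "Z i \<omega> = X (\<theta> (Suc i)) \<omega> - X (\<theta> i) \<omega>" for i \<omega>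
  define I where "I = {..<2 * n + 1}"
  have ind: "indep_vars (\<lambda>_. borel) Z I" unfolding Z_def[abs_def] I_def
    by (rule increments_indep[OF \<theta>_0 \<theta>_Suc])
  define J where "J = I - {n}"
  have "indep_var (PiM {n} (\<lambda>_. borel)) (\<lambda>\<omega>. restrict (\<lambda>i. Z i \<omega>) {n}) (PiM J (\<lambda>_. borel)) (\<lambda>\<omega>. restrict (\<lambda>i. Z i \<omega>) J)"
    by (rule indep_var_restrict[OF ind]) (auto simp: J_def I_def)
  moreover define F where "F z = Min ((\<lambda>j. \<Sum>l\<in>{Suc n..<Suc n + j}. z l) ` {..n}) - Min ((\<lambda>i. - (\<Sum>l\<in>{i..<n}. z l)) ` {..n})" for z :: "nat \<Rightarrow> real"
  have "(\<lambda>z. z n) \<in> measurable (PiM {n} (\<lambda>_. borel)) borel" by (rule measurable_component_singleton) simp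
  moreover have "F \<in> measurable (PiM J (\<lambda>_. borel)) borel"
    unfolding F_def
    by (intro borel_measurable_diff borel_measurable_Min borel_measurable_uminus borel_measurable_sum
        measurable_component_singleton) (auto simp: J_def I_def)
  ultimately have "indep_var borel ((\<lambda>z. z n) \<circ> (\<lambda>\<omega>. restrict (\<lambda>i. Z i \<omega>) {n})) borel (F \<circ> (\<lambda>\<omega>. restrict (\<lambda>i. Z i \<omega>) J))"
    by (rule indep_var_compose)
  moreover have "(\<lambda>z. z n) \<circ> (\<lambda>\<omega>. restrict (\<lambda>i. Z i \<omega>) {n}) = (\<lambda>\<omega>. X r \<omega> - X q \<omega>)"
    using P0 R0 by (auto simp: fun_eq_iff Z_def \<theta>_def)
  moreover have "F \<circ> (\<lambda>\<omega>. restrict (\<lambda>i. Z i \<omega>) J) =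
    (\<lambda>\<omega>. Min ((\<lambda>i. X (R N i) \<omega> - X r \<omega>) ` {..Suc N}) - Min ((\<lambda>i. X (P N i) \<omega> - X q \<omega>) ` {..Suc N}))"
  proof
    fix \<omega>
    have tele: "(\<Sum>l\<in>{a..<b}. Z l \<omega>) = X (\<theta> b) \<omega> - X (\<theta> a) \<omega>" if "a \<le> b" for a b
      unfolding Z_def using sum_Suc_diff'[OF that, of "\<lambda>i. X (\<theta> i) \<omega>"] .
    have 1: "(\<Sum>l\<in>{Suc n..<Suc n + j}. restrict (\<lambda>i. Z i \<omega>) J l) = X (R N j) \<omega> - X r \<omega>" if "j \<le> n" for j
    proof -
      have "(\<Sum>l\<in>{Suc n..<Suc n + j}. restrict (\<lambda>i. Z i \<omega>) J l) = (\<Sum>l\<in>{Suc n..<Suc n + j}. Z l \<omega>)"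
        by (rule sum.cong) (use that in \<open>auto simp: J_def I_def\<close>)
      then show ?thesis using tele[of "Suc n" "Suc n + j"] R0 by (simp add: \<theta>_def)
    qed
    have 2: "- (\<Sum>l\<in>{i..<n}. restrict (\<lambda>i. Z i \<omega>) J l) = X (P N i) \<omega> - X q \<omega>" if "i \<le> n" for i
    proof -
      have "(\<Sum>l\<in>{i..<n}. restrict (\<lambda>i. Z i \<omega>) J l) = (\<Sum>l\<in>{i..<n}. Z l \<omega>)"
        by (rule sum.cong) (auto simp: J_def I_def)
      then show ?thesis using tele[of i n] that P0 by (simp add: \<theta>_def)
    qed
    have "(\<lambda>j. \<Sum>l\<in>{Suc n..<Suc n + j}. restrict (\<lambda>i. Z i \<omega>) J l) ` {..n} = (\<lambda>i. X (R N i) \<omega> - X r \<omega>) ` {..n}"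
      by (rule image_cong[OF refl 1]) simp
    moreover have "(\<lambda>i. - (\<Sum>l\<in>{i..<n}. restrict (\<lambda>i. Z i \<omega>) J l)) ` {..n} = (\<lambda>i. X (P N i) \<omega> - X q \<omega>) ` {..n}"
      by (rule image_cong[OF refl 2]) simp
    ultimately show "(F \<circ> (\<lambda>\<omega>. restrict (\<lambda>i. Z i \<omega>) J)) \<omega> =
       Min ((\<lambda>i. X (R N i) \<omega> - X r \<omega>) ` {..Suc N}) - Min ((\<lambda>i. X (P N i) \<omega> - X q \<omega>) ` {..Suc N})"
      unfolding F_def comp_def n_def by (simp only:)
  qed
  ultimately show ?thesis by simp
qed

lemma AE_cadlag: "AE \<omega> in M. cadlag_on_halfline (\<lambda>t. X t \<omega>)"
  using levy by (simp add: levy_process_def)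

lemma AE_skip_free: "AE \<omega> in M. skip_free_path (\<lambda>t. X t \<omega>)"
proof -
  have "AE \<omega> in M. \<forall>t>0. left_lim (\<lambda>s. X s \<omega>) t \<le> X t \<omega>"
    using stable by (simp add: spectrally_positive_stable_levy_def spectrally_positive_def)
  with AE_cadlag show ?thesis
    by eventually_elim (auto simp: skip_free_path_def)
qed

text \<open>The difference of the infima is the limit of \<open>V + S N\<close>, where \<open>V\<close> is the increment over the gap
  and \<open>S N\<close> is independent of it.\<close>
lemma distinct_minima:
  assumes ord: "0 \<le> p" "p < q" "q < r" "r < s"
  shows "AE \<omega> in M. (INF w\<in>{p..q}. X w \<omega>) \<noteq> (INF w\<in>{r..s}. X w \<omega>)"
proof -
  define P where "P = (\<lambda>N i. p + (q - p) * real i / real (Suc N))"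
  define R where "R = (\<lambda>N i. r + (s - r) * real i / real (Suc N))"
  define V where "V \<omega> = X r \<omega> - X q \<omega>" for \<omega>
  define S where "S N \<omega> = Min ((\<lambda>i. X (R N i) \<omega> - X r \<omega>) ` {..Suc N}) - Min ((\<lambda>i. X (P N i) \<omega> - X q \<omega>) ` {..Suc N})" for N \<omega>
  have ind: "indep_var borel V borel (S N)" for N
    unfolding V_def[abs_def] S_def[abs_def] P_def R_def by (rule separated_minima_grid_indep[OF ord])
  have V: "distr M borel V = distr M borel (X (r - q))"
    unfolding V_def[abs_def] by (rule increment_law) (use ord in simp_all)
  have [measurable]: "V \<in> borel_measurable M" "S N \<in> borel_measurable M" for N
    using indep_var_rv1[OF ind[of 0]] indep_var_rv2[OF ind[of N]] by simp_all
  have lim: "(\<lambda>N. V \<omega> + S N \<omega>) \<longlonglongrightarrow> (INF w\<in>{r..s}. X w \<omega>) - (INF w\<in>{p..q}. X w \<omega>)"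
    if "skip_free_path (\<lambda>t. X t \<omega>)" for \<omega>
  proof -
    interpret skip_free_path "\<lambda>t. X t \<omega>" by (rule that)
    have b: "bdd_below ((\<lambda>t. X t \<omega>) ` {a..b})" if "0 \<le> a" for a b
      by (rule bdd_below_mono[OF bdd_below_on[of b]]) (use that in auto)
    have eq: "V \<omega> + S N \<omega> = Min ((\<lambda>i. X (R N i) \<omega>) ` {..Suc N}) - Min ((\<lambda>i. X (P N i) \<omega>) ` {..Suc N})" for N
    proof -
      have sh: "Min ((\<lambda>i. g i - k) ` {..Suc N}) = Min (g ` {..Suc N}) - k" for g :: "nat \<Rightarrow> real" and k
        using Min_add_commute[of "{..Suc N}" g "- k"] by simp
      show ?thesis unfolding S_def V_def sh by simp
    qed
    show ?thesis unfolding eq P_def R_def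
      by (intro tendsto_diff grid_minimum_tendsto b right_tendsto) (use ord in simp_all)
  qed
  have "AE \<omega> in M. skip_free_path (\<lambda>t. X t \<omega>) \<longrightarrow> (INF w\<in>{p..q}. X w \<omega>) \<noteq> (INF w\<in>{r..s}. X w \<omega>)"
  proof (rule AE_if_small_exceptions)
    fix \<eta> :: real assume \<eta>: "\<eta> > 0"
    have rq: "0 < r - q" using ord by simp
    obtain \<delta> where \<delta>: "\<delta> > 0" and small: "\<And>V S. indep_var borel V borel S \<Longrightarrow> distr M borel V = distr M borel (X (r - q)) \<Longrightarrow>
      prob {\<omega> \<in> space M. \<bar>V \<omega> + S \<omega>\<bar> < \<delta>} \<le> \<eta>"
      using increment_plus_independent_small[OF rq \<eta>] by blast
    define B where "B N = {\<omega> \<in> space M. \<bar>V \<omega> + S N \<omega>\<bar> < \<delta>}" for N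
    \<comment> \<open>If the limit is 0, the chance point lies in all but finitely many of the \<open>B N\<close>.\<close>
    define C where "C m = (\<Inter>N\<in>{m..}. B N)" for m
    have [measurable]: "B N \<in> events" for N unfolding B_def by measurable
    have C: "C m \<in> events" for m unfolding C_def by (intro sets.countable_INT') auto
    have "prob (C m) \<le> \<eta>" for m
    proof -
      have "prob (C m) \<le> prob (B m)" by (rule finite_measure_mono) (auto simp: C_def)
      then show ?thesis using small[OF ind V, of m] by (simp add: B_def)
    qed
    moreover have "(\<lambda>m. prob (C m)) \<longlonglongrightarrow> prob (\<Union>m. C m)"
      by (rule finite_Lim_measure_incseq) (use C in \<open>auto simp: incseq_def C_def\<close>)
    ultimately have "prob (\<Union>m. C m) \<le> \<eta>" by (intro LIMSEQ_le_const2) auto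
    moreover have "(\<Union>m. C m) \<in> events" using C by auto
    moreover have "{\<omega> \<in> space M. \<not> (skip_free_path (\<lambda>t. X t \<omega>) \<longrightarrow> (INF w\<in>{p..q}. X w \<omega>) \<noteq> (INF w\<in>{r..s}. X w \<omega>))} \<subseteq> (\<Union>m. C m)"
    proof
      fix \<omega> assume w: "\<omega> \<in> {\<omega> \<in> space M. \<not> (skip_free_path (\<lambda>t. X t \<omega>) \<longrightarrow> (INF w\<in>{p..q}. X w \<omega>) \<noteq> (INF w\<in>{r..s}. X w \<omega>))}"
      then have "(\<lambda>N. V \<omega> + S N \<omega>) \<longlonglongrightarrow> 0" using lim[of \<omega>] by simp
      from tendstoD[OF this \<delta>] obtain m where "\<And>N. N \<ge> m \<Longrightarrow> \<bar>V \<omega> + S N \<omega>\<bar> < \<delta>"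
        unfolding eventually_sequentially by auto
      then have "\<omega> \<in> C m" using w by (simp add: C_def B_def)
      then show "\<omega> \<in> (\<Union>m. C m)" by blast
    qed
    ultimately show "\<exists>E\<in>events. prob E \<le> \<eta> \<and> {\<omega> \<in> space M. \<not> (skip_free_path (\<lambda>t. X t \<omega>) \<longrightarrow> (INF w\<in>{p..q}. X w \<omega>) \<noteq> (INF w\<in>{r..s}. X w \<omega>))} \<subseteq> E"
      by (intro bexI[of _ "\<Union>m. C m"] conjI)
  qed
  with AE_skip_free show ?thesis by eventually_elim blast
qed

lemma AE_distinct_minima:
  "AE \<omega> in M. \<forall>p\<in>\<rat>. \<forall>q\<in>\<rat>. \<forall>r\<in>\<rat>. \<forall>s\<in>\<rat>. 0 \<le> p \<longrightarrow> p < q \<longrightarrow> q < r \<longrightarrow> r < s \<longrightarrow>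
     (INF w\<in>{p..q}. X w \<omega>) \<noteq> (INF w\<in>{r..s}. X w \<omega>)"
  by (intro AE_ball_countable[THEN iffD2, OF countable_rat] ballI AE_impI distinct_minima)

section \<open>Almost every time is a dip\<close>

text \<open>The process at the first point of the grid of mesh \<open>1 / (n+1)\<close> strictly after \<open>t\<close>; sampling from
  the right is compatible with right continuity.\<close>
definition sample :: "nat \<Rightarrow> real \<Rightarrow> 'a \<Rightarrow> real" where
  "sample n t \<omega> = X ((real (nat \<lfloor>real (Suc n) * t\<rfloor>) + 1) / real (Suc n)) \<omega>"

text \<open>A jointly measurable version of the process, as needed for Fubini's theorem; along cadlag paths
  it agrees with \<open>X\<close>.\<close>
definition regular :: "real \<Rightarrow> 'a \<Rightarrow> real" where
  "regular t \<omega> = lim (\<lambda>n. sample n t \<omega>)"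

lemma measurable_sample: "(\<lambda>z. sample n (fst z) (snd z)) \<in> borel_measurable (borel \<Otimes>\<^sub>M M)"
proof -
  have 1: "(\<lambda>z. X ((real k + 1) / real (Suc n)) (snd z)) \<in> borel_measurable (borel \<Otimes>\<^sub>M M)" for k
    by (rule measurable_compose[OF measurable_snd meas]) simp
  have 2: "(\<lambda>z::real \<times> 'a. nat \<lfloor>real (Suc n) * fst z\<rfloor>) \<in> measurable (borel \<Otimes>\<^sub>M M) (count_space UNIV)"
    by measurable
  show ?thesis unfolding sample_def by (rule measurable_compose_countable[OF 1 2])
qed

lemma measurable_regular [measurable]: "(\<lambda>z. regular (fst z) (snd z)) \<in> borel_measurable (borel \<Otimes>\<^sub>M M)"
  unfolding regular_def by (rule borel_measurable_lim_metric[OF measurable_sample])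

lemma regular_eq:
  assumes "cadlag_on_halfline (\<lambda>t. X t \<omega>)" and t: "0 \<le> t"
  shows "regular t \<omega> = X t \<omega>"
proof -
  define u where "u n = (real (nat \<lfloor>real (Suc n) * t\<rfloor>) + 1) / real (Suc n)" for n
  have u: "t < u n" "u n \<le> t + 1 / real (Suc n)" for n
  proof -
    define k where "k = real (Suc n)"
    have k: "k > 0" by (simp add: k_def)
    have "0 \<le> k * t" using k t by simp
    then have f: "real (nat \<lfloor>k * t\<rfloor>) \<le> k * t" "k * t < real (nat \<lfloor>k * t\<rfloor>) + 1" by linarith+
    have un: "u n = (real (nat \<lfloor>k * t\<rfloor>) + 1) / k" by (simp add: u_def k_def)
    show "t < u n" unfolding un using f k by (simp add: pos_less_divide_eq mult.commute)
    have "u n \<le> (k * t + 1) / k" unfolding un using f k by (intro divide_right_mono) simp_all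
    also have "\<dots> = t + 1 / k" using k by (simp add: add_divide_distrib)
    finally show "u n \<le> t + 1 / real (Suc n)" by (simp add: k_def)
  qed
  have "u \<longlonglongrightarrow> t"
  proof (rule tendsto_sandwich[of "\<lambda>_. t" u _ "\<lambda>n. t + 1 / real (Suc n)"])
    have "(\<lambda>n. t + 1 / real (Suc n)) \<longlonglongrightarrow> t + 0"
      by (intro tendsto_add tendsto_const LIMSEQ_Suc[OF lim_1_over_n])
    then show "(\<lambda>n. t + 1 / real (Suc n)) \<longlonglongrightarrow> t" by simp
  qed (use u in \<open>auto intro!: always_eventually less_imp_le\<close>)
  then have "filterlim u (at_right t) sequentially"
    unfolding filterlim_at using u(1) by (auto intro!: always_eventually simp: less_imp_neq[symmetric])
  moreover have "((\<lambda>t. X t \<omega>) \<longlongrightarrow> X t \<omega>) (at_right t)"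
    using assms unfolding cadlag_on_halfline_def by blast
  ultimately have "(\<lambda>n. X (u n) \<omega>) \<longlonglongrightarrow> X t \<omega>" using filterlim_compose by blast
  then show ?thesis unfolding regular_def sample_def u_def by (rule limI)
qed

text \<open>A version of \<open>dips_at\<close> that is measurable jointly in time and chance.\<close>
definition dips_rationally :: "real \<Rightarrow> 'a \<Rightarrow> bool" where
  "dips_rationally t \<omega> \<longleftrightarrow> (\<forall>m::nat. (\<exists>q::rat. 0 < real_of_rat q \<and> real_of_rat q < 1 / real (Suc m) \<and> regular (t + real_of_rat q) \<omega> < regular t \<omega>) \<and>
     (\<exists>q::rat. 0 < real_of_rat q \<and> real_of_rat q < 1 / real (Suc m) \<and> real_of_rat q < t \<and> regular (t - real_of_rat q) \<omega> < regular t \<omega>))"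

lemma pred_dips_rationally: "Measurable.pred (borel \<Otimes>\<^sub>M M) (\<lambda>z. dips_rationally (fst z) (snd z))"
proof -
  have [measurable]: "(\<lambda>z. regular (fst z + c) (snd z)) \<in> borel_measurable (borel \<Otimes>\<^sub>M M)" for c
  proof -
    have "(\<lambda>z::real \<times> 'a. (fst z + c, snd z)) \<in> measurable (borel \<Otimes>\<^sub>M M) (borel \<Otimes>\<^sub>M M)" by measurable
    from measurable_compose[OF this measurable_regular] show ?thesis by simp
  qed
  have [measurable]: "(\<lambda>z. regular (fst z - c) (snd z)) \<in> borel_measurable (borel \<Otimes>\<^sub>M M)" for c
  proof -
    have "(\<lambda>z::real \<times> 'a. (fst z - c, snd z)) \<in> measurable (borel \<Otimes>\<^sub>M M) (borel \<Otimes>\<^sub>M M)" by measurable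
    from measurable_compose[OF this measurable_regular] show ?thesis by simp
  qed
  show ?thesis unfolding dips_rationally_def by measurable
qed

lemma rational_right_of:
  assumes "cadlag_on_halfline (\<lambda>t. X t \<omega>)" and s: "0 \<le> s" "s < b" "X s \<omega> < c"
  obtains q where "q \<in> \<rat>" "s < z + q" "z + q < b" "X (z + q) \<omega> < c"
proof -
  have "((\<lambda>t. X t \<omega>) \<longlongrightarrow> X s \<omega>) (at_right s)"
    using assms unfolding cadlag_on_halfline_def by blast
  then have "\<forall>\<^sub>F w in at_right s. X w \<omega> < c" by (rule order_tendstoD(2)) (rule s)
  then obtain d where d: "s < d" "\<And>w. s < w \<Longrightarrow> w < d \<Longrightarrow> X w \<omega> < c"
    unfolding eventually_at_right_field by blast
  have "s - z < min b d - z" using s d by simp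
  then obtain q where q: "q \<in> \<rat>" "s - z < q" "q < min b d - z" using Rats_dense_in_real by blast
  then show ?thesis using that[of q] d(2)[of "z + q"] by simp
qed

lemma AE_dips_rationally:
  assumes t: "0 < t"
  shows "AE \<omega> in M. dips_rationally t \<omega>"
proof -
  have t0: "0 \<le> t" using t by simp
  from AE_cadlag dips_right[OF t0] dips_left[OF t] show ?thesis
  proof eventually_elim
    case (elim \<omega>)
    note reg = regular_eq[OF elim(1)]
    show ?case unfolding dips_rationally_def
    proof (intro allI conjI)
      fix m
      have e: "0 < 1 / real (Suc m)" by simp
      show "\<exists>q::rat. 0 < real_of_rat q \<and> real_of_rat q < 1 / real (Suc m) \<and> regular (t + real_of_rat q) \<omega> < regular t \<omega>"
      proof -
        obtain s where s: "t < s" "s < t + 1 / real (Suc m)" "X s \<omega> < X t \<omega>" using elim(2) e by blast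
        have s0: "0 \<le> s" using s t by simp
        obtain q where q: "q \<in> \<rat>" "s < t + q" "t + q < t + 1 / real (Suc m)" "X (t + q) \<omega> < X t \<omega>"
          by (rule rational_right_of[OF elim(1) s0 s(2,3)])
        obtain q' where q': "q = real_of_rat q'" using q(1) by (rule Rats_cases)
        have "0 < q" "q < 1 / real (Suc m)" using q s by linarith+
        moreover have "regular (t + q) \<omega> < regular t \<omega>" using q s0 t reg[of t] reg[of "t + q"] by simp
        ultimately show ?thesis unfolding q' by blast
      qed
      show "\<exists>q::rat. 0 < real_of_rat q \<and> real_of_rat q < 1 / real (Suc m) \<and> real_of_rat q < t \<and> regular (t - real_of_rat q) \<omega> < regular t \<omega>"
      proof -
        obtain s where s: "0 \<le> s" "t - 1 / real (Suc m) < s" "s < t" "X s \<omega> < X t \<omega>" using elim(3) e by blast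
        obtain q where q: "q \<in> \<rat>" "s < t + q" "t + q < t" "X (t + q) \<omega> < X t \<omega>"
          by (rule rational_right_of[OF elim(1) s(1,3,4)])
        have "- q \<in> \<rat>" using q(1) by simp
        then obtain q' where q': "- q = real_of_rat q'" by (rule Rats_cases)
        have "0 < - q" "- q < 1 / real (Suc m)" "- q < t" using q s by linarith+
        moreover have "regular (t - (- q)) \<omega> < regular t \<omega>" using q s t reg[of t] reg[of "t + q"] by simp
        ultimately show ?thesis unfolding q' by blast
      qed
    qed
  qed
qed

lemma AE_AE_dips: "AE \<omega> in M. AE t in lborel. 0 < t \<longrightarrow> dips_at (\<lambda>t. X t \<omega>) t"
proof -
  interpret pair: pair_sigma_finite lborel M ..
  have "Measurable.pred (borel \<Otimes>\<^sub>M M) (\<lambda>z. 0 < fst z \<longrightarrow> dips_rationally (fst z) (snd z))"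
    using pred_dips_rationally by measurable
  then have "Measurable.pred (lborel \<Otimes>\<^sub>M M) (\<lambda>z. 0 < fst z \<longrightarrow> dips_rationally (fst z) (snd z))"
    by (simp cong: measurable_cong_sets add: sets_pair_measure_cong[OF sets_lborel refl])
  then have m: "{z \<in> space (lborel \<Otimes>\<^sub>M M). 0 < fst z \<longrightarrow> dips_rationally (fst z) (snd z)} \<in> sets (lborel \<Otimes>\<^sub>M M)"
    by (simp add: pred_def)
  have "AE t in lborel. AE \<omega> in M. 0 < t \<longrightarrow> dips_rationally t \<omega>"
    by (intro AE_I2 AE_impI AE_dips_rationally)
  then have "AE \<omega> in M. AE t in lborel. 0 < t \<longrightarrow> dips_rationally t \<omega>"
    by (subst (asm) pair.AE_commute[OF m])
  with AE_cadlag show ?thesis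
  proof eventually_elim
    case (elim \<omega>)
    note reg = regular_eq[OF elim(1)]
    have d: "dips_at (\<lambda>t. X t \<omega>) t" if t: "0 < t" "dips_rationally t \<omega>" for t
      unfolding dips_at_def
    proof (intro conjI allI impI)
      fix a assume "a < t"
      then obtain m where m: "1 / real (Suc m) < t - a" using nat_approx_posE[of "t - a"] by auto
      obtain q where q: "0 < real_of_rat q" "real_of_rat q < 1 / real (Suc m)" "real_of_rat q < t" "regular (t - real_of_rat q) \<omega> < regular t \<omega>"
        using t(2) unfolding dips_rationally_def by blast
      have "a < t - real_of_rat q" using q m by linarith
      moreover have "X (t - real_of_rat q) \<omega> < X t \<omega>" using q t reg[of t] reg[of "t - real_of_rat q"] by simp
      ultimately show "\<exists>w\<in>{a<..<t}. X w \<omega> < X t \<omega>" using q by (intro bexI[of _ "t - real_of_rat q"]) simp_all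
    next
      fix b assume "t < b"
      then obtain m where m: "1 / real (Suc m) < b - t" using nat_approx_posE[of "b - t"] by auto
      obtain q where q: "0 < real_of_rat q" "real_of_rat q < 1 / real (Suc m)" "regular (t + real_of_rat q) \<omega> < regular t \<omega>"
        using t(2) unfolding dips_rationally_def by blast
      have "t + real_of_rat q < b" using q m by linarith
      moreover have "X (t + real_of_rat q) \<omega> < X t \<omega>" using q t reg[of t] reg[of "t + real_of_rat q"] by simp
      ultimately show "\<exists>w\<in>{t<..<b}. X w \<omega> < X t \<omega>" using q by (intro bexI[of _ "t + real_of_rat q"]) simp_all
    qed
    from elim(2) show ?case by eventually_elim (use d in blast)
  qed
qed

text \<open>The left limit at 1 equals \<open>X 1\<close> because, by \<open>no_fixed_jump\<close>, the values at \<open>1 - 1/(n+1)\<close> come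
  arbitrarily close to \<open>X 1\<close> infinitely often.\<close>
lemma AE_straddling: "AE \<omega> in M. straddling_path (\<lambda>t. X t \<omega>)"
proof -
  have "AE \<omega> in M. \<forall>\<epsilon>>0. \<exists>s. 0 \<le> s \<and> 1 - \<epsilon> < s \<and> s < 1 \<and> X s \<omega> < X 1 \<omega>"
    by (rule dips_left) simp
  with AE_skip_free no_fixed_jump unbounded_below_paths show ?thesis
  proof eventually_elim
    case (elim \<omega>)
    interpret skip_free_path "\<lambda>t. X t \<omega>" by (rule elim(1))
    let ?p = "\<lambda>t. X t \<omega>"
    show ?case
    proof
      show "\<exists>s. 0 \<le> s \<and> s < 1 \<and> X s \<omega> < X 1 \<omega>" using elim(4) zero_less_one by blast
      show "\<exists>s\<ge>1. X s \<omega> < (INF u\<in>{0..1}. X u \<omega>)"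
      proof -
        obtain b :: nat where "- (INF u\<in>{0..1}. X u \<omega>) \<le> real b" using real_arch_simple by blast
        then have "- real b \<le> (INF u\<in>{0..1}. X u \<omega>)" by simp
        moreover obtain s where "s \<ge> 1" "X s \<omega> < - real b" using elim(3) by blast
        ultimately show ?thesis by (intro exI[of _ s]) simp
      qed
      show "left_lim ?p 1 = X 1 \<omega>"
      proof (rule ccontr)
        define l where "l = left_lim ?p 1"
        assume "left_lim ?p 1 \<noteq> X 1 \<omega>"
        then have "0 < \<bar>X 1 \<omega> - l\<bar> / 2" by (simp add: l_def)
        then obtain m where m: "1 / real (Suc m) < \<bar>X 1 \<omega> - l\<bar> / 2" by (rule nat_approx_posE)
        have "(?p \<longlongrightarrow> l) (at_left 1)" unfolding l_def by (rule left_tendsto) simp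
        from tendstoD[OF this \<open>0 < \<bar>X 1 \<omega> - l\<bar> / 2\<close>]
        obtain a where a: "a < 1" "\<And>w. a < w \<Longrightarrow> w < 1 \<Longrightarrow> dist (X w \<omega>) l < \<bar>X 1 \<omega> - l\<bar> / 2"
          unfolding eventually_at_left_field by blast
        obtain N where N: "1 / real (Suc N) < 1 - a" using nat_approx_posE[of "1 - a"] a by auto
        obtain n where n: "n \<ge> N" "\<bar>X 1 \<omega> - X (1 - 1 / real (Suc n)) \<omega>\<bar> \<le> 1 / real (Suc m)"
          using elim(2) by blast
        define w where "w = 1 - 1 / real (Suc n)"
        have "1 / real (Suc n) \<le> 1 / real (Suc N)" using n by (intro divide_left_mono) simp_all
        then have "a < w" using N unfolding w_def by linarith
        moreover have "w < 1" by (simp add: w_def)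
        ultimately have "\<bar>X w \<omega> - l\<bar> < \<bar>X 1 \<omega> - l\<bar> / 2" using a(2)[of w] by (simp add: dist_real_def)
        moreover have "\<bar>X 1 \<omega> - X w \<omega>\<bar> \<le> 1 / real (Suc m)" using n(2) unfolding w_def .
        moreover have "\<bar>X 1 \<omega> - l\<bar> \<le> \<bar>X 1 \<omega> - X w \<omega>\<bar> + \<bar>X w \<omega> - l\<bar>"
          using abs_triangle_ineq[of "X 1 \<omega> - X w \<omega>" "X w \<omega> - l"] by simp
        ultimately show False using m by argo
      qed
    qed
  qed
qed

end

section \<open>The stable tree is binary, and its measure charges its dense set of leaves\<close>

theorem proposition1p4:
  fixes M :: "'a measure" and X :: "real \<Rightarrow> 'a \<Rightarrow> real" and \<alpha> :: real
  assumes "1 < \<alpha>" and "\<alpha> < 2"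
    and "spectrally_positive_stable_levy M \<alpha> X"
  shows "AE \<omega> in M.
    (let x = normalized_excursion \<alpha> (\<lambda>t. X t \<omega>) in
      (\<exists>\<xi> \<tau>. parametric_representation x \<xi> \<tau>) \<and>
      (\<forall>\<xi> \<tau>. parametric_representation x \<xi> \<tau> \<longrightarrow>
        (\<forall>v \<in> tree_points \<xi>. tree_degree \<xi> v \<in> {1, 2, 3}) \<and>
        tree_top \<xi> closure_of tree_leaves \<xi> = tree_points \<xi> \<and>
        (\<forall>v \<in> tree_points \<xi>. emeasure (tree_measure \<xi> \<tau>) {v} = 0) \<and>
        emeasure (tree_measure \<xi> \<tau>) (tree_leaves \<xi>) = 1))"
proof -
  interpret stable_levy M X \<alpha> by unfold_locales (rule assms)+
  from AE_straddling AE_distinct_minima AE_AE_dips show ?thesis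
  proof eventually_elim
    case (elim \<omega>)
    show ?case
      by (rule straddling_path.coded_tree_properties[OF elim(1) _ elim(3)]) (use elim(2) in blast)
  qed
qed

end
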